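(* For every integer $m > 2$ and every integer $k > 1$, $\mathrm{ATIME}[\log^k n, m] \subsetneq \mathrm{ATIME}[\log^{k+2} n, m]$.
   Context: Throughout, $\log n$ denotes $\log_2 n$ and $\log^k n$ denotes $(\log n)^k$. A random-access Turing machine is a multi-tape Turing machine with a read-only random-access input of length $n+1$ (the input binary string followed by an endmark $\triangleleft$), a fixed number of read-write working tapes, and a read-write input address-tape of length $\lceil\log n\rceil$; at each step the binary number on the address-tape determines which input cell is read (the endmark cell if the number exceeds $n$). A random-access alternating Turing machine is such a machine whose states are partitioned into existential and universal states, with the usual alternating acceptance condition. $\mathrm{ATIME}[f(n), m]$ is the class of languages of binary strings accepted by a random-access alternating Turing machine that starts in an existential state, makes at most $O(f(n))$ steps on inputs of length $n$, and whose computations have at most $m$ alternating blocks of existential/universal states (i.e. at most $m-1$ alternations). *)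

theory Defs
  imports Complex_Main "HOL-Library.Landau_Symbols"
begin

datatype move = Go_Left | Stay | Go_Right

(* States and work-tape symbols are natural numbers; the symbol 0 is the blank.
   The arguments of transitions are the current state, the scanned input symbol, the scanned
   address-tape symbol and the list of scanned work-tape symbols.  Its values are the sets of
   possible actions: next state, bit written on the address tape and move of its head, and for
   each work tape the symbol written and the move of the head. *)
record ratm =
  existential :: "nat set"
  universal :: "nat set"
  start :: nat
  final :: "nat set"
  symbols :: "nat set"
  tape_count :: nat
  transitions :: "nat \<Rightarrow> bool option \<Rightarrow> bool option \<Rightarrow> nat list \<Rightarrow>
    (nat \<times> (bool \<times> move) \<times> (nat \<times> move) list) set"

definition states :: "ratm \<Rightarrow> nat set" where
  "states M = existential M \<union> universal M"

definition wf_ratm :: "ratm \<Rightarrow> bool" where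
  "wf_ratm M \<longleftrightarrow>
     finite (existential M) \<and> finite (universal M) \<and> existential M \<inter> universal M = {} \<and>
     start M \<in> states M \<and> final M \<subseteq> states M \<and>
     finite (symbols M) \<and> 0 \<in> symbols M \<and>
     (\<forall>q \<in> states M. \<forall>x y gs. length gs = tape_count M \<and> set gs \<subseteq> symbols M \<longrightarrow>
        (q \<in> final M \<longrightarrow> transitions M q x y gs = {}) \<and>
        (\<forall>(q', (b, d), acts) \<in> transitions M q x y gs.
           q' \<in> states M \<and> length acts = tape_count M \<and> fst ` set acts \<subseteq> symbols M))"

(* A work tape is infinite in both directions and is paired with its head position.
   The address tape is a finite list of bits; its head ranges over 0..length, where the
   position just past the last cell serves to recognize the end of the tape. *)
record config =
  cstate :: nat
  address :: "bool list"
  address_head :: nat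
  work :: "((int \<Rightarrow> nat) \<times> int) list"

definition address_length :: "nat \<Rightarrow> nat" where
  "address_length n = nat \<lceil>log 2 (real n)\<rceil>"

(* For the empty input log 2 0 = 0, so the address tape is empty, as it is for inputs of
   length 1; an empty address tape denotes the number 0. *)
definition init_config :: "ratm \<Rightarrow> bool list \<Rightarrow> config" where
  "init_config M w = \<lparr>cstate = start M, address = replicate (address_length (length w)) False,
     address_head = 0, work = replicate (tape_count M) (\<lambda>_. 0, 0)\<rparr>"

(* Most significant bit first. *)
definition address_value :: "bool list \<Rightarrow> nat" where
  "address_value bs = horner_sum of_bool 2 (rev bs)"

(* Cells are numbered from 0; None is the endmark, which is in the cell with number length w. *)
definition read_input :: "bool list \<Rightarrow> nat \<Rightarrow> bool option" where
  "read_input w a = (if a < length w then Some (w ! a) else None)"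

definition read_address :: "config \<Rightarrow> bool option" where
  "read_address c =
     (if address_head c < length (address c) then Some (address c ! address_head c) else None)"

definition read_work :: "config \<Rightarrow> nat list" where
  "read_work c = map (\<lambda>(t, i). t i) (work c)"

fun move_address_head :: "nat \<Rightarrow> move \<Rightarrow> nat \<Rightarrow> nat" where
  "move_address_head l Go_Left i = i - 1"
| "move_address_head l Stay i = i"
| "move_address_head l Go_Right i = min (i + 1) l"

fun move_work_head :: "move \<Rightarrow> int \<Rightarrow> int" where
  "move_work_head Go_Left i = i - 1"
| "move_work_head Stay i = i"
| "move_work_head Go_Right i = i + 1"

(* Writing just past the end of the address tape has no effect, since list_update ignores
   positions outside the list. *)
definition perform ::
  "config \<Rightarrow> nat \<times> (bool \<times> move) \<times> (nat \<times> move) list \<Rightarrow> config" where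
  "perform c = (\<lambda>(q', (b, d), acts).
     \<lparr>cstate = q', address = (address c)[address_head c := b],
      address_head = move_address_head (length (address c)) d (address_head c),
      work = map2 (\<lambda>(t, i) (g, e). (t(i := g), move_work_head e i)) (work c) acts\<rparr>)"

definition step :: "ratm \<Rightarrow> bool list \<Rightarrow> config \<Rightarrow> config \<Rightarrow> bool" where
  "step M w c c' \<longleftrightarrow>
     (\<exists>a \<in> transitions M (cstate c) (read_input w (address_value (address c)))
             (read_address c) (read_work c). c' = perform c a)"

inductive accepting :: "ratm \<Rightarrow> bool list \<Rightarrow> config \<Rightarrow> bool" for M w where
  final: "cstate c \<in> final M \<Longrightarrow> accepting M w c"
| existential: "cstate c \<in> existential M \<Longrightarrow> step M w c c' \<Longrightarrow> accepting M w c' \<Longrightarrow> accepting M w c"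
| universal: "cstate c \<in> universal M \<Longrightarrow> \<exists>c'. step M w c c' \<Longrightarrow>
    (\<And>c'. step M w c c' \<Longrightarrow> accepting M w c') \<Longrightarrow> accepting M w c"

definition accepted_language :: "ratm \<Rightarrow> bool list set" where
  "accepted_language M = {w. accepting M w (init_config M w)}"

(* A computation need not be maximal: every finite path from the initial configuration counts. *)
definition computation :: "ratm \<Rightarrow> bool list \<Rightarrow> config list \<Rightarrow> bool" where
  "computation M w cs \<longleftrightarrow> cs \<noteq> [] \<and> hd cs = init_config M w \<and> successively (step M w) cs"

(* The number of maximal blocks of consecutive configurations of the same kind. *)
definition blocks :: "ratm \<Rightarrow> config list \<Rightarrow> nat" where
  "blocks M cs = length (remdups_adj (map (\<lambda>c. cstate c \<in> existential M) cs))"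

definition ATIME :: "(nat \<Rightarrow> real) \<Rightarrow> nat \<Rightarrow> bool list set set" where
  "ATIME f m = {L. \<exists>M T. wf_ratm M \<and> start M \<in> existential M \<and> accepted_language M = L \<and>
     (\<lambda>n. real (T n)) \<in> O(f) \<and>
     (\<forall>w cs. computation M w cs \<longrightarrow> length cs - 1 \<le> T (length w) \<and> blocks M cs \<le> m)}"

end

theory Submission
  imports Defs "HOL-Library.Countable"
begin

text \<open>The separating language is a parity problem. On inputs of length \<open>2 ^ l\<close>, the machine
  of the upper bound computes the parity of \<open>s ^ m\<close> input bits, where \<open>s\<close> is at least \<open>l ^ (k + 1)\<close>,
  as a game between the existential and the universal player: whoever is to move on a block guesses the parities
  of its \<open>s\<close> subblocks, and the opponent picks the subblock for which the guess is claimed to be wrong. After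
  \<open>m - 1\<close> moves, a block of \<open>s\<close> bits is left, whose parity is computed directly. As every index is a
  counter on a segment of the address tape, the address of the current bit is always in place.

  For the lower bound, an alternating machine running in time \<open>t\<close> with \<open>m\<close> blocks is an alternating
  formula: the acceptance of a configuration at the beginning of a block is a disjunction (or, for a
  universal block, a conjunction) over the computation paths inside the block, each of which reads at most \<open>t\<close>
  bits. By Hastad's switching lemma, a random restriction turns these formulas into decision trees of
  depth \<open>O(t)\<close>, block by block, while the number of free variables drops by a factor of \<open>O(t)\<close>
  each time. If there are more than \<open>(C t) ^ m\<close> variables, a disjunctive normal form of small width is left for
  the parity of a larger number of variables, which is impossible. With \<open>t = O(l ^ k)\<close> and \<open>s \<ge> l ^ (k + 1)\<close>, the
  lower bound applies. The switching lemma is proved by Razborov's encoding of bad restrictions.\<close>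

section \<open>The switching lemma\<close>

text \<open>The two extra powers of the logarithm are spent in different places; let l be the length
  of the address tape. Counters of \<open>b = (k + 1) * digits l\<close> cells have more than
  l^(k+1) values. One factor l of this pays for all constants of the lower bound, as C t is below
  l^(k+1) for large l when t = O(l^k). The other power pays for the addressing: each of the 2^b
  rounds of a loop increments a counter of b cells, and 2^b * b is O(l^(k+2)). The length b must be
  computable by the machine itself; hence it is a multiple of the binary length of l, obtained by
  counting the cells of the address tape. The class bounds time and blocks of every computation,
  also after a losing move and on inputs of any length. The value of a configuration and its bounds
  are therefore proved together, and the machine simply gets stuck when its address tape is too
  short. The two languages are compared only at lengths 2^l where l is itself a large power of two:
  there every address names an input bit, not the endmark, and \<open>digits l\<close> is known
  exactly.\<close>

definition override :: "('v \<rightharpoonup> bool) \<Rightarrow> ('v \<Rightarrow> bool) \<Rightarrow> 'v \<Rightarrow> bool" where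
  "override \<rho> x = (\<lambda>v. case \<rho> v of Some b \<Rightarrow> b | None \<Rightarrow> x v)"

definition sat :: "('v \<Rightarrow> bool) \<Rightarrow> ('v \<rightharpoonup> bool) \<Rightarrow> bool" where
  "sat x T \<longleftrightarrow> (\<forall>v b. T v = Some b \<longrightarrow> x v = b)"

definition width_le :: "'v set \<Rightarrow> nat \<Rightarrow> ('v \<rightharpoonup> bool) \<Rightarrow> bool" where
  "width_le V w T \<longleftrightarrow> dom T \<subseteq> V \<and> finite (dom T) \<and> card (dom T) \<le> w"

text \<open>The terms form a list because the encoding below always processes the first compatible
  one. Being partial maps, they never contain a variable with both signs.\<close>

definition dnf :: "'v set \<Rightarrow> nat \<Rightarrow> (('v \<Rightarrow> bool) \<Rightarrow> bool) \<Rightarrow> bool" where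
  "dnf V w f \<longleftrightarrow> (\<exists>F. (\<forall>T \<in> set F. width_le V w T) \<and> (\<forall>x. f x \<longleftrightarrow> (\<exists>T \<in> set F. sat x T)))"

text \<open>Trees are treated semantically, as a property of \<open>f\<close>: a query replaces
  \<open>f\<close> by its two restrictions. As a leaf is allowed at every \<open>d\<close>, this
  number only bounds the depth.\<close>

inductive decision_tree :: "'v set \<Rightarrow> nat \<Rightarrow> (('v \<Rightarrow> bool) \<Rightarrow> bool) \<Rightarrow> bool" for V where
  leaf: "(\<And>x. f x = c) \<Longrightarrow> decision_tree V d f"
| query: "v \<in> V \<Longrightarrow> decision_tree V d (\<lambda>x. f (x(v := False))) \<Longrightarrow>
    decision_tree V d (\<lambda>x. f (x(v := True))) \<Longrightarrow> decision_tree V (Suc d) f"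

lemma decision_tree_subset: "decision_tree V d f \<Longrightarrow> V \<subseteq> V' \<Longrightarrow> decision_tree V' d f"
  by (induction rule: decision_tree.induct) (auto intro: decision_tree.intros)

lemma decision_tree_not: "decision_tree V d f \<Longrightarrow> decision_tree V d (\<lambda>x. \<not> f x)"
proof (induction rule: decision_tree.induct)
  case (leaf f c d)
  show ?case by (rule decision_tree.leaf[where c = "\<not> c"]) (simp add: leaf)
qed (auto intro: decision_tree.query)

lemma width_le_mono: "width_le V w T \<Longrightarrow> w \<le> w' \<Longrightarrow> width_le V w' T"
  by (auto simp: width_le_def)

lemma dnf_mono: "dnf V w f \<Longrightarrow> w \<le> w' \<Longrightarrow> dnf V w' f"
  unfolding dnf_def by (meson width_le_mono)

lemma dnf_const: "dnf V w (\<lambda>x. c)"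
proof (cases c)
  case True
  show ?thesis unfolding dnf_def
    by (rule exI[of _ "[Map.empty]"]) (simp add: True sat_def width_le_def)
next
  case False
  show ?thesis unfolding dnf_def
    by (rule exI[of _ "[]"]) (simp add: False)
qed

lemma dnf_or: "dnf V w f \<Longrightarrow> dnf V w g \<Longrightarrow> dnf V w (\<lambda>x. f x \<or> g x)"
proof -
  assume "dnf V w f" "dnf V w g"
  then obtain F G where "\<forall>T \<in> set F. width_le V w T" "\<forall>x. f x \<longleftrightarrow> (\<exists>T \<in> set F. sat x T)"
    "\<forall>T \<in> set G. width_le V w T" "\<forall>x. g x \<longleftrightarrow> (\<exists>T \<in> set G. sat x T)"
    unfolding dnf_def by auto
  then show ?thesis unfolding dnf_def by (intro exI[of _ "F @ G"]) auto
qed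

lemma dnf_Bex:
  assumes "finite S" "\<And>c. c \<in> S \<Longrightarrow> dnf V w (h c)"
  shows "dnf V w (\<lambda>x. \<exists>c \<in> S. h c x)"
  using assms
proof (induction S rule: finite_induct)
  case empty
  show ?case using dnf_const[of V w False] by simp
next
  case (insert c S)
  have "dnf V w (\<lambda>x. h c x \<or> (\<exists>c \<in> S. h c x))"
    using insert by (intro dnf_or) auto
  then show ?case by simp
qed

lemma dnf_literal:
  assumes "dnf V w f" "v \<in> V"
  shows "dnf V (Suc w) (\<lambda>x. x v = b \<and> f x)"
proof -
  obtain F where F: "\<forall>T \<in> set F. width_le V w T" "\<forall>x. f x \<longleftrightarrow> (\<exists>T \<in> set F. sat x T)"
    using assms(1) unfolding dnf_def by auto
  \<comment> \<open>Terms with the opposite literal cannot hold together with the new one; the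
    others absorb it.\<close>
  define G where "G = map (\<lambda>T. T(v \<mapsto> b)) (filter (\<lambda>T. T v \<noteq> Some (\<not> b)) F)"
  have "\<forall>T \<in> set G. width_le V (Suc w) T"
    using F(1) assms(2) unfolding G_def width_le_def
    by (auto simp: card_insert_if)
  moreover have "(x v = b \<and> f x) \<longleftrightarrow> (\<exists>T \<in> set G. sat x T)" for x
  proof
    assume a: "x v = b \<and> f x"
    then obtain T where T: "T \<in> set F" "sat x T" using F(2) by auto
    then have "T v \<noteq> Some (\<not> b)" using a by (auto simp: sat_def)
    moreover have "sat x (T(v \<mapsto> b))" using T(2) a by (auto simp: sat_def)
    ultimately show "\<exists>T \<in> set G. sat x T" using T(1) unfolding G_def by auto
  next
    assume "\<exists>T \<in> set G. sat x T"
    then obtain T where T: "T \<in> set F" "T v \<noteq> Some (\<not> b)" "sat x (T(v \<mapsto> b))"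
      unfolding G_def by auto
    then have xv: "x v = b" by (auto simp: sat_def)
    have "sat x T" unfolding sat_def
    proof (intro allI impI)
      fix u c assume "T u = Some c"
      then show "x u = c" using T(2,3) xv by (cases "u = v") (auto simp: sat_def)
    qed
    then show "x v = b \<and> f x" using xv T(1) F(2) by auto
  qed
  ultimately show ?thesis unfolding dnf_def by (intro exI[of _ G]) simp
qed

lemma dnf_case:
  assumes "\<And>b. dnf V w (f b)" "v \<in> V"
  shows "dnf V (Suc w) (\<lambda>x. f (x v) x)"
proof -
  have "(\<lambda>x. f (x v) x) = (\<lambda>x. (x v = True \<and> f True x) \<or> (x v = False \<and> f False x))"
    by (rule ext) (metis (full_types))
  then show ?thesis using assms by (simp only:) (intro dnf_or dnf_literal)
qed

lemma decision_tree_dnf: "decision_tree V d f \<Longrightarrow> dnf V d f"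
proof (induction rule: decision_tree.induct)
  case (leaf f c d)
  then have "f = (\<lambda>x. c)" by auto
  then show ?case by (simp add: dnf_const)
next
  case (query v d f)
  have "dnf V d (\<lambda>x. f (x(v := b)))" for b using query.IH by (cases b) auto
  from dnf_case[of V d "\<lambda>b x. f (x(v := b))", OF this query.hyps(1)] show ?case by simp
qed

text \<open>A term that holds at some point mentions fewer than \<open>card V\<close> variables.
  Flipping a variable of \<open>V\<close> outside it keeps the term true, but would have to change
  \<open>f\<close>.\<close>

lemma dnf_not_parity:
  assumes "dnf V w f" "w < card V" "\<And>x v. v \<in> V \<Longrightarrow> f (x(v := \<not> x v)) = (\<not> f x)"
  shows False
proof -
  obtain F where F: "\<forall>T \<in> set F. width_le V w T" "\<forall>x. f x \<longleftrightarrow> (\<exists>T \<in> set F. sat x T)"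
    using assms(1) unfolding dnf_def by auto
  obtain v where v: "v \<in> V" using assms(2) by fastforce
  obtain y where "f y" using assms(3)[OF v] by blast
  then obtain T where T: "T \<in> set F" "sat y T" using F by auto
  have "\<not> V \<subseteq> dom T"
    using F(1) T(1) assms(2) unfolding width_le_def
    by (metis card_mono leD order_less_le_trans)
  then obtain u where u: "u \<in> V" "T u = None" by auto
  have "sat (y(u := \<not> y u)) T" using T(2) u(2) by (auto simp: sat_def)
  then have "f (y(u := \<not> y u))" using F(2) T(1) by auto
  then show False using assms(3)[OF u(1)] \<open>f y\<close> by auto
qed

lemma override_override: "override \<rho> (override \<pi> x) = override (\<pi> ++ \<rho>) x"
  by (auto simp: override_def map_add_def split: option.splits)

lemma decision_tree_query_set:
  assumes "finite U" "U \<subseteq> V" "\<And>\<pi>. dom \<pi> = U \<Longrightarrow> decision_tree V d (\<lambda>x. f (override \<pi> x))"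
  shows "decision_tree V (card U + d) f"
  using assms
proof (induction U arbitrary: f rule: finite_induct)
  case empty
  have "decision_tree V d (\<lambda>x. f (override Map.empty x))" using empty by simp
  then show ?case by (simp add: override_def)
next
  case (insert v U)
  have "decision_tree V (card U + d) (\<lambda>x. f (x(v := b)))" for b
  proof (rule insert.IH)
    show "U \<subseteq> V" using insert by auto
    fix \<pi> :: "'a \<rightharpoonup> bool" assume "dom \<pi> = U"
    then have "decision_tree V d (\<lambda>x. f (override (\<pi>(v \<mapsto> b)) x))"
      by (intro insert.prems) auto
    moreover have "override (\<pi>(v \<mapsto> b)) x = (override \<pi> x)(v := b)" for x
      by (auto simp: override_def)
    ultimately show "decision_tree V d (\<lambda>x. f ((override \<pi> x)(v := b)))" by simp
  qed
  then have "decision_tree V (Suc (card U + d)) f"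
    using insert.prems by (intro decision_tree.query[of v]) auto
  then show ?case using insert by simp
qed

section \<open>Razborov's encoding of bad restrictions\<close>

definition compatible :: "('v \<rightharpoonup> bool) \<Rightarrow> ('v \<rightharpoonup> bool) \<Rightarrow> bool" where
  "compatible \<rho> T \<longleftrightarrow> (\<forall>v b c. T v = Some b \<longrightarrow> \<rho> v = Some c \<longrightarrow> b = c)"

lemma compatible_antimono: "\<rho> \<subseteq>\<^sub>m \<theta> \<Longrightarrow> compatible \<theta> T \<Longrightarrow> compatible \<rho> T"
  unfolding compatible_def map_le_def by (metis domI)

text \<open>A code for a path of length \<open>s\<close> in the canonical decision tree of
  \<open>F\<close> under \<rho>. Each stage takes the first term \<open>T\<close> that is still
  alive and queries its free variables \<open>U\<close>; \<pi> holds the answers along the path,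
  with which the next stage continues. In the code these answers are replaced by the values that
  satisfy \<open>T\<close>, so that \<open>T\<close> can be recognized again. Only in the last stage
  may \<open>U\<close> be a proper subset of the free variables, which cuts the path to length
  exactly \<open>s\<close>.\<close>

inductive encodes :: "('v \<rightharpoonup> bool) list \<Rightarrow> ('v \<rightharpoonup> bool) \<Rightarrow> nat \<Rightarrow> ('v \<rightharpoonup> bool) \<Rightarrow> bool" for F where
  encodes_0: "encodes F \<rho> 0 \<rho>"
| encodes_term: "find (compatible \<rho>) F = Some T \<Longrightarrow> U \<subseteq> dom T - dom \<rho> \<Longrightarrow> card U > 0 \<Longrightarrow>
    (s > 0 \<Longrightarrow> U = dom T - dom \<rho>) \<Longrightarrow> dom \<pi> = U \<Longrightarrow> encodes F (\<rho> ++ \<pi>) s \<theta> \<Longrightarrow>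
    encodes F \<rho> (card U + s) (\<theta> ++ (T |` U))"

lemma find_SomeD: "find P xs = Some x \<Longrightarrow> x \<in> set xs"
  by (induction xs) (auto split: if_splits)

lemma encodes_extends: "encodes F \<rho> s \<theta> \<Longrightarrow> \<rho> \<subseteq>\<^sub>m \<theta>"
proof (induction rule: encodes.induct)
  case (encodes_term \<rho> T U s \<pi> \<theta>)
  show ?case unfolding map_le_def
  proof
    fix v assume v: "v \<in> dom \<rho>"
    then have U: "v \<notin> U" using encodes_term.hyps(2) by blast
    have "\<theta> v = (\<rho> ++ \<pi>) v" using encodes_term.IH v unfolding map_le_def by simp
    also have "\<dots> = \<rho> v" using U encodes_term.hyps(5) by (simp add: map_add_dom_app_simps(3))
    finally show "\<rho> v = (\<theta> ++ (T |` U)) v" using U by (simp add: map_add_def)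
  qed
qed simp

lemma encodes_dom:
  assumes "encodes F \<rho> s \<theta>" "\<forall>T \<in> set F. width_le V w T" "finite V" "dom \<rho> \<subseteq> V"
  shows "dom \<theta> \<subseteq> V \<and> card (dom \<theta>) = card (dom \<rho>) + s"
  using assms
proof (induction rule: encodes.induct)
  case (encodes_term \<rho> T U s \<pi> \<theta>)
  have T: "T \<in> set F" using encodes_term.hyps(1) by (rule find_SomeD)
  then have "dom T \<subseteq> V" using encodes_term.prems by (simp add: width_le_def)
  then have UV: "U \<subseteq> V" using encodes_term.hyps(2) by blast
  then have IH: "dom \<theta> \<subseteq> V \<and> card (dom \<theta>) = card (dom (\<rho> ++ \<pi>)) + s"
    using encodes_term by auto
  have "U \<subseteq> dom \<theta>"
    using map_le_implies_dom_le[OF encodes_extends[OF encodes_term.hyps(6)]] encodes_term.hyps(5)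
    by simp
  then have "dom (\<theta> ++ (T |` U)) = dom \<theta>" unfolding dom_map_add dom_restrict by blast
  moreover have "card (dom (\<rho> ++ \<pi>)) = card (dom \<rho>) + card U"
  proof -
    have "card (dom \<rho> \<union> U) = card (dom \<rho>) + card U"
    proof (rule card_Un_disjoint)
      show "finite (dom \<rho>)" "finite U"
        using finite_subset[OF _ encodes_term.prems(2)] encodes_term.prems(3) UV by blast+
      show "dom \<rho> \<inter> U = {}" using encodes_term.hyps(2) by blast
    qed
    then show ?thesis using encodes_term.hyps(5) by (simp add: Un_commute)
  qed
  ultimately show ?case using IH by simp
qed simp

lemma find_compatible_extension:
  assumes "find (compatible \<rho>) F = Some T" "\<rho> \<subseteq>\<^sub>m \<theta>" "compatible \<theta> T"
  shows "find (compatible \<theta>) F = Some T"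
proof -
  obtain i where i: "i < length F" "compatible \<rho> (F ! i)" "T = F ! i" "\<forall>j<i. \<not> compatible \<rho> (F ! j)"
    using assms(1) unfolding find_Some_iff by auto
  then show ?thesis unfolding find_Some_iff
    using assms(2,3) compatible_antimono by blast
qed

text \<open>The decoding step: the terms before \<open>T\<close> are contradicted by \<rho> already,
  hence by the code, while the code satisfies \<open>T\<close> on \<open>U\<close> and does not
  contradict it elsewhere.\<close>

lemma encodes_find:
  assumes f: "find (compatible \<rho>) F = Some T" and U: "U \<subseteq> dom T - dom \<rho>"
    and full: "s > 0 \<Longrightarrow> U = dom T - dom \<rho>" and pi: "dom \<pi> = U" and e: "encodes F (\<rho> ++ \<pi>) s \<theta>"
  shows "find (compatible (\<theta> ++ (T |` U))) F = Some T"
proof (rule find_compatible_extension[OF f])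
  have le: "\<rho> ++ \<pi> \<subseteq>\<^sub>m \<theta>" using encodes_extends[OF e] .
  have agree: "\<theta> v = \<rho> v" if "v \<in> dom \<rho>" for v
  proof -
    have "v \<notin> dom \<pi>" using that U pi by auto
    then have "(\<rho> ++ \<pi>) v = \<rho> v" by (simp add: map_add_dom_app_simps(3))
    then show ?thesis using le that unfolding map_le_def by simp
  qed
  show "\<rho> \<subseteq>\<^sub>m \<theta> ++ (T |` U)" unfolding map_le_def
  proof
    fix v assume v: "v \<in> dom \<rho>"
    then have "v \<notin> U" using U by auto
    then have "(\<theta> ++ (T |` U)) v = \<theta> v" by (simp add: map_add_def restrict_map_def)
    then show "\<rho> v = (\<theta> ++ (T |` U)) v" using agree[OF v] by simp
  qed
  have cT: "compatible \<rho> T" using f unfolding find_Some_iff by auto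
  show "compatible (\<theta> ++ (T |` U)) T" unfolding compatible_def
  proof (intro allI impI)
    fix v b c assume b: "T v = Some b" and c: "(\<theta> ++ (T |` U)) v = Some c"
    show "b = c"
    proof (cases "v \<in> U")
      case True
      then show ?thesis using b c by (simp add: map_add_def restrict_map_def)
    next
      case False
      then have c': "\<theta> v = Some c" using c by (simp add: map_add_def restrict_map_def)
      show ?thesis
      proof (cases "v \<in> dom \<rho>")
        case True
        then show ?thesis using agree[OF True] c' b cT by (auto simp: compatible_def)
      next
        case nd: False
        \<comment> \<open>A variable of \<open>T\<close> outside \<open>U\<close> and
          \<open>dom \<rho>\<close> exists only in a truncated, hence last stage, and there it has
          not been set at all.\<close>
        then have "s = 0" using full False b by auto
        then have "\<theta> = \<rho> ++ \<pi>" using e by (auto elim: encodes.cases)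
        moreover have "v \<notin> dom \<pi>" using False pi by simp
        ultimately show ?thesis using c' nd by (metis domI dom_map_add UnE)
      qed
    qed
  qed
qed

lemma sum_power2_less: "(\<Sum>u < s. 2 ^ u) < (2 :: nat) ^ s"
  by (induction s) auto

text \<open>The bound (4 w)^s survives the recursion that counts the restrictions with a given code:
  one chooses \<open>U\<close>, then one of 2^|U| answers, then decodes the rest. There are at most
  w^u sets of size u, so they contribute at most (2 w)^s 2^(s-u), and the geometric sum over u stays
  below 2^s; this is the origin of the 4.\<close>

lemma sum_Pow_weight_le:
  fixes w s :: nat
  assumes "finite D" "card D \<le> w"
  shows "(\<Sum>U \<in> {U. U \<subseteq> D \<and> 0 < card U \<and> card U \<le> s}. 2 ^ card U * (4 * w) ^ (s - card U)) \<le> (4 * w) ^ s"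
proof -
  let ?A = "{U. U \<subseteq> D \<and> 0 < card U \<and> card U \<le> s}"
  have fin: "finite ?A" using assms(1) by auto
  have "(\<Sum>U \<in> ?A. 2 ^ card U * (4 * w) ^ (s - card U)) =
      (\<Sum>u \<in> {1..s}. \<Sum>U \<in> {U \<in> ?A. card U = u}. 2 ^ card U * (4 * w) ^ (s - card U))"
    by (rule sum.group[symmetric]) (use fin in auto)
  also have "\<dots> = (\<Sum>u \<in> {1..s}. (card D choose u) * (2 ^ u * (4 * w) ^ (s - u)))"
  proof (rule sum.cong[OF refl])
    fix u assume u: "u \<in> {1..s}"
    have e: "{U \<in> ?A. card U = u} = {U. U \<subseteq> D \<and> card U = u}" using u by auto
    have "(\<Sum>U \<in> {U. U \<subseteq> D \<and> card U = u}. 2 ^ card U * (4 * w) ^ (s - card U)) =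
        (\<Sum>U \<in> {U. U \<subseteq> D \<and> card U = u}. 2 ^ u * (4 * w) ^ (s - u))"
      by (rule sum.cong) auto
    also have "\<dots> = (card D choose u) * (2 ^ u * (4 * w) ^ (s - u))"
      using n_subsets[OF assms(1), of u] by simp
    finally show "(\<Sum>U \<in> {U \<in> ?A. card U = u}. 2 ^ card U * (4 * w) ^ (s - card U)) =
        (card D choose u) * (2 ^ u * (4 * w) ^ (s - u))" unfolding e .
  qed
  also have "\<dots> \<le> (\<Sum>u \<in> {1..s}. (2 * w) ^ s * 2 ^ (s - u))"
  proof (rule sum_mono)
    fix u assume u: "u \<in> {1..s}"
    have "card D choose u \<le> w ^ u"
    proof (cases "u \<le> card D")
      case True
      then show ?thesis using binomial_le_pow[OF True] power_mono[OF assms(2), of u] by linarith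
    qed (simp add: binomial_eq_0)
    then have "(card D choose u) * (2 ^ u * (4 * w) ^ (s - u)) \<le> w ^ u * (2 ^ u * (4 * w) ^ (s - u))"
      by (rule mult_right_mono) simp
    also have "\<dots> = (2 * w) ^ u * ((2 * w) ^ (s - u) * 2 ^ (s - u))"
      by (simp add: power_mult_distrib flip: power_mult_distrib[of 2 2])
    also have "\<dots> = (2 * w) ^ (u + (s - u)) * 2 ^ (s - u)"
      by (simp only: power_add mult.assoc)
    also have "\<dots> = (2 * w) ^ s * 2 ^ (s - u)" using u by simp
    finally show "(card D choose u) * (2 ^ u * (4 * w) ^ (s - u)) \<le> (2 * w) ^ s * 2 ^ (s - u)" .
  qed
  also have "\<dots> = (2 * w) ^ s * (\<Sum>u \<in> {1..s}. 2 ^ (s - u))" by (simp add: sum_distrib_left)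
  also have "(\<Sum>u \<in> {1..s}. 2 ^ (s - u)) = (\<Sum>u < s. 2 ^ u :: nat)"
    by (rule sum.reindex_bij_witness[of _ "\<lambda>u. s - u" "\<lambda>u. s - u"]) auto
  also have "(2 * w) ^ s * (\<Sum>u < s. 2 ^ u) \<le> (2 * w) ^ s * 2 ^ s"
    by (intro mult_left_mono less_imp_le[OF sum_power2_less]) simp
  also have "\<dots> = (2 * w * 2) ^ s" by (rule power_mult_distrib[symmetric])
  also have "2 * w * 2 = 4 * w" by simp
  finally show ?thesis .
qed

lemma finite_partial_assignments:
  "finite U \<Longrightarrow> finite {\<pi> :: 'v \<rightharpoonup> bool. dom \<pi> = U}"
  "finite U \<Longrightarrow> card {\<pi> :: 'v \<rightharpoonup> bool. dom \<pi> = U} = 2 ^ card U"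
proof -
  assume U: "finite U"
  have b: "bij_betw (\<lambda>A v. if v \<in> U then Some (v \<in> A) else None) (Pow U) {\<pi> :: 'v \<rightharpoonup> bool. dom \<pi> = U}"
  proof (rule bij_betw_byWitness[where f' = "\<lambda>\<pi>. {v. \<pi> v = Some True}"])
    show "\<forall>\<pi> \<in> {\<pi> :: 'v \<rightharpoonup> bool. dom \<pi> = U}. (\<lambda>v. if v \<in> U then Some (v \<in> {v. \<pi> v = Some True}) else None) = \<pi>"
      by (intro ballI ext) (auto simp: domIff dest: sym)
  qed (auto split: if_splits)
  show "finite {\<pi> :: 'v \<rightharpoonup> bool. dom \<pi> = U}" using bij_betw_finite[OF b] U by simp
  show "card {\<pi> :: 'v \<rightharpoonup> bool. dom \<pi> = U} = 2 ^ card U"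
    using bij_betw_same_card[OF b] U by (simp add: card_Pow)
qed

text \<open>The first term compatible with \<open>\<theta>\<close> is the one used in the first stage of the encoding; knowing
  the set \<open>U\<close> of variables queried there and the answers \<open>\<pi>\<close>, one undoes that stage.\<close>

lemma card_encodes_le:
  assumes F: "\<forall>T \<in> set F. width_le V w T" and w: "w > 0"
  shows "finite {\<rho>. encodes F \<rho> s \<theta>} \<and> card {\<rho>. encodes F \<rho> s \<theta>} \<le> (4 * w) ^ s"
proof (induction s arbitrary: \<theta> rule: less_induct)
  case (less s)
  let ?D = "\<lambda>s \<theta>. {\<rho>. encodes F \<rho> s \<theta>}"
  show ?case
  proof (cases "s = 0")
    case True
    have "?D 0 \<theta> \<subseteq> {\<theta>}"
    proof
      fix \<rho> assume "\<rho> \<in> ?D 0 \<theta>"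
      then have "encodes F \<rho> 0 \<theta>" by simp
      then show "\<rho> \<in> {\<theta>}" by (cases rule: encodes.cases) auto
    qed
    moreover have "card (?D 0 \<theta>) \<le> card {\<theta>}"
      by (rule card_mono) (use calculation in auto)
    ultimately show ?thesis using True finite_subset[of "?D 0 \<theta>" "{\<theta>}"] by simp
  next
    case False
    show ?thesis
    proof (cases "find (compatible \<theta>) F")
      case None
      have "\<not> encodes F \<rho> s \<theta>" for \<rho>
      proof
        assume "encodes F \<rho> s \<theta>"
        then show False
        proof (cases rule: encodes.cases)
          case (encodes_term T U s' \<pi> \<theta>')
          from encodes_find[of \<rho> F T U s' \<pi> \<theta>'] encodes_term None show False by auto
        qed (use False in simp)
      qed
      then show ?thesis by simp
    next
      case (Some T)
      then have "T \<in> set F" by (rule find_SomeD)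
      then have T: "finite (dom T)" "card (dom T) \<le> w" using F by (auto simp: width_le_def)
      let ?A = "{U. U \<subseteq> dom T \<and> 0 < card U \<and> card U \<le> s}"
      let ?P = "\<lambda>U. {\<pi> :: 'a \<rightharpoonup> bool. dom \<pi> = U}"
      let ?S = "\<lambda>U. \<Union>\<pi> \<in> ?P U. (\<lambda>\<rho>. \<rho> |` (- U)) ` ?D (s - card U) (\<theta> ++ \<pi>)"
      have fA: "finite ?A" using T by auto
      have fU: "finite U" if "U \<in> ?A" for U using that T finite_subset by auto
      have IH: "finite (?D (s - card U) \<theta>')" "card (?D (s - card U) \<theta>') \<le> (4 * w) ^ (s - card U)"
        if "U \<in> ?A" for U \<theta>'
        using less.IH[of "s - card U" \<theta>'] that by auto
      have sub: "?D s \<theta> \<subseteq> (\<Union>U \<in> ?A. ?S U)"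
      proof
        fix \<rho> assume "\<rho> \<in> ?D s \<theta>"
        then have "encodes F \<rho> s \<theta>" by simp
        then show "\<rho> \<in> (\<Union>U \<in> ?A. ?S U)"
        proof (cases rule: encodes.cases)
          case (encodes_term T' U s' \<pi> \<theta>')
          have "T' = T" using encodes_find[of \<rho> F T' U s' \<pi> \<theta>'] encodes_term Some by auto
          then have U: "U \<in> ?A" using encodes_term by auto
          \<comment> \<open>\<open>\<theta>\<close> is \<open>\<theta>'\<close> overwritten by the
            term on \<open>U\<close>, and \<open>\<theta>'\<close> extends
            \<open>\<rho> ++ \<pi>\<close>; writing the answers back therefore restores it.\<close>
          have "\<theta> ++ \<pi> = \<theta>'"
          proof
            fix v
            have "\<rho> ++ \<pi> \<subseteq>\<^sub>m \<theta>'" using encodes_extends encodes_term by blast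
            then have "v \<in> U \<Longrightarrow> \<theta>' v = \<pi> v"
              using encodes_term(7) unfolding map_le_def
              by (metis UnCI dom_map_add map_add_dom_app_simps(1))
            moreover have "v \<notin> U \<Longrightarrow> \<pi> v = None" using encodes_term(7) by auto
            ultimately show "(\<theta> ++ \<pi>) v = \<theta>' v"
              using encodes_term(2,7) by (cases "v \<in> U") (auto simp: map_add_def restrict_map_def split: option.splits)
          qed
          then have "\<rho> ++ \<pi> \<in> ?D (s - card U) (\<theta> ++ \<pi>)" using encodes_term by simp
          moreover have "(\<rho> ++ \<pi>) |` (- U) = \<rho>"
          proof
            fix v
            show "((\<rho> ++ \<pi>) |` (- U)) v = \<rho> v"
            proof (cases "v \<in> U")
              case True
              then have "\<rho> v = None" using encodes_term(4) by blast
              then show ?thesis using True by simp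
            next
              case False
              then have "v \<notin> dom \<pi>" using encodes_term by simp
              then show ?thesis using False by (simp add: restrict_map_def map_add_dom_app_simps(3))
            qed
          qed
          ultimately show ?thesis using U encodes_term(7) by (metis (mono_tags, lifting) UN_iff image_eqI mem_Collect_eq)
        qed (use False in auto)
      qed
      have fS: "finite (?S U)" if "U \<in> ?A" for U
        using IH(1)[OF that] finite_partial_assignments(1)[OF fU[OF that]] by auto
      have cS: "card (?S U) \<le> 2 ^ card U * (4 * w) ^ (s - card U)" if U: "U \<in> ?A" for U
      proof -
        have "card (?S U) \<le> (\<Sum>\<pi> \<in> ?P U. card ((\<lambda>\<rho>. \<rho> |` (- U)) ` ?D (s - card U) (\<theta> ++ \<pi>)))"
          by (rule card_UN_le[OF finite_partial_assignments(1)[OF fU[OF U]]])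
        also have "\<dots> \<le> (\<Sum>\<pi> \<in> ?P U. (4 * w) ^ (s - card U))"
          by (rule sum_mono) (rule order_trans[OF card_image_le[OF IH(1)[OF U]] IH(2)[OF U]])
        also have "\<dots> = 2 ^ card U * (4 * w) ^ (s - card U)"
          using finite_partial_assignments(2)[OF fU[OF U]] by simp
        finally show ?thesis .
      qed
      have fin: "finite (\<Union>U \<in> ?A. ?S U)" using fA fS by blast
      have "card (?D s \<theta>) \<le> card (\<Union>U \<in> ?A. ?S U)" by (rule card_mono[OF fin sub])
      also have "\<dots> \<le> (\<Sum>U \<in> ?A. card (?S U))" by (rule card_UN_le[OF fA])
      also have "\<dots> \<le> (\<Sum>U \<in> ?A. 2 ^ card U * (4 * w) ^ (s - card U))" by (rule sum_mono[OF cS])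
      also have "\<dots> \<le> (4 * w) ^ s" by (rule sum_Pow_weight_le[OF T])
      finally show ?thesis using finite_subset[OF sub fin] by simp
    qed
  qed
qed

text \<open>The canonical tree queries all free variables of the first compatible term and continues
  with the answers. It ends in a leaf when no term is compatible (value false) or when the
  compatible term has no free variable left (value true). A path of length \<open>s\<close> would be
  an encoding.\<close>

lemma no_encoding_decision_tree:
  assumes F: "\<forall>T \<in> set F. width_le V w T" and f: "\<And>x. f x \<longleftrightarrow> (\<exists>T \<in> set F. sat x T)"
    and no: "\<nexists>\<theta>. encodes F \<rho> s \<theta>" 
  shows "decision_tree (V - dom \<rho>) (s - 1) (\<lambda>x. f (override \<rho> x))"
  using no
proof (induction s arbitrary: \<rho> rule: less_induct)
  case (less s)
  have s: "s > 0" using less.prems encodes_0 by (cases s) auto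
  have incompatible: "\<not> sat (override \<rho> x) T" if "\<not> compatible \<rho> T" for x T
    using that by (force simp: compatible_def sat_def override_def)
  show ?case
  proof (cases "find (compatible \<rho>) F")
    case None
    then have "\<forall>T \<in> set F. \<not> compatible \<rho> T" by (simp add: find_None_iff)
    then have "f (override \<rho> x) = False" for x using f incompatible by auto
    then show ?thesis by (rule decision_tree.leaf)
  next
    case (Some T)
    then have TF: "T \<in> set F" and cT: "compatible \<rho> T" by (auto dest: find_SomeD simp: find_Some_iff)
    then have T: "finite (dom T)" "dom T \<subseteq> V" using F by (auto simp: width_le_def)
    let ?U = "dom T - dom \<rho>"
    show ?thesis
    proof (cases "?U = {}")
      case True
      have "sat (override \<rho> x) T" for x
        unfolding sat_def
      proof (intro allI impI)
        fix v b assume v: "T v = Some b"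
        then obtain c where "\<rho> v = Some c" using True by auto
        then show "override \<rho> x v = b" using cT v by (auto simp: compatible_def override_def)
      qed
      then have "f (override \<rho> x) = True" for x using f TF by auto
      then show ?thesis by (rule decision_tree.leaf)
    next
      case False
      then have cU: "card ?U > 0" using T by (simp add: card_gt_0_iff)
      \<comment> \<open>A term with at least \<open>s\<close> free variables would give an encoding
        in a single truncated stage.\<close>
      have lt: "card ?U < s"
      proof (rule ccontr)
        assume "\<not> card ?U < s"
        then obtain U where U: "U \<subseteq> ?U" "card U = s" by (metis not_less obtain_subset_with_card_n)
        obtain \<pi> :: "'a \<rightharpoonup> bool" where "dom \<pi> = U" by (rule that[of "\<lambda>v. if v \<in> U then Some True else None"]) (auto split: if_splits)
        then have "encodes F \<rho> (card U + 0) ((\<rho> ++ \<pi>) ++ (T |` U))"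
          using U s Some by (intro encodes_term) (auto intro: encodes_0)
        then show False using less.prems U by auto
      qed
      have "decision_tree (V - dom \<rho>) (s - card ?U - 1) (\<lambda>x. f (override \<rho> (override \<pi> x)))"
        if pi: "dom \<pi> = ?U" for \<pi>
      proof -
        have "\<nexists>\<theta>. encodes F (\<rho> ++ \<pi>) (s - card ?U) \<theta>"
        proof
          assume "\<exists>\<theta>. encodes F (\<rho> ++ \<pi>) (s - card ?U) \<theta>"
          then obtain \<theta> where "encodes F (\<rho> ++ \<pi>) (s - card ?U) \<theta>" by blast
          then have "encodes F \<rho> (card ?U + (s - card ?U)) (\<theta> ++ (T |` ?U))"
            using pi cU by (intro encodes_term[OF Some]) auto
          then show False using less.prems lt by auto
        qed
        then have "decision_tree (V - dom (\<rho> ++ \<pi>)) (s - card ?U - 1) (\<lambda>x. f (override (\<rho> ++ \<pi>) x))"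
          using less.IH[of "s - card ?U" "\<rho> ++ \<pi>"] lt cU by simp
        moreover have "\<rho> ++ \<pi> = \<pi> ++ \<rho>" using pi by (intro map_add_comm) auto
        ultimately show ?thesis unfolding override_override
          by (auto elim!: decision_tree_subset)
      qed
      then have "decision_tree (V - dom \<rho>) (card ?U + (s - card ?U - 1)) (\<lambda>x. f (override \<rho> x))"
        using T by (intro decision_tree_query_set) auto
      then show ?thesis using lt by simp
    qed
  qed
qed

section \<open>Counting restrictions by their number of free variables\<close>

definition restrictions :: "'v set \<Rightarrow> nat \<Rightarrow> ('v \<rightharpoonup> bool) set" where
  "restrictions V i = {\<rho>. dom \<rho> \<subseteq> V \<and> card (V - dom \<rho>) = i}"

lemma finite_restrictions: "finite V \<Longrightarrow> finite (restrictions V i)"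
proof -
  assume V: "finite V"
  have "restrictions V i \<subseteq> (\<Union>U \<in> Pow V. {\<pi>. dom \<pi> = U})" by (auto simp: restrictions_def)
  moreover have "finite (\<Union>U \<in> Pow V. {\<pi> :: 'a \<rightharpoonup> bool. dom \<pi> = U})"
    using V finite_subset by (auto intro!: finite_partial_assignments)
  ultimately show ?thesis by (rule finite_subset)
qed

lemma card_restrictions:
  assumes V: "finite V" and i: "i \<le> card V"
  shows "card (restrictions V i) = (card V choose i) * 2 ^ (card V - i)"
proof -
  let ?A = "{U. U \<subseteq> V \<and> card U = card V - i}"
  have fin: "finite ?A" using V by auto
  have "restrictions V i = (\<Union>U \<in> ?A. {\<pi>. dom \<pi> = U})"
  proof -
    have "card (V - U) = i \<longleftrightarrow> card U = card V - i" if "U \<subseteq> V" for U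
      using that V i card_mono[OF V that] by (simp add: card_Diff_subset finite_subset[OF that]) linarith
    then show ?thesis unfolding restrictions_def by blast
  qed
  then have "card (restrictions V i) = (\<Sum>U \<in> ?A. card {\<pi> :: 'a \<rightharpoonup> bool. dom \<pi> = U})"
    using fin finite_subset[OF _ V]
    by (simp only:) (intro card_UN_disjoint, auto intro: finite_partial_assignments)
  also have "\<dots> = (\<Sum>U \<in> ?A. 2 ^ (card V - i))"
    by (rule sum.cong[OF refl]) (use finite_subset[OF _ V] in \<open>auto simp: finite_partial_assignments(2)\<close>)
  also have "\<dots> = (card V choose (card V - i)) * 2 ^ (card V - i)"
    using n_subsets[OF V, of "card V - i"] by simp
  finally show ?thesis using binomial_symmetric[OF i] by simp
qed

text \<open>With N variables, the numbers of restrictions with e and with e + 1 free variables have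
  the ratio 2 (e + 1) / (N - e), which is at most 2 i / (N - i) for e < i. Giving up
  \<open>s\<close> free variables collects \<open>s\<close> such factors.\<close>

lemma card_restrictions_ratio:
  assumes V: "finite V" and "s \<le> i" "i \<le> card V"
  shows "card (restrictions V (i - s)) * (card V - i) ^ s \<le> (2 * i) ^ s * card (restrictions V i)"
  using assms(2)
proof (induction s)
  case (Suc s)
  let ?N = "card V" and ?e = "i - Suc s"
  have e: "i - s = Suc ?e" using Suc.prems by simp
  have "card (restrictions V ?e) * (?N - ?e) = 2 * Suc ?e * card (restrictions V (Suc ?e))"
  proof -
    have "Suc ?e * (?N choose Suc ?e) = (?N choose ?e) * (?N - ?e)"
      using binomial_absorption[of ?e ?N] binomial_absorb_comp[of ?N ?e]
      by (simp add: mult.commute)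
    moreover have "2 ^ (?N - ?e) = (2 :: nat) * 2 ^ (?N - Suc ?e)"
      using Suc.prems assms(3) by (simp flip: power_Suc add: Suc_diff_Suc)
    moreover have "card (restrictions V ?e) = (?N choose ?e) * 2 ^ (?N - ?e)"
      "card (restrictions V (Suc ?e)) = (?N choose Suc ?e) * 2 ^ (?N - Suc ?e)"
      by (rule card_restrictions[OF V], use Suc.prems assms(3) in simp)+
    ultimately show ?thesis by (metis mult.assoc mult.commute)
  qed
  moreover have "?N - i \<le> ?N - ?e" by simp
  ultimately have "card (restrictions V ?e) * (?N - i) \<le> 2 * Suc ?e * card (restrictions V (Suc ?e))"
    by (metis mult_le_mono2)
  also have "\<dots> \<le> 2 * i * card (restrictions V (Suc ?e))"
    using Suc.prems by (intro mult_right_mono) auto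
  finally have "card (restrictions V ?e) * (?N - i) * (?N - i) ^ s \<le>
      2 * i * card (restrictions V (i - s)) * (?N - i) ^ s"
    unfolding e by (rule mult_right_mono) simp
  also have "\<dots> \<le> 2 * i * ((2 * i) ^ s * card (restrictions V i))"
    using Suc.IH Suc.prems unfolding mult.assoc by (intro mult_left_mono) auto
  finally show ?case by (simp add: mult_ac)
qed simp

text \<open>A bad restriction has a code with \<open>s\<close> fewer free variables, and at most (4
  w)^s restrictions share a code. With N = \<open>card V\<close>, the fraction of bad ones is at
  most (4 w * 2 i / (N - i))^s, hence at most 2^-s once 16 w i is at most N - i. This explains the
  hypothesis on \<open>card V\<close>.\<close>

lemma switching_lemma_card:
  assumes V: "finite V" and f: "dnf V w f" and w: "w > 0" and s: "s \<le> i"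
    and i: "i * (16 * w + 1) \<le> card V"
  shows "card {\<rho> \<in> restrictions V i. \<not> decision_tree (V - dom \<rho>) (s - 1) (\<lambda>x. f (override \<rho> x))} * 2 ^ s
    \<le> card (restrictions V i)"
proof (cases "i = 0")
  case True
  then have "s = 0" using s by simp
  then show ?thesis using card_mono[OF finite_restrictions[OF V]] by (simp add: Collect_mono_iff) 
next
  case False
  let ?B = "{\<rho> \<in> restrictions V i. \<not> decision_tree (V - dom \<rho>) (s - 1) (\<lambda>x. f (override \<rho> x))}"
  obtain F where F: "\<forall>T \<in> set F. width_le V w T" "\<And>x. f x \<longleftrightarrow> (\<exists>T \<in> set F. sat x T)"
    using f unfolding dnf_def by auto
  have iV: "i \<le> card V" using i by simp
  have "?B \<subseteq> (\<Union>\<theta> \<in> restrictions V (i - s). {\<rho>. encodes F \<rho> s \<theta>})"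
  proof
    fix \<rho> assume r: "\<rho> \<in> ?B"
    then obtain \<theta> where t: "encodes F \<rho> s \<theta>" using no_encoding_decision_tree[OF F, of \<rho> s] by auto
    have d: "dom \<rho> \<subseteq> V" "card (V - dom \<rho>) = i" using r by (auto simp: restrictions_def)
    have t': "dom \<theta> \<subseteq> V" "card (dom \<theta>) = card (dom \<rho>) + s"
      using encodes_dom[OF t F(1) V d(1)] by auto
    have "card (V - dom \<theta>) = i - s"
      using d t' V by (simp add: card_Diff_subset finite_subset)
    then show "\<rho> \<in> (\<Union>\<theta> \<in> restrictions V (i - s). {\<rho>. encodes F \<rho> s \<theta>})"
      using t t' by (auto simp: restrictions_def)
  qed
  then have "card ?B \<le> card (\<Union>\<theta> \<in> restrictions V (i - s). {\<rho>. encodes F \<rho> s \<theta>})"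
    using card_encodes_le[OF F(1) w] finite_restrictions[OF V] by (intro card_mono) auto
  also have "\<dots> \<le> (\<Sum>\<theta> \<in> restrictions V (i - s). card {\<rho>. encodes F \<rho> s \<theta>})"
    by (rule card_UN_le[OF finite_restrictions[OF V]])
  also have "\<dots> \<le> (\<Sum>\<theta> \<in> restrictions V (i - s). (4 * w) ^ s)"
    using card_encodes_le[OF F(1) w] by (intro sum_mono) auto
  finally have B: "card ?B \<le> card (restrictions V (i - s)) * (4 * w) ^ s" by simp
  have "card ?B * 2 ^ s * (2 * i) ^ s \<le> card (restrictions V (i - s)) * (4 * w) ^ s * 2 ^ s * (2 * i) ^ s"
    using B by simp
  also have "\<dots> = card (restrictions V (i - s)) * (4 * w * 2 * (2 * i)) ^ s"
    by (simp only: power_mult_distrib mult.assoc)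
  also have "\<dots> \<le> card (restrictions V (i - s)) * (card V - i) ^ s"
    using i by (intro mult_left_mono power_mono) (auto simp: algebra_simps)
  also have "\<dots> \<le> (2 * i) ^ s * card (restrictions V i)"
    by (rule card_restrictions_ratio[OF V s iV])
  finally have "(2 * i) ^ s * (card ?B * 2 ^ s) \<le> (2 * i) ^ s * card (restrictions V i)"
    by (simp only: mult_ac)
  then show ?thesis using False by simp
qed

text \<open>The number of the \<open>f i\<close> is so small that the exceptional sets cannot cover all restrictions.\<close>

lemma switching_lemma:
  assumes V: "finite V" and I: "finite I" "card I < 2 ^ s" and w: "w > 0" and s: "s \<le> l"
    and l: "l * (16 * w + 1) \<le> card V"
    and f: "\<And>i. i \<in> I \<Longrightarrow> dnf V w (f i) \<or> dnf V w (\<lambda>x. \<not> f i x)"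
  shows "\<exists>\<rho>. dom \<rho> \<subseteq> V \<and> card (V - dom \<rho>) = l \<and>
    (\<forall>i \<in> I. decision_tree (V - dom \<rho>) (s - 1) (\<lambda>x. f i (override \<rho> x)))"
proof (rule ccontr)
  assume no: "\<not> ?thesis"
  let ?R = "restrictions V l"
  let ?B = "\<lambda>i. {\<rho> \<in> ?R. \<not> decision_tree (V - dom \<rho>) (s - 1) (\<lambda>x. f i (override \<rho> x))}"
  have B: "card (?B i) * 2 ^ s \<le> card ?R" if "i \<in> I" for i
  proof (cases "dnf V w (f i)")
    case True
    then show ?thesis by (rule switching_lemma_card[OF V _ w s l])
  next
    case False
    then have "dnf V w (\<lambda>x. \<not> f i x)" using f that by auto
    from switching_lemma_card[OF V this w s l]
    have "card {\<rho> \<in> ?R. \<not> decision_tree (V - dom \<rho>) (s - 1) (\<lambda>x. \<not> f i (override \<rho> x))} * 2 ^ s \<le> card ?R" .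
    moreover have "decision_tree (V - dom \<rho>) (s - 1) (\<lambda>x. \<not> f i (override \<rho> x)) \<longleftrightarrow>
        decision_tree (V - dom \<rho>) (s - 1) (\<lambda>x. f i (override \<rho> x))" for \<rho>
      using decision_tree_not[of "V - dom \<rho>" "s - 1" "\<lambda>x. f i (override \<rho> x)"]
        decision_tree_not[of "V - dom \<rho>" "s - 1" "\<lambda>x. \<not> f i (override \<rho> x)"] by auto
    ultimately show ?thesis by simp
  qed
  have fR: "finite ?R" by (rule finite_restrictions[OF V])
  have "?R \<subseteq> (\<Union>i \<in> I. ?B i)"
  proof
    fix \<rho> assume "\<rho> \<in> ?R"
    then show "\<rho> \<in> (\<Union>i \<in> I. ?B i)" using no unfolding restrictions_def by blast
  qed
  then have "card ?R \<le> card (\<Union>i \<in> I. ?B i)" using I fR by (intro card_mono) auto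
  also have "\<dots> \<le> (\<Sum>i \<in> I. card (?B i))" by (rule card_UN_le[OF I(1)])
  finally have "card ?R * 2 ^ s \<le> (\<Sum>i \<in> I. card (?B i) * 2 ^ s)"
    by (simp flip: sum_distrib_right)
  also have "\<dots> \<le> (\<Sum>i \<in> I. card ?R)" by (rule sum_mono[OF B])
  also have "\<dots> = card ?R * card I" by simp
  finally have "card ?R * 2 ^ s \<le> card ?R * card I" .
  moreover have "card ?R > 0"
    using card_restrictions[OF V, of l] l by simp
  ultimately show False using I(2) by simp
qed

section \<open>Alternating machines do not compute parity\<close>

definition existential_config :: "ratm \<Rightarrow> config \<Rightarrow> bool" where
  "existential_config M c \<longleftrightarrow> cstate c \<in> existential M"

text \<open>Acceptance within \<open>j\<close> blocks and \<open>\<tau>\<close> steps. Unlike \<^const>\<open>accepting\<close>, it can be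
  evaluated for every input at every configuration, reachable or not.\<close>

fun accepts_within :: "ratm \<Rightarrow> bool list \<Rightarrow> nat \<Rightarrow> nat \<Rightarrow> config \<Rightarrow> bool" where
  "accepts_within M w 0 \<tau> c = False"
| "accepts_within M w (Suc j) 0 c = (cstate c \<in> final M)"
| "accepts_within M w (Suc j) (Suc \<tau>) c =
    (let nxt = (\<lambda>c'. accepts_within M w
       (if existential_config M c' = existential_config M c then Suc j else j) \<tau> c')
     in cstate c \<in> final M \<or>
       (if existential_config M c then \<exists>c'. step M w c c' \<and> nxt c'
        else (\<exists>c'. step M w c c') \<and> (\<forall>c'. step M w c c' \<longrightarrow> nxt c')))"

definition bounded :: "ratm \<Rightarrow> bool list \<Rightarrow> nat \<Rightarrow> nat \<Rightarrow> config \<Rightarrow> bool" where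
  "bounded M w j \<tau> c \<longleftrightarrow> (\<forall>cs. cs \<noteq> [] \<longrightarrow> hd cs = c \<longrightarrow> successively (step M w) cs \<longrightarrow>
     length cs - 1 \<le> \<tau> \<and> blocks M cs \<le> j)"

lemma blocks_Cons:
  "cs \<noteq> [] \<Longrightarrow> blocks M (c # cs) =
    (if existential_config M (hd cs) = existential_config M c then blocks M cs else Suc (blocks M cs))"
  by (cases cs) (auto simp: blocks_def existential_config_def)

lemma bounded_step:
  assumes "bounded M w j \<tau> c" "step M w c c'"
  shows "\<exists>j' \<tau>'. j = Suc j' \<and> \<tau> = Suc \<tau>' \<and>
    bounded M w (if existential_config M c' = existential_config M c then Suc j' else j') \<tau>' c'"
proof -
  have *: "Suc (length cs - 1) \<le> \<tau> \<and>
      (if existential_config M c' = existential_config M c then blocks M cs else Suc (blocks M cs)) \<le> j"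
    if "cs \<noteq> []" "hd cs = c'" "successively (step M w) cs" for cs
  proof -
    have "successively (step M w) (c # cs)" using that assms(2) by (cases cs) auto
    then have "length (c # cs) - 1 \<le> \<tau> \<and> blocks M (c # cs) \<le> j"
      using assms(1) unfolding bounded_def by force
    then show ?thesis using that by (simp add: blocks_Cons split: if_splits)
  qed
  from *[of "[c']"] have "\<tau> > 0" "j > 0" by (auto simp: blocks_def split: if_splits)
  then obtain j' \<tau>' where "j = Suc j'" "\<tau> = Suc \<tau>'" by (meson gr0_conv_Suc)
  moreover from this have "bounded M w (if existential_config M c' = existential_config M c then Suc j' else j') \<tau>' c'"
    unfolding bounded_def
  proof (intro allI impI)
    fix cs assume "cs \<noteq> []" "hd cs = c'" "successively (step M w) cs"
    from *[OF this] \<open>j = Suc j'\<close> \<open>\<tau> = Suc \<tau>'\<close>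
    show "length cs - 1 \<le> \<tau>' \<and> blocks M cs \<le> (if existential_config M c' = existential_config M c then Suc j' else j')"
      by (simp split: if_splits)
  qed
  ultimately show ?thesis by blast
qed

lemma bounded_pos: "bounded M w j \<tau> c \<Longrightarrow> j > 0"
  unfolding bounded_def by (erule allE[of _ "[c]"]) (simp add: blocks_def)

text \<open>\<open>wf_ratm\<close> restricts the transitions only at states and tape symbols of the
  machine, so finite branching is guaranteed at these configurations.\<close>

definition valid_config :: "ratm \<Rightarrow> config \<Rightarrow> bool" where
  "valid_config M c \<longleftrightarrow> cstate c \<in> states M \<and> length (work c) = tape_count M \<and>
     (\<forall>p \<in> set (work c). range (fst p) \<subseteq> symbols M)"

definition actions :: "ratm \<Rightarrow> (nat \<times> (bool \<times> move) \<times> (nat \<times> move) list) set" where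
  "actions M = states M \<times> UNIV \<times> {acts. set acts \<subseteq> symbols M \<times> UNIV \<and> length acts = tape_count M}"

lemma finite_actions: "wf_ratm M \<Longrightarrow> finite (actions M)"
proof -
  assume M: "wf_ratm M"
  have "UNIV = {Go_Left, Stay, Go_Right}" using move.exhaust by auto
  then have fin: "finite (UNIV :: move set)" by (metis finite.emptyI finite.insertI)
  then have "finite (UNIV :: (bool \<times> move) set)" by (simp add: finite_prod)
  then show ?thesis unfolding actions_def states_def
    using fin by (intro finite_cartesian_product finite_lists_length_eq) (use M in \<open>simp_all add: wf_ratm_def\<close>)
qed

lemma valid_init: "wf_ratm M \<Longrightarrow> valid_config M (init_config M w)"
proof -
  assume "wf_ratm M"
  then have "start M \<in> states M" "0 \<in> symbols M" unfolding wf_ratm_def by blast+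
  then show ?thesis by (auto simp: valid_config_def init_config_def)
qed

lemma valid_perform: "valid_config M c \<Longrightarrow> a \<in> actions M \<Longrightarrow> valid_config M (perform c a)"
proof -
  assume c: "valid_config M c" and a: "a \<in> actions M"
  obtain q b d acts where a': "a = (q, (b, d), acts)" by (metis prod.exhaust)
  have "range (fst p) \<subseteq> symbols M" if p: "p \<in> set (work (perform c a))" for p
  proof -
    obtain t i g e where z: "((t, i), (g, e)) \<in> set (zip (work c) acts)" "p = (t(i := g), move_work_head e i)"
      using p unfolding a' perform_def by auto
    have "(t, i) \<in> set (work c)" using z(1) by (rule set_zip_leftD)
    then have "range t \<subseteq> symbols M" using c unfolding valid_config_def by fastforce
    moreover have "(g, e) \<in> set acts" using z(1) by (rule set_zip_rightD)
    then have "g \<in> symbols M" using a unfolding actions_def a' by auto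
    ultimately show ?thesis unfolding z(2) by auto
  qed
  then show ?thesis
    using c a unfolding valid_config_def actions_def a' perform_def by simp
qed

text \<open>The scanned input symbol is a parameter: it is the only way in which a step depends on
  the input.\<close>

definition successors :: "ratm \<Rightarrow> config \<Rightarrow> bool option \<Rightarrow> config set" where
  "successors M c x = perform c ` transitions M (cstate c) x (read_address c) (read_work c)"

lemma step_iff_successors:
  "step M w c c' \<longleftrightarrow> c' \<in> successors M c (read_input w (address_value (address c)))"
  by (auto simp: step_def successors_def)

lemma successors_subset:
  assumes "wf_ratm M" "valid_config M c"
  shows "successors M c x \<subseteq> perform c ` actions M"
proof -
  have len: "length (read_work c) = tape_count M"
    using assms(2) by (simp add: valid_config_def read_work_def)
  have "t i \<in> symbols M" if "(t, i) \<in> set (work c)" for t i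
    using assms(2) that unfolding valid_config_def by (metis fst_conv rangeI subsetD)
  then have syms: "set (read_work c) \<subseteq> symbols M" unfolding read_work_def by auto
  have q: "cstate c \<in> states M" using assms(2) by (simp add: valid_config_def)
  have "transitions M (cstate c) x (read_address c) (read_work c) \<subseteq> actions M"
  proof
    fix a assume a: "a \<in> transitions M (cstate c) x (read_address c) (read_work c)"
    obtain q' b d acts where a': "a = (q', (b, d), acts)" by (metis prod.exhaust)
    have "\<forall>(q', (b, d), acts) \<in> transitions M (cstate c) x (read_address c) (read_work c).
      q' \<in> states M \<and> length acts = tape_count M \<and> fst ` set acts \<subseteq> symbols M"
      using assms(1) len syms q unfolding wf_ratm_def by simp
    then have "q' \<in> states M \<and> length acts = tape_count M \<and> fst ` set acts \<subseteq> symbols M"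
      using a unfolding a' by blast
    then show "a \<in> actions M" unfolding a' actions_def by auto
  qed
  then show ?thesis unfolding successors_def by (rule image_mono)
qed

lemma finite_successors: "wf_ratm M \<Longrightarrow> valid_config M c \<Longrightarrow> finite (successors M c x)"
  by (rule finite_subset[OF successors_subset]) (simp_all add: finite_actions)

lemma valid_successor: "wf_ratm M \<Longrightarrow> valid_config M c \<Longrightarrow> c' \<in> successors M c x \<Longrightarrow> valid_config M c'"
  by (metis imageE subsetD successors_subset valid_perform)

lemma accepts_within_iff_accepting:
  assumes M: "wf_ratm M"
  shows "valid_config M c \<Longrightarrow> bounded M w j \<tau> c \<Longrightarrow> accepts_within M w j \<tau> c \<longleftrightarrow> accepting M w c"
proof (induction \<tau> arbitrary: j c)
  case 0
  then obtain j' where j: "j = Suc j'" using bounded_pos by (metis gr0_conv_Suc)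
  have "\<not> step M w c c'" for c' using bounded_step[OF 0(2)] by auto
  then show ?case unfolding j accepts_within.simps by (subst accepting.simps) auto
next
  case (Suc \<tau>)
  then obtain j' where j: "j = Suc j'" using bounded_pos by (metis gr0_conv_Suc)
  define nxt where "nxt = (\<lambda>c'. accepts_within M w
      (if existential_config M c' = existential_config M c then Suc j' else j') \<tau> c')"
  have IH: "nxt c' \<longleftrightarrow> accepting M w c'" if s: "step M w c c'" for c'
    unfolding nxt_def using bounded_step[OF Suc.prems(2) s] valid_successor[OF M Suc.prems(1)] s j
    by (auto simp: step_iff_successors intro!: Suc.IH)
  have kind: "cstate c \<in> universal M \<longleftrightarrow> \<not> existential_config M c"
  proof -
    have "existential M \<inter> universal M = {}" using M unfolding wf_ratm_def by blast
    then show ?thesis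
      using Suc.prems(1) by (auto simp: valid_config_def states_def existential_config_def)
  qed
  have "accepting M w c \<longleftrightarrow> cstate c \<in> final M \<or>
     (if existential_config M c then \<exists>c'. step M w c c' \<and> accepting M w c'
      else (\<exists>c'. step M w c c') \<and> (\<forall>c'. step M w c c' \<longrightarrow> accepting M w c'))"
  proof (cases "existential_config M c")
    case True
    then show ?thesis using kind by (subst accepting.simps) (auto simp: existential_config_def)
  next
    case False
    then show ?thesis using kind by (subst accepting.simps) (auto simp: existential_config_def)
  qed
  moreover have "accepts_within M w j (Suc \<tau>) c \<longleftrightarrow> cstate c \<in> final M \<or>
     (if existential_config M c then \<exists>c'. step M w c c' \<and> accepting M w c'
      else (\<exists>c'. step M w c c') \<and> (\<forall>c'. step M w c c' \<longrightarrow> accepting M w c'))"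
  proof -
    have "(\<exists>c'. step M w c c' \<and> nxt c') \<longleftrightarrow> (\<exists>c'. step M w c c' \<and> accepting M w c')"
      "(\<forall>c'. step M w c c' \<longrightarrow> nxt c') \<longleftrightarrow> (\<forall>c'. step M w c c' \<longrightarrow> accepting M w c')"
      using IH by blast+
    then show ?thesis unfolding j accepts_within.simps Let_def nxt_def by argo
  qed
  ultimately show ?case by simp
qed

text \<open>Ignores the transition relation and the input. The family of configurations is thus the
  same for all inputs of one length, and the union bound can be taken over it before any input is
  chosen.\<close>

fun reach :: "ratm \<Rightarrow> config \<Rightarrow> nat \<Rightarrow> config set" where
  "reach M c 0 = {c}"
| "reach M c (Suc i) = (\<Union>c' \<in> reach M c i. perform c' ` actions M)"

lemma finite_reach: "wf_ratm M \<Longrightarrow> finite (reach M c i)"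
  by (induction i) (auto simp: finite_actions)

lemma card_reach: "wf_ratm M \<Longrightarrow> card (reach M c i) \<le> card (actions M) ^ i"
proof (induction i)
  case (Suc i)
  have "card (reach M c (Suc i)) \<le> (\<Sum>c' \<in> reach M c i. card (perform c' ` actions M))"
    unfolding reach.simps using Suc.prems by (intro card_UN_le finite_reach)
  also have "\<dots> \<le> (\<Sum>c' \<in> reach M c i. card (actions M))"
    using Suc.prems by (intro sum_mono card_image_le finite_actions)
  also have "\<dots> \<le> card (actions M) ^ Suc i" using Suc by simp
  finally show ?case .
qed simp

lemma valid_reach: "valid_config M c \<Longrightarrow> c' \<in> reach M c i \<Longrightarrow> valid_config M c'"
  by (induction i arbitrary: c') (auto intro: valid_perform)

section \<open>One block as a normal form, and the lower bound\<close>

definition word :: "nat \<Rightarrow> (nat \<Rightarrow> bool) \<Rightarrow> bool list" where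
  "word n x = map x [0..<n]"

text \<open>The scanned cell is either a free variable, which costs one literal, or its content is
  fixed by \<rho> or is the endmark.\<close>

lemma dnf_read_input:
  assumes "\<And>y. dnf V w (\<lambda>x. P y (override \<rho> x))" "V = - dom \<rho>"
  shows "dnf V (Suc w) (\<lambda>x. P (read_input (word n (override \<rho> x)) a) (override \<rho> x))"
proof (cases "a < n \<and> a \<notin> dom \<rho>")
  case True
  then have "read_input (word n (override \<rho> x)) a = Some (x a)" for x
    by (auto simp: read_input_def word_def override_def split: option.splits)
  moreover have "dnf V (Suc w) (\<lambda>x. P (Some (x a)) (override \<rho> x))"
    using dnf_case[of V w "\<lambda>b x. P (Some b) (override \<rho> x)" a] assms True by auto
  ultimately show ?thesis by simp
next
  case False
  then obtain y where "\<And>x. read_input (word n (override \<rho> x)) a = y"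
    by (cases "a < n") (auto simp: read_input_def word_def override_def)
  then show ?thesis using assms(1)[of y] dnf_mono[of V w _ "Suc w"] by simp
qed

text \<open>The paths inside one block give the terms of a disjunctive normal form: a step reads at most one
  variable, and the configuration at the beginning of the next block contributes \<open>s\<close> variables.\<close>

lemma block_dnf:
  assumes M: "wf_ratm M" and V: "V = - dom \<rho>" and c0: "valid_config M c0"
    and dt: "\<And>i c. i \<le> T \<Longrightarrow> c \<in> reach M c0 i \<Longrightarrow>
      decision_tree V s (\<lambda>x. accepts_within M (word n (override \<rho> x)) j (T - i) c)"
  shows "\<tau> \<le> T \<Longrightarrow> c \<in> reach M c0 (T - \<tau>) \<Longrightarrow>
    dnf V (\<tau> + s) (\<lambda>x. accepts_within M (word n (override \<rho> x)) (Suc j) \<tau> c = existential_config M c)"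
proof (induction \<tau> arbitrary: c)
  case 0
  show ?case using dnf_const by simp
next
  case (Suc \<tau>)
  note valid = valid_reach[OF c0 Suc.prems(2)]
  define h where "h = (\<lambda>c' x. accepts_within M (word n x)
    (if existential_config M c' = existential_config M c then Suc j else j) \<tau> c')"
  have Ti: "T - \<tau> = Suc (T - Suc \<tau>)" using Suc.prems(1) by simp
  have h: "dnf V (\<tau> + s) (\<lambda>x. h c' (override \<rho> x) = existential_config M c)"
    if c': "c' \<in> successors M c y" for c' y
  proof -
    have r: "c' \<in> reach M c0 (T - \<tau>)"
      using successors_subset[OF M valid] c' Suc.prems(2) unfolding Ti by fastforce
    show ?thesis
    proof (cases "existential_config M c' = existential_config M c")
      case True
      then show ?thesis using Suc.IH[OF _ r] Suc.prems(1) unfolding h_def by simp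
    next
      case False
      then have "decision_tree V s (\<lambda>x. h c' (override \<rho> x))"
        using dt[OF _ r] Suc.prems(1) unfolding h_def by simp
      then have "decision_tree V s (\<lambda>x. h c' (override \<rho> x) = existential_config M c)"
        using decision_tree_not by (cases "existential_config M c") auto
      then show ?thesis by (auto dest!: decision_tree_dnf elim: dnf_mono)
    qed
  qed
  show ?case
  proof (cases "cstate c \<in> final M")
    case True
    then show ?thesis using dnf_const by (simp add: Let_def)
  next
    case nf: False
    let ?a = "address_value (address c)"
    \<comment> \<open>One formula serves both kinds: an existential configuration accepts iff some
      successor does; a universal one rejects iff it has no successor or some successor rejects. So
      the negation gets the normal form in the universal case.\<close>
    have eq: "accepts_within M (word n x) (Suc j) (Suc \<tau>) c = existential_config M c \<longleftrightarrow>
      (\<lambda>y x. (\<not> existential_config M c \<and> successors M c y = {}) \<or>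
         (\<exists>c' \<in> successors M c y. h c' x = existential_config M c)) (read_input (word n x) ?a) x" for x
      using nf by (auto simp: Let_def h_def step_iff_successors)
    have "dnf V (Suc (\<tau> + s)) (\<lambda>x. (\<lambda>y x. (\<not> existential_config M c \<and> successors M c y = {}) \<or>
         (\<exists>c' \<in> successors M c y. h c' x = existential_config M c))
         (read_input (word n (override \<rho> x)) ?a) (override \<rho> x))"
      by (rule dnf_read_input[OF _ V]) (intro dnf_or dnf_const dnf_Bex finite_successors[OF M valid] h)
    then show ?thesis unfolding eq by simp
  qed
qed

text \<open>The left side bounds the number of formulas in the union bound; the exponent on the
  right becomes the \<open>s\<close> of the switching lemma.\<close>

lemma Suc_mult_power_less:
  "Suc T * B ^ T < (2 :: nat) ^ (Suc B * Suc T)"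
proof -
  have "B ^ T \<le> (2 ^ B) ^ T" by (rule power_mono[OF less_imp_le[OF less_exp]]) simp
  also have "\<dots> \<le> (2 ^ B) ^ Suc T" by (rule power_increasing) simp_all
  finally have "Suc T * B ^ T \<le> Suc T * (2 ^ B) ^ Suc T" by (rule mult_left_mono) simp
  also have "\<dots> < 2 ^ Suc T * (2 ^ B) ^ Suc T" using less_exp[of "Suc T"] by (intro mult_strict_right_mono) simp_all
  also have "\<dots> = 2 ^ (Suc B * Suc T)" by (simp only: mult_Suc power_add power_mult)
  finally show ?thesis .
qed

lemma parity_flip:
  fixes x :: "'v \<Rightarrow> bool"
  assumes "finite V" "v \<in> V"
  shows "odd (card {u \<in> V. (x(v := \<not> x v)) u}) \<longleftrightarrow> even (card {u \<in> V. x u})"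
proof -
  let ?A = "{u \<in> V. u \<noteq> v \<and> x u}"
  have "{u \<in> V. x u} = (if x v then insert v ?A else ?A)" using assms(2) by auto
  moreover have "{u \<in> V. (x(v := \<not> x v)) u} = (if x v then ?A else insert v ?A)"
    using assms(2) by auto
  moreover have "card (insert v ?A) = Suc (card ?A)" using assms(1) by simp
  ultimately show ?thesis by simp
qed

theorem parity_lower_bound:
  assumes M: "wf_ratm M"
    and T: "\<And>w cs. computation M w cs \<Longrightarrow> length cs - 1 \<le> T (length w) \<and> blocks M cs \<le> m"
  shows "\<exists>C. \<forall>n V. V \<subseteq> {..<n} \<longrightarrow> (C * Suc (T n)) ^ m \<le> card V \<longrightarrow>
    \<not> (\<forall>w. length w = n \<longrightarrow> (w \<in> accepted_language M \<longleftrightarrow> odd (card {v \<in> V. w ! v})))"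
proof (intro exI allI impI notI)
  let ?B = "card (actions M)"
  fix n V0
  define t where "t = T n"
  \<comment> \<open>Chosen so that 2^s exceeds the number of pairs of a step number and a
    configuration in the corresponding \<open>reach\<close>.\<close>
  define s where "s = Suc ?B * Suc t"
  \<comment> \<open>The factor by which one application of the switching lemma at width
    \<open>t + s\<close> reduces the number of variables. It is at most (16 B + 33) (t + 1), where B
    is the number of actions.\<close>
  define q where "q = 16 * (t + s) + 1"
  assume V0: "V0 \<subseteq> {..<n}" and big: "((16 * ?B + 33) * Suc (T n)) ^ m \<le> card V0"
    and parity: "\<forall>w. length w = n \<longrightarrow> (w \<in> accepted_language M \<longleftrightarrow> odd (card {v \<in> V0. w ! v}))"
  have fV0: "finite V0" using V0 finite_subset by blast
  define c0 where "c0 = init_config M (replicate n False)"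
  have init: "init_config M w = c0" if "length w = n" for w
    using that by (simp add: c0_def init_config_def)
  have c0: "valid_config M c0" unfolding c0_def by (rule valid_init[OF M])
  have bd: "bounded M w m t c0" if "length w = n" for w
    using T that init[OF that] unfolding bounded_def computation_def t_def by metis
  have "m > 0" using bounded_pos[OF bd[of "replicate n False"]] by simp
  have "q \<le> (16 * ?B + 33) * Suc (T n)"
    unfolding q_def s_def t_def by (simp add: algebra_simps)
  then have big: "q ^ m \<le> card V0" using big power_mono[of q _ m] by fastforce
  define I where "I = (SIGMA i:{..t}. reach M c0 i)"
  have fI: "finite I" unfolding I_def using finite_reach[OF M] by auto
  have cI: "card I < 2 ^ s"
  proof -
    have "card I = (\<Sum>i\<le>t. card (reach M c0 i))" unfolding I_def by (simp add: finite_reach[OF M])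
    also have "\<dots> \<le> (\<Sum>i\<le>t. ?B ^ t)"
    proof (rule sum_mono)
      fix i assume "i \<in> {..t}"
      show "card (reach M c0 i) \<le> ?B ^ t"
      proof (cases "i = t")
        case True
        then show ?thesis using card_reach[OF M] by simp
      next
        case False
        have "states M \<noteq> {} \<and> symbols M \<noteq> {}" using M unfolding wf_ratm_def by blast
        then obtain q g where "q \<in> states M" "g \<in> symbols M" by blast
        then have "(q, (False, Stay), replicate (tape_count M) (g, Stay)) \<in> actions M"
          by (auto simp: actions_def)
        then have "?B > 0" using finite_actions[OF M] by (auto simp: card_gt_0_iff)
        then have "?B ^ i \<le> ?B ^ t" using \<open>i \<in> {..t}\<close> by (intro power_increasing) auto
        then show ?thesis using card_reach[OF M, of c0 i] by linarith
      qed
    qed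
    also have "\<dots> = Suc t * ?B ^ t" by simp
    also have "\<dots> < 2 ^ s" unfolding s_def by (rule Suc_mult_power_less)
    finally show ?thesis .
  qed
  have s0: "s > 0" unfolding s_def by simp
  let ?g = "\<lambda>\<rho> j i x. accepts_within M (word n (override \<rho> x)) j (t - fst i) (snd i)"
  have step: "dnf (- dom \<rho>) (t + (s - 1)) (\<lambda>x. ?g \<rho> (Suc j) i x = existential_config M (snd i))"
    if dt: "\<And>i. i \<in> I \<Longrightarrow> decision_tree (- dom \<rho>) (s - 1) (?g \<rho> j i)" and i: "i \<in> I" for \<rho> j i
  proof -
    have "dnf (- dom \<rho>) (t - fst i + (s - 1)) (\<lambda>x. ?g \<rho> (Suc j) i x = existential_config M (snd i))"
      using i by (intro block_dnf[OF M refl c0]) (auto simp: I_def intro!: dt[unfolded I_def, of "(_, _)", simplified])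
    then show ?thesis by (rule dnf_mono) simp
  qed
  \<comment> \<open>Blocks are counted from the end of the computation, and all formulas with
    \<open>j\<close> blocks left become shallow trees at once. Only m - 1 rounds are made: the last
    factor \<open>q\<close> is kept in order to exceed the width of the final normal form.\<close>
  have "\<exists>\<rho>. - dom \<rho> \<subseteq> V0 \<and> q ^ (m - j) \<le> card (- dom \<rho>) \<and>
      (\<forall>i \<in> I. decision_tree (- dom \<rho>) (s - 1) (?g \<rho> j i))" if "j < m" for j
    using that
  proof (induction j)
    case 0
    \<comment> \<open>Cells outside \<open>V0\<close> are fixed to 0. With no block left,
      \<open>accepts_within\<close> is constantly false.\<close>
    let ?r = "\<lambda>v. if v \<in> V0 then None else Some False"
    have "- dom ?r = V0" by (auto split: if_splits)
    then show ?case using big by (intro exI[of _ ?r]) (auto intro: decision_tree.leaf)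
  next
    case (Suc j)
    then obtain \<rho> where r: "- dom \<rho> \<subseteq> V0" "q ^ (m - j) \<le> card (- dom \<rho>)"
      "\<And>i. i \<in> I \<Longrightarrow> decision_tree (- dom \<rho>) (s - 1) (?g \<rho> j i)" by auto
    have mj: "m - j = Suc (m - Suc j)" using Suc.prems by simp
    have "s \<le> q ^ (m - Suc j)"
    proof -
      have "s \<le> q" unfolding q_def by simp
      also have "q ^ 1 \<le> q ^ (m - Suc j)" using Suc.prems unfolding q_def by (intro power_increasing) auto
      finally show ?thesis by simp
    qed
    moreover have "q ^ (m - Suc j) * (16 * (t + s) + 1) \<le> card (- dom \<rho>)"
      using r(2) unfolding mj q_def by (simp add: mult.commute)
    moreover have "dnf (- dom \<rho>) (t + s) (?g \<rho> (Suc j) i) \<or> dnf (- dom \<rho>) (t + s) (\<lambda>x. \<not> ?g \<rho> (Suc j) i x)"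
      if "i \<in> I" for i
      using dnf_mono[OF step[OF r(3) that], of "t + s"] by (cases "existential_config M (snd i)") auto
    ultimately have "\<exists>\<pi>. dom \<pi> \<subseteq> - dom \<rho> \<and> card (- dom \<rho> - dom \<pi>) = q ^ (m - Suc j) \<and>
      (\<forall>i \<in> I. decision_tree (- dom \<rho> - dom \<pi>) (s - 1) (\<lambda>x. ?g \<rho> (Suc j) i (override \<pi> x)))"
      using s0 by (intro switching_lemma[OF finite_subset[OF r(1) fV0] fI cI, where w = "t + s"]) simp_all
    then obtain \<pi> where pi: "dom \<pi> \<subseteq> - dom \<rho>" "card (- dom \<rho> - dom \<pi>) = q ^ (m - Suc j)"
      "\<And>i. i \<in> I \<Longrightarrow> decision_tree (- dom \<rho> - dom \<pi>) (s - 1) (\<lambda>x. ?g \<rho> (Suc j) i (override \<pi> x))" by blast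
    have "- dom (\<pi> ++ \<rho>) = - dom \<rho> - dom \<pi>" by auto
    then show ?case using pi r(1) by (intro exI[of _ "\<pi> ++ \<rho>"]) (auto simp: override_override)
  qed
  from this[of "m - 1"] obtain \<rho> where r: "- dom \<rho> \<subseteq> V0" "q \<le> card (- dom \<rho>)"
    "\<And>i. i \<in> I \<Longrightarrow> decision_tree (- dom \<rho>) (s - 1) (?g \<rho> (m - 1) i)" using \<open>m > 0\<close> by auto
  have "(0, c0) \<in> I" unfolding I_def by simp
  from step[OF r(3) this] have d: "dnf (- dom \<rho>) (t + (s - 1)) (\<lambda>x. accepts_within M (word n (override \<rho> x)) m t c0
      = existential_config M c0)" using \<open>m > 0\<close> by simp
  have "accepts_within M (word n y) m t c0 \<longleftrightarrow> odd (card {v \<in> V0. y v})" for y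
  proof -
    have l: "length (word n y) = n" by (simp add: word_def)
    have "accepts_within M (word n y) m t c0 \<longleftrightarrow> word n y \<in> accepted_language M"
      unfolding accepted_language_def mem_Collect_eq init[OF l]
      by (rule accepts_within_iff_accepting[OF M c0 bd[OF l]])
    moreover have "{v \<in> V0. word n y ! v} = {v \<in> V0. y v}" using V0 by (auto simp: word_def)
    ultimately show ?thesis using parity l by simp
  qed
  note d = d[unfolded this]
  show False
  proof (rule dnf_not_parity[OF d])
    show "t + (s - 1) < card (- dom \<rho>)" using r(2) s0 unfolding q_def by arith
    fix x v assume v: "v \<in> - dom \<rho>"
    then have "\<rho> v = None" by auto
    then have flip: "override \<rho> (x(v := \<not> x v)) = (override \<rho> x)(v := \<not> override \<rho> x v)"
      by (intro ext) (simp add: override_def split: option.split)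
    have "v \<in> V0" using v r(1) by blast
    from parity_flip[OF fV0 this, of "override \<rho> x"]
    show "(odd (card {u \<in> V0. override \<rho> (x(v := \<not> x v)) u}) = existential_config M c0) =
        (\<not> (odd (card {u \<in> V0. override \<rho> x u}) = existential_config M c0))"
      unfolding flip by argo
  qed
qed

section \<open>A machine for the parity game\<close>

text \<open>Value, number of steps and number of blocks are established in one induction, because
  \<open>ATIME\<close> bounds every computation, including those that follow a losing move.
  \<open>V\<close> assigns the values of the successors.\<close>

inductive evaluates :: "ratm \<Rightarrow> bool list \<Rightarrow> nat \<Rightarrow> nat \<Rightarrow> bool \<Rightarrow> config \<Rightarrow> bool" for M w where
  evaluates_final: "cstate c \<in> final M \<Longrightarrow> (\<And>c'. \<not> step M w c c') \<Longrightarrow> evaluates M w t (Suc j) True c"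
| evaluates_step: "cstate c \<notin> final M \<Longrightarrow> cstate c \<in> states M \<Longrightarrow>
    (\<And>c'. step M w c c' \<Longrightarrow>
      evaluates M w t (if existential_config M c' = existential_config M c then Suc j else j) (V c') c') \<Longrightarrow>
    v = (if existential_config M c then \<exists>c'. step M w c c' \<and> V c'
         else (\<exists>c'. step M w c c') \<and> (\<forall>c'. step M w c c' \<longrightarrow> V c')) \<Longrightarrow>
    evaluates M w (Suc t) (Suc j) v c"

lemma evaluates_mono: "evaluates M w t j v c \<Longrightarrow> t \<le> t' \<Longrightarrow> evaluates M w t' j v c"
proof (induction arbitrary: t' rule: evaluates.induct)
  case (evaluates_final c t j)
  then show ?case by (auto intro: evaluates.evaluates_final)
next
  case (evaluates_step c t j V v)
  then obtain t'' where "t' = Suc t''" "t \<le> t''" by (cases t') auto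
  with evaluates_step show ?case by (auto intro!: evaluates.evaluates_step[where V = V])
qed

lemma evaluates_bounded: "evaluates M w t j v c \<Longrightarrow> bounded M w j t c"
proof (induction rule: evaluates.induct)
  case (evaluates_final c t j)
  show ?case unfolding bounded_def
  proof (intro allI impI)
    fix cs assume "cs \<noteq> []" "hd cs = c" "successively (step M w) cs"
    then have "cs = [c]" using evaluates_final.hyps(2) by (cases cs rule: remdups_adj.cases) auto
    then show "length cs - 1 \<le> t \<and> blocks M cs \<le> Suc j" by (simp add: blocks_def)
  qed
next
  case (evaluates_step c t j V v)
  show ?case unfolding bounded_def
  proof (intro allI impI)
    fix cs assume cs: "cs \<noteq> []" "hd cs = c" "successively (step M w) cs"
    show "length cs - 1 \<le> Suc t \<and> blocks M cs \<le> Suc j"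
    proof (cases "tl cs")
      case Nil
      then have "cs = [c]" using cs by (cases cs) auto
      then show ?thesis by (simp add: blocks_def)
    next
      case (Cons c' ds)
      then have e: "cs = c # c' # ds" using cs by (cases cs) auto
      then have s: "step M w c c'" "successively (step M w) (c' # ds)" using cs(3) by auto
      have "length (c' # ds) - 1 \<le> t \<and> blocks M (c' # ds) \<le>
          (if existential_config M c' = existential_config M c then Suc j else j)"
        using evaluates_step.IH[OF s(1)] s(2) unfolding bounded_def by force
      then show ?thesis unfolding e by (auto simp: blocks_Cons split: if_splits)
    qed
  qed
qed

lemma evaluates_accepting:
  assumes "wf_ratm M"
  shows "evaluates M w t j v c \<Longrightarrow> accepting M w c \<longleftrightarrow> v"
proof (induction rule: evaluates.induct)
  case (evaluates_final c t j)
  then show ?case by (auto intro: accepting.final)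
next
  case (evaluates_step c t j V v)
  have "existential M \<inter> universal M = {}" using assms unfolding wf_ratm_def by blast
  then have "cstate c \<in> universal M \<longleftrightarrow> \<not> existential_config M c"
    using evaluates_step.hyps(2) by (auto simp: states_def existential_config_def)
  then show ?case
    using evaluates_step.hyps(1,4) evaluates_step.IH
    by (subst accepting.simps) (auto simp: existential_config_def)
qed

text \<open>The activities are the loops whose counter is being incremented. \<open>Choose r\<close> and \<open>Seek r\<close> are played by the
  player of level \<open>r + 1\<close>, on the counter of level \<open>r\<close>; the Boolean is the parity that the
  player still has to establish, in \<open>Back\<close> whether the counter has overflowed, and in \<open>Halt r\<close> whether
  the player of level \<open>r\<close> has won.\<close>

datatype activity = Guess nat bool | Choose nat | Evaluate bool

datatype ctrl = Init | Count | Count_Carry | Count_Return | Layout nat | Layout_Return nat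
  | Guessing nat bool | Inc activity | Back activity bool | Choosing nat | Seek nat bool
  | Evaluating bool | Halt nat bool

instance activity :: countable by countable_datatype
instance ctrl :: countable by countable_datatype

type_synonym tape_action = "nat \<times> move"

locale parity_machine =
  fixes m k :: nat
  assumes m: "m \<ge> 2"
begin

text \<open>Each of the \<open>m\<close> segments of the address tape consists of
  \<open>k + 1\<close> chunks of \<open>digits l\<close> cells, the unit of length that the machine
  can measure.\<close>

abbreviation chunks :: nat where "chunks \<equiv> m * Suc k"

fun segment :: "activity \<Rightarrow> nat" where
  "segment (Guess r v) = r"
| "segment (Choose r) = r"
| "segment (Evaluate v) = m"

fun activity_player :: "activity \<Rightarrow> nat" where
  "activity_player (Guess r v) = r"
| "activity_player (Choose r) = Suc r"
| "activity_player (Evaluate v) = m"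

text \<open>Odd players are existential. The set-up belongs to player 1, so it costs no block, and
  the levels 1 to \<open>m\<close> give \<open>m\<close> blocks.\<close>

fun player :: "ctrl \<Rightarrow> nat" where
  "player (Guessing r v) = r"
| "player (Inc \<kappa>) = activity_player \<kappa>"
| "player (Back \<kappa> ov) = activity_player \<kappa>"
| "player (Choosing r) = Suc r"
| "player (Seek r v) = Suc r"
| "player (Evaluating v) = m"
| "player (Halt r v) = r"
| "player q = 1"

fun valid_activity :: "activity \<Rightarrow> bool" where
  "valid_activity (Guess r v) = (r < m)"
| "valid_activity (Choose r) = (r < m)"
| "valid_activity (Evaluate v) = True"

fun valid_ctrl :: "ctrl \<Rightarrow> bool" where
  "valid_ctrl (Layout c) = (c \<le> chunks)"
| "valid_ctrl (Layout_Return c) = (c < chunks)"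
| "valid_ctrl (Guessing r v) = (r < m)"
| "valid_ctrl (Inc \<kappa>) = valid_activity \<kappa>"
| "valid_ctrl (Back \<kappa> ov) = valid_activity \<kappa>"
| "valid_ctrl (Choosing r) = (r < m)"
| "valid_ctrl (Seek r v) = (r < m)"
| "valid_ctrl (Halt r v) = (r \<le> m)"
| "valid_ctrl q = True"

text \<open>After its last round a loop is lost for its player if the guesses do not add up to the
  required parity, or if no subblock has been challenged. The move is that of the head on the table
  of guesses: \<open>Go_Left\<close> leads from behind the last guess onto it, and from each guess
  to the preceding one.\<close>

fun resume :: "activity \<Rightarrow> bool \<Rightarrow> ctrl \<times> move" where
  "resume (Guess r v) ov =
    (if ov then if v then (Halt r False, Stay) else (Choosing r, Go_Left) else (Guessing r v, Stay))"
| "resume (Choose r) ov = (if ov then (Halt (Suc r) False, Stay) else (Choosing r, Go_Left))"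
| "resume (Evaluate v) ov = (if ov then (Halt m (\<not> v), Stay) else (Evaluating v, Stay))"

text \<open>The arguments after the control state are the scanned input cell, the scanned address cell, and the
  scanned symbols of the ruler, which always moves together with the address head and labels
  the address cells with the levels, of the binary counter measuring the address tape, and of the table
  of guesses.\<close>

fun delta :: "ctrl \<Rightarrow> bool option \<Rightarrow> bool option \<Rightarrow> nat \<Rightarrow> nat \<Rightarrow> nat \<Rightarrow>
    (ctrl \<times> (bool \<times> move) \<times> tape_action \<times> tape_action \<times> tape_action) set" where
  "delta Init x y R B Q = {(Count, (y = Some True, Stay), (Suc m, Stay), (B, Stay), (Q, Stay))}"
| "delta Count x y R B Q =
    (if y = None
     then if R = Suc m then {}
       else {(Layout 0, (False, Go_Left), (R, Go_Left), (B, Stay), (Q, Stay))}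
     else {(Count_Carry, (y = Some True, Stay), (R, Stay), (B, Stay), (Q, Stay))})"
| "delta Count_Carry x y R B Q =
    (if B = 2 then {(Count_Carry, (y = Some True, Stay), (R, Stay), (1, Go_Left), (Q, Stay))}
     else {(Count_Return, (y = Some True, Stay), (R, Stay), (2, Go_Right), (Q, Stay))})"
| "delta Count_Return x y R B Q =
    (if B = 0 then {(Count, (y = Some True, Go_Right), (R, Go_Right), (B, Go_Left), (Q, Stay))}
     else {(Count_Return, (y = Some True, Stay), (R, Stay), (B, Go_Right), (Q, Stay))})"
| "delta (Layout c) x y R B Q =
    (if c = chunks then {(Guessing 1 True, (y = Some True, Go_Right), (R, Go_Right), (B, Stay), (Q, Stay))}
     else if B = 0 then {(Layout_Return c, (y = Some True, Stay), (R, Stay), (B, Go_Right), (Q, Stay))}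
     else if R = Suc m then {}
     else {(Layout c, (y = Some True, Go_Left), (m - c div Suc k, Go_Left), (B, Go_Left), (Q, Stay))})"
| "delta (Layout_Return c) x y R B Q =
    (if B = 0 then {(Layout (Suc c), (y = Some True, Stay), (R, Stay), (B, Go_Left), (Q, Stay))}
     else {(Layout_Return c, (y = Some True, Stay), (R, Stay), (B, Go_Right), (Q, Stay))})"
| "delta (Guessing r v) x y R B Q =
    (\<lambda>g. (Inc (Guess r (v \<noteq> g)), (y = Some True, Stay), (R, Stay), (B, Stay), (of_bool g, Go_Right))) ` UNIV"
| "delta (Inc \<kappa>) x y R B Q =
    (if R \<noteq> segment \<kappa> then {(Back \<kappa> True, (y = Some True, Go_Left), (R, Go_Left), (B, Stay), (Q, Stay))}
     else if y = Some True then {(Inc \<kappa>, (False, Go_Right), (R, Go_Right), (B, Stay), (Q, Stay))}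
     else {(Back \<kappa> False, (True, Go_Left), (R, Go_Left), (B, Stay), (Q, Stay))})"
| "delta (Back \<kappa> ov) x y R B Q =
    (if R = segment \<kappa> then {(Back \<kappa> ov, (y = Some True, Go_Left), (R, Go_Left), (B, Stay), (Q, Stay))}
     else {(fst (resume \<kappa> ov), (y = Some True, Go_Right), (R, Go_Right), (B, Stay), (Q, snd (resume \<kappa> ov)))})"
| "delta (Choosing r) x y R B Q =
    {(Seek r (Q \<noteq> 1), (y = Some True, Stay), (R, Stay), (B, Stay), (Q, Stay)),
     (Inc (Choose r), (y = Some True, Stay), (R, Stay), (B, Stay), (Q, Stay))}"
| "delta (Seek r v) x y R B Q =
    (if R = r then {(Seek r v, (y = Some True, Go_Right), (R, Go_Right), (B, Stay), (Q, Stay))}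
     else {(if Suc r = m then Evaluating v else Guessing (Suc r) v,
       (y = Some True, Stay), (R, Stay), (B, Stay), (Q, Stay))})"
| "delta (Evaluating v) x y R B Q =
    {(Inc (Evaluate (v \<noteq> (x = Some True))), (y = Some True, Stay), (R, Stay), (B, Stay), (Q, Stay))}"
| "delta (Halt r v) x y R B Q = {}"

text \<open>\<open>Halt r True\<close> is a win of player \<open>r\<close>,
  \<open>Halt r False\<close> a loss. Since exactly the odd players are existential, the existential
  side has won, and the input is accepted, iff \<open>v = odd r\<close>.\<close>

definition machine :: ratm where
  "machine = \<lparr>existential = to_nat ` {q. valid_ctrl q \<and> odd (player q)},
     universal = to_nat ` {q. valid_ctrl q \<and> even (player q)},
     start = to_nat Init, final = to_nat ` {Halt r v | r v. r \<le> m \<and> v = odd r},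
     symbols = {..m + 2}, tape_count = 3,
     transitions = (\<lambda>q x y gs. (\<lambda>(q', a, t1, t2, t3). (to_nat q', a, [t1, t2, t3])) `
       delta (from_nat q) x y (gs ! 0) (gs ! 1) (gs ! 2))\<rparr>"

lemma finite_valid_ctrl: "finite {q. valid_ctrl q}"
proof -
  let ?A = "(\<lambda>(r, v). Guess r v) ` ({..m} \<times> UNIV) \<union> Choose ` {..m} \<union> range Evaluate"
  let ?Q = "{Init, Count, Count_Carry, Count_Return} \<union> Layout ` {..chunks} \<union> Layout_Return ` {..chunks} \<union>
    (\<lambda>(r, v). Guessing r v) ` ({..m} \<times> UNIV) \<union> Inc ` ?A \<union> (\<lambda>(\<kappa>, v). Back \<kappa> v) ` (?A \<times> UNIV) \<union>
    Choosing ` {..m} \<union> (\<lambda>(r, v). Seek r v) ` ({..m} \<times> UNIV) \<union> range Evaluating \<union>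
    (\<lambda>(r, v). Halt r v) ` ({..m} \<times> UNIV)"
  have A: "\<kappa> \<in> ?A" if "valid_activity \<kappa>" for \<kappa> using that by (cases \<kappa>) force+
  have "q \<in> ?Q" if q: "valid_ctrl q" for q
  proof (cases q)
    case (Inc \<kappa>)
    then have "q \<in> Inc ` ?A" using q A by (auto simp del: Un_iff)
    then show ?thesis by blast
  next
    case (Back \<kappa> v)
    then have "q \<in> (\<lambda>(\<kappa>, v). Back \<kappa> v) ` (?A \<times> UNIV)" using q A[of \<kappa>] by (auto simp del: Un_iff)
    then show ?thesis by blast
  qed (use q in \<open>force+\<close>)
  then have "{q. valid_ctrl q} \<subseteq> ?Q" by blast
  moreover have "finite ?Q" by (intro finite_UnI finite_imageI finite_cartesian_product) auto
  ultimately show ?thesis by (rule finite_subset)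
qed

lemma valid_resume: "valid_activity \<kappa> \<Longrightarrow> valid_ctrl (fst (resume \<kappa> ov))"
  using m by (cases \<kappa>) auto

lemma valid_delta:
  assumes "valid_ctrl q" "(q', a, (r, d1), (b, d2), (g, d3)) \<in> delta q x y R B Q"
    and "R \<le> m + 2" "B \<le> m + 2" "Q \<le> m + 2"
  shows "valid_ctrl q' \<and> r \<le> m + 2 \<and> b \<le> m + 2 \<and> g \<le> m + 2"
proof (cases q)
  case (Guessing r v)
  then show ?thesis using assms m by auto
next
  case (Choosing r)
  then show ?thesis using assms m by auto
qed (use assms m valid_resume in \<open>simp_all split: if_splits\<close>)

lemma states_machine: "states machine = to_nat ` {q. valid_ctrl q}"
  by (auto simp: states_def machine_def)

lemma wf_machine: "wf_ratm machine"
proof -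
  have delta: "q' \<in> states machine \<and> length acts = 3 \<and> fst ` set acts \<subseteq> symbols machine"
    if q: "valid_ctrl q" and gs: "length gs = 3" "set gs \<subseteq> symbols machine"
      and a: "(q', (b, d), acts) \<in> transitions machine (to_nat q) x y gs" for q x y gs q' b d acts
  proof -
    have s: "gs ! i \<le> m + 2" if "i < 3" for i
    proof -
      have "gs ! i \<in> set gs" using gs(1) that by simp
      then show ?thesis using gs(2) by (auto simp: machine_def)
    qed
    obtain p r d1 b' d2 g d3 where p: "(p, (b, d), (r, d1), (b', d2), (g, d3)) \<in> delta q x y (gs ! 0) (gs ! 1) (gs ! 2)"
      "q' = to_nat p" "acts = [(r, d1), (b', d2), (g, d3)]"
      using a unfolding machine_def by auto
    from valid_delta[OF q p(1)] s have "valid_ctrl p \<and> r \<le> m + 2 \<and> b' \<le> m + 2 \<and> g \<le> m + 2" by simp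
    then show ?thesis unfolding states_machine p(2,3) by (auto simp: machine_def)
  qed
  have halt: "transitions machine q x y gs = {}" if "q \<in> final machine" for q x y gs
    using that by (auto simp: machine_def)
  have sets: "finite (existential machine)" "finite (universal machine)"
    "existential machine \<inter> universal machine = {}"
    using finite_valid_ctrl by (auto simp: machine_def)
  have states: "start machine \<in> states machine" "final machine \<subseteq> states machine"
    unfolding states_machine by (auto simp: machine_def)
  have syms: "finite (symbols machine)" "0 \<in> symbols machine"
    by (auto simp: machine_def)
  have "(q \<in> final machine \<longrightarrow> transitions machine q x y gs = {}) \<and>
      (\<forall>(q', (b, d), acts) \<in> transitions machine q x y gs.
         q' \<in> states machine \<and> length acts = tape_count machine \<and> fst ` set acts \<subseteq> symbols machine)"
    if q: "q \<in> states machine" and gs: "length gs = tape_count machine \<and> set gs \<subseteq> symbols machine" for q x y gs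
  proof -
    obtain q0 where q0: "q = to_nat q0" "valid_ctrl q0" using q states_machine by auto
    have "length gs = 3" using gs by (simp add: machine_def)
    with delta[OF q0(2), of gs] gs have D: "q' \<in> states machine \<and> length acts = 3 \<and> fst ` set acts \<subseteq> symbols machine"
      if "(q', (b, d), acts) \<in> transitions machine q x y gs" for q' b d acts
      using that unfolding q0(1) by blast
    have tc: "tape_count machine = 3" by (simp add: machine_def)
    have "(\<lambda>(q', (b, d), acts). q' \<in> states machine \<and>
          length acts = tape_count machine \<and> fst ` set acts \<subseteq> symbols machine) a"
      if a: "a \<in> transitions machine q x y gs" for a
    proof -
      obtain q' b d acts where a': "a = (q', (b, d), acts)" by (metis prod.exhaust)
      show ?thesis unfolding a' prod.case tc by (rule D[OF a[unfolded a']])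
    qed
    then show ?thesis using halt[of q x y gs] by (intro conjI impI ballI)
  qed
  then show ?thesis unfolding wf_ratm_def using sets states syms by simp
qed

section \<open>Steps of the machine and the value for the player to move\<close>

definition conf :: "nat \<Rightarrow> ctrl \<Rightarrow> (nat \<Rightarrow> bool) \<Rightarrow> nat \<Rightarrow> (int \<Rightarrow> nat) \<Rightarrow> (int \<Rightarrow> nat) \<Rightarrow> int \<Rightarrow> (int \<Rightarrow> nat) \<Rightarrow> int \<Rightarrow> config" where
  "conf l q f h R B i Q p = \<lparr>cstate = to_nat q, address = map f [0..<l], address_head = h,
     work = [(R, int h), (B, i), (Q, p)]\<rparr>"

definition input_at :: "bool list \<Rightarrow> nat \<Rightarrow> (nat \<Rightarrow> bool) \<Rightarrow> bool option" where
  "input_at w l f = read_input w (address_value (map f [0..<l]))"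

text \<open>The head positions of address tape and ruler are kept in one variable, so that the heads must not be at the
  end of the address tape towards which they are moving.\<close>

definition successor :: "nat \<Rightarrow> (nat \<Rightarrow> bool) \<Rightarrow> nat \<Rightarrow> (int \<Rightarrow> nat) \<Rightarrow> (int \<Rightarrow> nat) \<Rightarrow> int \<Rightarrow> (int \<Rightarrow> nat) \<Rightarrow> int \<Rightarrow>
    ctrl \<times> (bool \<times> move) \<times> tape_action \<times> tape_action \<times> tape_action \<Rightarrow> config" where
  "successor l f h R B i Q p = (\<lambda>(q, (y, d), (r, _), (b, e), (g, e')).
     conf l q (f(h := y)) (move_address_head l d h) (R(int h := r)) (B(i := b)) (move_work_head e i)
       (Q(p := g)) (move_work_head e' p))"

definition synchronous :: "nat \<Rightarrow> nat \<Rightarrow> ctrl \<times> (bool \<times> move) \<times> tape_action \<times> tape_action \<times> tape_action \<Rightarrow> bool" where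
  "synchronous l h = (\<lambda>(q, (y, d), (r, d'), _). d' = d \<and> (d = Go_Left \<longrightarrow> 0 < h) \<and> (d = Go_Right \<longrightarrow> h < l))"

lemma map_upt_update: "(map f [0..<l])[h := y] = map (f(h := y)) [0..<l]"
  by (rule nth_equalityI) (auto simp: nth_list_update)

lemma perform_conf:
  assumes "synchronous l h a"
  shows "perform (conf l q f h R B i Q p) ((\<lambda>(q', a, t1, t2, t3). (to_nat q', a, [t1, t2, t3])) a) =
    successor l f h R B i Q p a"
proof -
  obtain q' y d r b e g e' where a: "a = (q', (y, d), (r, d), (b, e), (g, e'))"
    and d: "d = Go_Left \<longrightarrow> 0 < h" "d = Go_Right \<longrightarrow> h < l"
    using assms by (cases a) (auto simp: synchronous_def)
  have "int (move_address_head l d h) = move_work_head d (int h)"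
    using d by (cases d) (auto simp: min_def)
  then show ?thesis
    by (simp add: a perform_def conf_def successor_def map_upt_update)
qed

abbreviation actions_of :: "bool list \<Rightarrow> nat \<Rightarrow> ctrl \<Rightarrow> (nat \<Rightarrow> bool) \<Rightarrow> nat \<Rightarrow> (int \<Rightarrow> nat) \<Rightarrow> (int \<Rightarrow> nat) \<Rightarrow> int \<Rightarrow>
    (int \<Rightarrow> nat) \<Rightarrow> int \<Rightarrow> (ctrl \<times> (bool \<times> move) \<times> tape_action \<times> tape_action \<times> tape_action) set" where
  "actions_of w l q f h R B i Q p \<equiv>
    delta q (input_at w l f) (if h < l then Some (f h) else None) (R (int h)) (B i) (Q p)"

lemma step_conf:
  assumes "\<And>a. a \<in> actions_of w l q f h R B i Q p \<Longrightarrow> synchronous l h a"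
  shows "step machine w (conf l q f h R B i Q p) c' \<longleftrightarrow>
    c' \<in> successor l f h R B i Q p ` actions_of w l q f h R B i Q p"
proof -
  let ?c = "conf l q f h R B i Q p"
  have "transitions machine (cstate ?c) (read_input w (address_value (address ?c))) (read_address ?c) (read_work ?c) =
      (\<lambda>(q', a, t1, t2, t3). (to_nat q', a, [t1, t2, t3])) ` actions_of w l q f h R B i Q p"
    by (simp add: machine_def conf_def read_address_def read_work_def input_at_def)
  then show ?thesis
    using perform_conf[OF assms] unfolding step_def by auto
qed

text \<open>The value is seen from player \<open>r\<close>; \<open>v = odd r\<close> translates it
  into acceptance. The levels \<open>r\<close> to \<open>m\<close> leave \<open>Suc m - r\<close>
  blocks.\<close>

definition wins :: "bool list \<Rightarrow> nat \<Rightarrow> nat \<Rightarrow> bool \<Rightarrow> config \<Rightarrow> bool" where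
  "wins w t r v c = evaluates machine w t (Suc m - r) (v = odd r) c"

lemma wins_mono: "wins w t r v c \<Longrightarrow> t \<le> t' \<Longrightarrow> wins w t' r v c"
  unfolding wins_def by (rule evaluates_mono)

lemma existential_conf: "existential_config machine (conf l q f h R B i Q p) \<longleftrightarrow> valid_ctrl q \<and> odd (player q)"
  by (auto simp: existential_config_def machine_def conf_def)

lemma final_conf: "cstate (conf l q f h R B i Q p) \<in> final machine \<longleftrightarrow> (\<exists>r v. q = Halt r v \<and> r \<le> m \<and> v = odd r)"
  by (auto simp: machine_def conf_def)

lemma states_conf: "cstate (conf l q f h R B i Q p) \<in> states machine \<longleftrightarrow> valid_ctrl q"
  by (auto simp: states_machine conf_def)

lemma wins_halt:
  assumes "r \<le> m"
  shows "wins w (Suc t) r v (conf l (Halt r v) f h R B i Q p)"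
proof -
  have s: "Suc m - r = Suc (m - r)" using assms by simp
  have n: "\<not> step machine w (conf l (Halt r v) f h R B i Q p) c'" for c'
    by (subst step_conf) auto
  show ?thesis
  proof (cases "v = odd r")
    case True
    then show ?thesis unfolding wins_def s using n assms
      by (auto intro!: evaluates_final simp: final_conf)
  next
    case False
    then have "(v = odd r) = (if existential_config machine (conf l (Halt r v) f h R B i Q p)
       then \<exists>c'. step machine w (conf l (Halt r v) f h R B i Q p) c' \<and> False
       else (\<exists>c'. step machine w (conf l (Halt r v) f h R B i Q p) c') \<and>
         (\<forall>c'. step machine w (conf l (Halt r v) f h R B i Q p) c' \<longrightarrow> False))"
      using n by auto
    then show ?thesis unfolding wins_def s using n assms False
      by (intro evaluates_step[where V = "\<lambda>_. False"]) (auto simp: final_conf states_conf)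
  qed
qed

text \<open>In terms of winning, both kinds of player obey the same rule: some action must win. A
  configuration without successors rejects, which is a loss for the existential player 1 but would
  be a win for a universal player, whence \<open>ne\<close>. Injectivity transfers the values
  \<open>W\<close> from actions to configurations.\<close>

lemma wins_step:
  assumes q: "valid_ctrl q" "player q = r" "r \<le> m" "\<nexists>r v. q = Halt r v"
    and sync: "\<And>a. a \<in> actions_of w l q f h R B i Q p \<Longrightarrow> synchronous l h a \<and> valid_ctrl (fst a) \<and> player (fst a) = r"
    and ne: "actions_of w l q f h R B i Q p \<noteq> {} \<or> r = 1"
    and win: "\<And>a. a \<in> actions_of w l q f h R B i Q p \<Longrightarrow> wins w t r (W a) (successor l f h R B i Q p a)"
    and inj: "inj_on (successor l f h R B i Q p) (actions_of w l q f h R B i Q p)"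
  shows "wins w (Suc t) r (\<exists>a \<in> actions_of w l q f h R B i Q p. W a) (conf l q f h R B i Q p)"
proof -
  let ?c = "conf l q f h R B i Q p" and ?A = "actions_of w l q f h R B i Q p"
  let ?s = "successor l f h R B i Q p"
  have st: "step machine w ?c c' \<longleftrightarrow> c' \<in> ?s ` ?A" for c'
    by (rule step_conf) (use sync in blast)
  have s: "Suc m - r = Suc (m - r)" using q(3) by simp
  have kind: "existential_config machine (?s a) = existential_config machine ?c" if "a \<in> ?A" for a
    using sync[OF that] q by (cases a) (auto simp: successor_def existential_conf)
  define V where "V = (\<lambda>c'. W (the_inv_into ?A ?s c') = odd r)"
  have V: "V (?s a) = (W a = odd r)" if "a \<in> ?A" for a
    unfolding V_def using the_inv_into_f_f[OF inj that] by simp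
  show ?thesis unfolding wins_def s
  proof (rule evaluates_step[where V = V])
    fix c' assume "step machine w ?c c'"
    then obtain a where a: "a \<in> ?A" "c' = ?s a" using st by auto
    show "evaluates machine w t (if existential_config machine c' = existential_config machine ?c
        then Suc (m - r) else m - r) (V c') c'"
      using win[OF a(1)] kind[OF a(1)] V[OF a(1)] a(2) s unfolding wins_def by simp
  next
    have "(\<exists>c'. step machine w ?c c' \<and> V c') \<longleftrightarrow> (\<exists>a \<in> ?A. W a = odd r)" using st V by auto
    moreover have "(\<forall>c'. step machine w ?c c' \<longrightarrow> V c') \<longleftrightarrow> (\<forall>a \<in> ?A. W a = odd r)" using st V by auto
    moreover have "(\<exists>c'. step machine w ?c c') \<longleftrightarrow> ?A \<noteq> {}" using st by auto
    moreover have "existential_config machine ?c = odd r" using q existential_conf by simp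
    ultimately show "((\<exists>a \<in> ?A. W a) = odd r) = (if existential_config machine ?c
       then \<exists>c'. step machine w ?c c' \<and> V c'
       else (\<exists>c'. step machine w ?c c') \<and> (\<forall>c'. step machine w ?c c' \<longrightarrow> V c'))"
      using ne by auto
  qed (use q final_conf states_conf in auto)
qed

lemma wins_det:
  assumes q: "valid_ctrl q" "player q = r" "r \<le> m" "\<nexists>r v. q = Halt r v"
    and A: "actions_of w l q f h R B i Q p = {a}" "synchronous l h a" "valid_ctrl (fst a)" "player (fst a) = r"
    and win: "wins w t r v (successor l f h R B i Q p a)"
  shows "wins w (Suc t) r v (conf l q f h R B i Q p)"
proof -
  have "wins w (Suc t) r (\<exists>a \<in> actions_of w l q f h R B i Q p. v) (conf l q f h R B i Q p)"
    by (rule wins_step[OF q]; unfold A(1)) (use A(2-4) win in simp_all)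
  then show ?thesis unfolding A(1) by simp
qed

text \<open>Handing over to the opponent negates the value and uses up one block.\<close>

lemma wins_switch:
  assumes q: "valid_ctrl q" "player q = r" "r < m" "\<nexists>r v. q = Halt r v"
    and A: "actions_of w l q f h R B i Q p = {a}" "synchronous l h a" "valid_ctrl (fst a)" "player (fst a) = Suc r"
    and win: "wins w t (Suc r) (\<not> v) (successor l f h R B i Q p a)"
  shows "wins w (Suc t) r v (conf l q f h R B i Q p)"
proof -
  let ?c = "conf l q f h R B i Q p" and ?s = "successor l f h R B i Q p"
  have st: "step machine w ?c c' \<longleftrightarrow> c' = ?s a" for c'
    by (subst step_conf) (use A(1,2) in auto)
  have s: "Suc m - r = Suc (m - r)" "Suc m - Suc r = m - r" using q(3) by auto
  have kind: "existential_config machine (?s a) \<noteq> existential_config machine ?c"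
    using A q by (cases a) (auto simp: successor_def existential_conf)
  have "(\<not> v) = odd (Suc r) \<longleftrightarrow> v = odd r" by auto
  then show ?thesis
    using win kind unfolding wins_def s
    by (intro evaluates_step[where V = "\<lambda>_. v = odd r"]) (use st q final_conf states_conf in \<open>auto split: if_splits\<close>)
qed

end

section \<open>The levels of the game\<close>

context parity_machine
begin

section \<open>One-step rules of the game\<close>

lemma conf_update_end: "conf l q (f(l := y)) h R B i Q p = conf l q f h R B i Q p"
  by (simp add: conf_def)

lemmas transition_simps = synchronous_def successor_def fun_upd_idem

lemma player_le: "valid_activity \<kappa> \<Longrightarrow> activity_player \<kappa> \<le> m"
  by (cases \<kappa>) auto

lemma wins_halt_pos: "r \<le> m \<Longrightarrow> 0 < t \<Longrightarrow> wins w t r v (conf l (Halt r v) f h R B i Q p)"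
  using wins_halt[of r w "t - 1"] by simp

lemma wins_Inc_carry:
  assumes "valid_activity \<kappa>" "R (int h) = segment \<kappa>" "h < l" "f h"
    and "wins w t (activity_player \<kappa>) v (conf l (Inc \<kappa>) (f(h := False)) (Suc h) R B i Q p)"
  shows "wins w (Suc t) (activity_player \<kappa>) v (conf l (Inc \<kappa>) f h R B i Q p)"
  by (rule wins_det[where a = "(Inc \<kappa>, (False, Go_Right), (R (int h), Go_Right), (B i, Stay), (Q p, Stay))"])
    (use assms player_le in \<open>auto simp: transition_simps\<close>)

lemma wins_Inc_stop:
  assumes "valid_activity \<kappa>" "R (int h) = segment \<kappa>" "h < l" "\<not> f h" "0 < h"
    and "wins w t (activity_player \<kappa>) v (conf l (Back \<kappa> False) (f(h := True)) (h - 1) R B i Q p)"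
  shows "wins w (Suc t) (activity_player \<kappa>) v (conf l (Inc \<kappa>) f h R B i Q p)"
  by (rule wins_det[where a = "(Back \<kappa> False, (True, Go_Left), (R (int h), Go_Left), (B i, Stay), (Q p, Stay))"])
    (use assms player_le in \<open>auto simp: transition_simps\<close>)

text \<open>The case \<open>h = l\<close> arises at level \<open>m\<close>, whose segment ends with
  the address tape; what is written there has no effect.\<close>

lemma wins_Inc_overflow:
  assumes "valid_activity \<kappa>" "R (int h) \<noteq> segment \<kappa>" "h \<le> l" "0 < h"
    and "wins w t (activity_player \<kappa>) v (conf l (Back \<kappa> True) f (h - 1) R B i Q p)"
  shows "wins w (Suc t) (activity_player \<kappa>) v (conf l (Inc \<kappa>) f h R B i Q p)"
  by (rule wins_det[where a = "(Back \<kappa> True, (h < l \<and> f h, Go_Left), (R (int h), Go_Left), (B i, Stay), (Q p, Stay))"])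
    (use assms player_le in \<open>cases "h = l"; auto simp: transition_simps conf_update_end\<close>)+

lemma wins_Back:
  assumes "valid_activity \<kappa>" "R (int h) = segment \<kappa>" "h < l" "0 < h"
    and "wins w t (activity_player \<kappa>) v (conf l (Back \<kappa> ov) f (h - 1) R B i Q p)"
  shows "wins w (Suc t) (activity_player \<kappa>) v (conf l (Back \<kappa> ov) f h R B i Q p)"
  by (rule wins_det[where a = "(Back \<kappa> ov, (f h, Go_Left), (R (int h), Go_Left), (B i, Stay), (Q p, Stay))"])
    (use assms player_le in \<open>auto simp: transition_simps\<close>)

lemma wins_resume:
  assumes "valid_activity \<kappa>" "R (int h) \<noteq> segment \<kappa>" "h < l" "resume \<kappa> ov = (q, d)"
    and "player q = activity_player \<kappa>"
    and "wins w t (activity_player \<kappa>) v (conf l q f (Suc h) R B i Q (move_work_head d p))"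
  shows "wins w (Suc t) (activity_player \<kappa>) v (conf l (Back \<kappa> ov) f h R B i Q p)"
  by (rule wins_det[where a = "(q, (f h, Go_Right), (R (int h), Go_Right), (B i, Stay), (Q p, d))"])
    (use assms player_le valid_resume[of \<kappa> ov] in \<open>auto simp: transition_simps\<close>)

lemma wins_resume_switch:
  assumes "r < m" "R (int h) \<noteq> r" "h < l"
    and "wins w t (Suc r) (\<not> v) (conf l (Choosing r) f (Suc h) R B i Q (p - 1))"
  shows "wins w (Suc t) r v (conf l (Back (Guess r False) True) f h R B i Q p)"
  by (rule wins_switch[where a = "(Choosing r, (f h, Go_Right), (R (int h), Go_Right), (B i, Stay), (Q p, Go_Left))"])
    (use assms in \<open>auto simp: transition_simps\<close>)

lemma wins_Guessing:
  assumes "r < m" "h < l"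
    and "\<And>g. wins w t r (W g) (conf l (Inc (Guess r (v \<noteq> g))) f h R B i (Q(p := of_bool g)) (p + 1))"
  shows "wins w (Suc t) r (W True \<or> W False) (conf l (Guessing r v) f h R B i Q p)"
proof -
  let ?c = "conf l (Guessing r v) f h R B i Q p"
  let ?A = "actions_of w l (Guessing r v) f h R B i Q p"
  have A: "?A = (\<lambda>g. (Inc (Guess r (v \<noteq> g)), (f h, Stay), (R (int h), Stay), (B i, Stay), (of_bool g, Go_Right))) ` UNIV"
    using assms(2) by auto
  \<comment> \<open>The guess is recovered from an action as the symbol that it writes on the
    table.\<close>
  have "wins w (Suc t) r (\<exists>a \<in> ?A. W (fst (snd (snd (snd (snd a)))) = 1)) ?c"
  proof (rule wins_step)
    show "inj_on (successor l f h R B i Q p) ?A"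
      unfolding A by (auto simp: inj_on_def successor_def conf_def)
  qed (use assms(1,2) assms(3)[of True] assms(3)[of False] in \<open>auto simp: transition_simps A\<close>)
  moreover have "(\<exists>a \<in> ?A. W (fst (snd (snd (snd (snd a)))) = 1)) = (W True \<or> W False)"
    unfolding A by (auto simp: UNIV_bool)
  ultimately show ?thesis by simp
qed

text \<open>\<open>Q p \<noteq> 1\<close> is the negated guess: who challenges a subblock takes over
  the claim that it has the opposite parity. The alternative is to move on to the next
  subblock.\<close>

lemma wins_Choosing:
  assumes "r < m" "h < l"
    and "wins w t (Suc r) v1 (conf l (Seek r (Q p \<noteq> 1)) f h R B i Q p)"
    and "wins w t (Suc r) v2 (conf l (Inc (Choose r)) f h R B i Q p)"
  shows "wins w (Suc t) (Suc r) (v1 \<or> v2) (conf l (Choosing r) f h R B i Q p)"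
proof -
  let ?c = "conf l (Choosing r) f h R B i Q p"
  let ?A = "actions_of w l (Choosing r) f h R B i Q p"
  let ?a = "\<lambda>q. (q, (f h, Stay), (R (int h), Stay), (B i, Stay), (Q p, Stay))"
  have A: "?A = {?a (Seek r (Q p \<noteq> 1)), ?a (Inc (Choose r))}"
    using assms(2) by auto
  have "wins w (Suc t) (Suc r) (\<exists>a \<in> ?A. if fst a = Inc (Choose r) then v2 else v1) ?c"
  proof (rule wins_step)
    show "inj_on (successor l f h R B i Q p) ?A"
      unfolding A by (auto simp: inj_on_def successor_def conf_def)
  qed (use assms in \<open>auto simp: transition_simps A\<close>)
  moreover have "(\<exists>a \<in> ?A. if fst a = Inc (Choose r) then v2 else v1) = (v1 \<or> v2)"
    unfolding A by auto
  ultimately show ?thesis by simp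
qed

definition start_of :: "nat \<Rightarrow> bool \<Rightarrow> ctrl" where
  "start_of r v = (if r = m then Evaluating v else Guessing r v)"

lemma wins_Seek_move:
  assumes "r < m" "R (int h) = r" "h < l"
    and "wins w t (Suc r) v (conf l (Seek r u) f (Suc h) R B i Q p)"
  shows "wins w (Suc t) (Suc r) v (conf l (Seek r u) f h R B i Q p)"
  by (rule wins_det[where a = "(Seek r u, (f h, Go_Right), (R (int h), Go_Right), (B i, Stay), (Q p, Stay))"])
    (use assms in \<open>auto simp: transition_simps\<close>)

lemma wins_Seek_stop:
  assumes "r < m" "R (int h) \<noteq> r" "h < l"
    and "wins w t (Suc r) v (conf l (start_of (Suc r) u) f h R B i Q p)"
  shows "wins w (Suc t) (Suc r) v (conf l (Seek r u) f h R B i Q p)"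
  by (rule wins_det[where a = "(start_of (Suc r) u, (f h, Stay), (R (int h), Stay), (B i, Stay), (Q p, Stay))"])
    (use assms in \<open>auto simp: transition_simps start_of_def\<close>)

lemma wins_Evaluating:
  assumes "h < l"
    and "wins w t m v (conf l (Inc (Evaluate (u \<noteq> (input_at w l f = Some True)))) f h R B i Q p)"
  shows "wins w (Suc t) m v (conf l (Evaluating u) f h R B i Q p)"
  by (rule wins_det[where a = "(Inc (Evaluate (u \<noteq> (input_at w l f = Some True))), (f h, Stay), (R (int h), Stay), (B i, Stay), (Q p, Stay))"])
    (use assms in \<open>auto simp: transition_simps\<close>)

end

section \<open>Counters on segments of the address tape\<close>

definition set_segment :: "nat \<Rightarrow> nat \<Rightarrow> nat \<Rightarrow> (nat \<Rightarrow> bool) \<Rightarrow> nat \<Rightarrow> bool" where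
  "set_segment a b j f = (\<lambda>i. if a \<le> i \<and> i < a + b then bit j (i - a) else f i)"

lemma set_segment_update_True:
  assumes "i < b" "\<not> bit j i"
  shows "(set_segment a b j f)(a + i := True) = set_segment a b (j + 2 ^ i) f"
proof -
  have e: "j + 2 ^ i = set_bit i j" using assms(2) by (simp add: set_bit_eq)
  show ?thesis unfolding e using assms(1)
    by (intro ext) (auto simp: set_segment_def bit_set_bit_iff possible_bit_def)
qed

lemma set_segment_update_False:
  assumes "i < b" "bit j i"
  shows "(set_segment a b j f)(a + i := False) = set_segment a b (j - 2 ^ i) f"
proof -
  have "set_bit i (unset_bit i j) = j"
    by (rule bit_eqI) (use assms(2) in \<open>auto simp: bit_set_bit_iff bit_unset_bit_iff\<close>)
  moreover have "set_bit i (unset_bit i j) = unset_bit i j + 2 ^ i"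
    by (simp add: set_bit_eq bit_unset_bit_iff)
  ultimately have e: "j - 2 ^ i = unset_bit i j" by simp
  show ?thesis unfolding e using assms(1)
    by (intro ext) (auto simp: set_segment_def bit_unset_bit_iff)
qed

text \<open>The segments fill the right end of the address tape in the order of the levels;
  \<open>m * b < l\<close> leaves a cell to their left, where \<open>Back\<close> turns round at
  level 1. Inside a segment the least significant bit is leftmost, so that carries move right. The
  address itself has its most significant bit first, but only the set of generated addresses
  matters.\<close>

locale layout = parity_machine +
  fixes w :: "bool list" and l b :: nat and R B :: "int \<Rightarrow> nat"
  assumes b: "0 < b" and mb: "m * b < l"
    and R: "\<And>r i. 1 \<le> r \<Longrightarrow> r \<le> m \<Longrightarrow>
      R (int i) = r \<longleftrightarrow> l - (Suc m - r) * b \<le> i \<and> i < l - (m - r) * b"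
begin

definition lo :: "nat \<Rightarrow> nat" where
  "lo r = l - (Suc m - r) * b"

lemma lo_Suc: "1 \<le> r \<Longrightarrow> r \<le> m \<Longrightarrow> lo (Suc r) = lo r + b"
proof -
  assume "1 \<le> r" "r \<le> m"
  then have "Suc m - r = Suc (m - r)" by simp
  then have "(Suc m - r) * b = b + (m - r) * b" by simp
  moreover have "(Suc m - r) * b \<le> m * b" using \<open>1 \<le> r\<close> by (intro mult_right_mono) auto
  ultimately show ?thesis using mb unfolding lo_def by (simp add: Suc_diff_le)
qed

lemma lo_pos: "1 \<le> r \<Longrightarrow> 0 < lo r"
proof -
  assume "1 \<le> r"
  then have "(Suc m - r) * b \<le> m * b" by (intro mult_right_mono) auto
  then have "(Suc m - r) * b < l" using mb by (rule le_less_trans)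
  then show ?thesis unfolding lo_def by simp
qed

lemma lo_le: "lo r \<le> l" by (simp add: lo_def)

lemma R_lo: "1 \<le> r \<Longrightarrow> r \<le> m \<Longrightarrow> R (int i) = r \<longleftrightarrow> lo r \<le> i \<and> i < lo (Suc r)"
  unfolding lo_def using R by simp

text \<open>When the carry reaches bit \<open>i\<close>, the lower bits have been cleared, which is
  \<open>2 ^ i dvd j\<close>, and \<open>2 ^ i\<close> is still to be added. Where the head turns
  round depends on the length of the carry, so the premise covers all positions
  \<open>h\<close>.\<close>

lemma wins_Inc_run:
  assumes k: "valid_activity \<kappa>" "segment \<kappa> = r" "1 \<le> r" "r \<le> m"
    and "i \<le> b" "j < 2 ^ b" "2 ^ i dvd j"
    and "\<And>h. lo r - 1 \<le> h \<Longrightarrow> h < lo (Suc r) \<Longrightarrow> wins w t (activity_player \<kappa>) v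
      (conf l (Back \<kappa> (2 ^ b \<le> j + 2 ^ i)) (set_segment (lo r) b ((j + 2 ^ i) mod 2 ^ b) f) h R B x Q p)"
  shows "wins w (t + (b - i) + 1) (activity_player \<kappa>) v
      (conf l (Inc \<kappa>) (set_segment (lo r) b j f) (lo r + i) R B x Q p)"
  using assms(5-)
proof (induction "b - i" arbitrary: i j)
  case 0
  then have i: "i = b" by simp
  then have j: "j = 0" using 0 by (meson dvd_imp_le gr0I not_le)
  have lS: "lo r + b \<le> l" using lo_Suc[OF k(3,4)] lo_le[of "Suc r"] by simp
  have "wins w (Suc t) (activity_player \<kappa>) v (conf l (Inc \<kappa>) (set_segment (lo r) b 0 f) (lo r + b) R B x Q p)"
  proof (rule wins_Inc_overflow[where R = R])
    show "R (int (lo r + b)) \<noteq> segment \<kappa>"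
      using R_lo[OF k(3,4), of "lo r + b"] lo_Suc[OF k(3,4)] k(2) by (simp del: of_nat_add)
    show "wins w t (activity_player \<kappa>) v (conf l (Back \<kappa> True) (set_segment (lo r) b 0 f) (lo r + b - 1) R B x Q p)"
      using 0(5)[of "lo r + b - 1"] b unfolding i j by (simp add: lo_Suc[OF k(3,4)])
  qed (use k lS b in auto)
  then show ?case unfolding i j by simp
next
  case (Suc d)
  then have i: "i < b" by simp
  then have h: "lo r + i < lo (Suc r)" by (simp add: lo_Suc[OF k(3,4)])
  then have hl: "lo r + i < l" using lo_le[of "Suc r"] by simp
  have Rh: "R (int (lo r + i)) = segment \<kappa>" using R_lo[OF k(3,4), of "lo r + i"] h k(2) by simp
  obtain q where q: "j = 2 ^ i * q" using Suc.prems(3) by auto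
  have bq: "bit j i = odd q" unfolding q by (simp add: bit_iff_odd)
  have at: "set_segment (lo r) b j f (lo r + i) = odd q" using i bq by (simp add: set_segment_def)
  show ?case
  proof (cases "odd q")
    case True
    then obtain q' where q': "q = Suc (2 * q')" by (metis oddE Suc_eq_plus1)
    have j': "j = 2 ^ Suc i * q' + 2 ^ i" unfolding q q' by (simp add: algebra_simps)
    have "wins w (t + (b - Suc i) + 1) (activity_player \<kappa>) v
      (conf l (Inc \<kappa>) (set_segment (lo r) b (j - 2 ^ i) f) (lo r + Suc i) R B x Q p)"
    proof (rule Suc.hyps(1))
      show "j - 2 ^ i < 2 ^ b" using Suc.prems(2) by simp
      show "2 ^ Suc i dvd j - 2 ^ i" unfolding j' by simp
      have e: "j - 2 ^ i + 2 ^ Suc i = j + 2 ^ i" unfolding j' by simp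
      fix h assume "lo r - 1 \<le> h" "h < lo (Suc r)"
      then show "wins w t (activity_player \<kappa>) v (conf l (Back \<kappa> (2 ^ b \<le> j - 2 ^ i + 2 ^ Suc i))
          (set_segment (lo r) b ((j - 2 ^ i + 2 ^ Suc i) mod 2 ^ b) f) h R B x Q p)"
        unfolding e by (rule Suc.prems(4))
    qed (use Suc i in auto)
    then have "wins w (Suc (t + (b - Suc i) + 1)) (activity_player \<kappa>) v
      (conf l (Inc \<kappa>) (set_segment (lo r) b j f) (lo r + i) R B x Q p)"
      using k(1) Rh hl at True bq i
      by (intro wins_Inc_carry[where R = R]) (auto simp: set_segment_update_False)
    then show ?thesis using i by (simp add: Suc_diff_Suc)
  next
    case False
    then obtain q' where q': "q = 2 * q'" by auto
    have j': "j = 2 ^ Suc i * q'" unfolding q q' by simp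
    \<comment> \<open>Both \<open>j\<close> and \<open>2 ^ b\<close> are multiples of
      \<open>2 ^ Suc i\<close>, so adding \<open>2 ^ i\<close> to \<open>j\<close> cannot reach
      \<open>2 ^ b\<close>.\<close>
    obtain e where e: "b = Suc i + e" using i less_iff_Suc_add by auto
    have "2 ^ Suc i * q' < 2 ^ Suc i * 2 ^ e" using Suc.prems(2) unfolding j' e power_add .
    then have "q' < 2 ^ e" by simp
    then have "2 ^ Suc i * Suc q' \<le> 2 ^ Suc i * 2 ^ e" by (intro mult_left_mono) auto
    moreover have "2 ^ Suc i * q' + 2 ^ i < 2 ^ Suc i * Suc q'" by simp
    ultimately have lt: "j + 2 ^ i < 2 ^ b" unfolding j' e power_add by linarith
    have "wins w (Suc t) (activity_player \<kappa>) v
      (conf l (Inc \<kappa>) (set_segment (lo r) b j f) (lo r + i) R B x Q p)"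
    proof (rule wins_Inc_stop[where R = R])
      show "wins w t (activity_player \<kappa>) v
        (conf l (Back \<kappa> False) ((set_segment (lo r) b j f)(lo r + i := True)) (lo r + i - 1) R B x Q p)"
        using Suc.prems(4)[of "lo r + i - 1"] lt h lo_pos[OF k(3)] bq False i
        by (simp add: set_segment_update_True)
    qed (use k Rh hl at False lo_pos[OF k(3)] in auto)
    then show ?thesis by (rule wins_mono) simp
  qed
qed

lemma wins_Back_run:
  assumes k: "valid_activity \<kappa>" "segment \<kappa> = r" "1 \<le> r" "r \<le> m"
    and "wins w t (activity_player \<kappa>) v (conf l (Back \<kappa> ov) f (lo r - 1) R B x Q p)"
  shows "n \<le> b \<Longrightarrow> wins w (t + n) (activity_player \<kappa>) v (conf l (Back \<kappa> ov) f (lo r - 1 + n) R B x Q p)"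
proof (induction n)
  case 0
  then show ?case using assms(5) by simp
next
  case (Suc n)
  have h: "lo r - 1 + Suc n = lo r + n" using lo_pos[OF k(3)] by simp
  have h': "lo r + n < lo (Suc r)" using Suc.prems lo_Suc[OF k(3,4)] by simp
  have "wins w (Suc (t + n)) (activity_player \<kappa>) v (conf l (Back \<kappa> ov) f (lo r + n) R B x Q p)"
  proof (rule wins_Back[where R = R])
    show "R (int (lo r + n)) = segment \<kappa>" using R_lo[OF k(3,4), of "lo r + n"] h' k(2) by simp
    show "wins w (t + n) (activity_player \<kappa>) v (conf l (Back \<kappa> ov) f (lo r + n - 1) R B x Q p)"
      using Suc h by simp
  qed (use k(1) h' lo_le[of "Suc r"] lo_pos[OF k(3)] in auto)
  then show ?case unfolding h by simp
qed

lemma wins_Inc: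
  assumes k: "valid_activity \<kappa>" "segment \<kappa> = r" "1 \<le> r" "r \<le> m" and j: "j < 2 ^ b"
    and win: "wins w t (activity_player \<kappa>) v (conf l (Back \<kappa> (Suc j = 2 ^ b))
      (set_segment (lo r) b (Suc j mod 2 ^ b) f) (lo r - 1) R B x Q p)"
  shows "wins w (t + (2 * b + 2)) (activity_player \<kappa>) v
    (conf l (Inc \<kappa>) (set_segment (lo r) b j f) (lo r) R B x Q p)"
proof -
  have "wins w (t + b + (b - 0) + 1) (activity_player \<kappa>) v
      (conf l (Inc \<kappa>) (set_segment (lo r) b j f) (lo r + 0) R B x Q p)"
  proof (rule wins_Inc_run[OF k _ j])
    fix h assume h: "lo r - 1 \<le> h" "h < lo (Suc r)"
    then have "h - (lo r - 1) \<le> b" using lo_Suc[OF k(3,4)] by simp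
    from wins_Back_run[OF k win this] h(1)
    have "wins w (t + (h - (lo r - 1))) (activity_player \<kappa>) v (conf l (Back \<kappa> (Suc j = 2 ^ b))
      (set_segment (lo r) b (Suc j mod 2 ^ b) f) h R B x Q p)" by simp
    then have "wins w (t + b) (activity_player \<kappa>) v (conf l (Back \<kappa> (Suc j = 2 ^ b))
      (set_segment (lo r) b (Suc j mod 2 ^ b) f) h R B x Q p)"
      by (rule wins_mono) (use \<open>h - (lo r - 1) \<le> b\<close> in simp)
    moreover have "(2 ^ b \<le> j + 2 ^ 0) = (Suc j = 2 ^ b)" using j by auto
    ultimately show "wins w (t + b) (activity_player \<kappa>) v (conf l (Back \<kappa> (2 ^ b \<le> j + 2 ^ 0))
      (set_segment (lo r) b ((j + 2 ^ 0) mod 2 ^ b) f) h R B x Q p)" by simp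
  qed simp_all
  then show ?thesis by (auto elim: wins_mono)
qed

section \<open>The value of a level\<close>

lemma R_before: "1 \<le> r \<Longrightarrow> r \<le> m \<Longrightarrow> R (int (lo r - 1)) \<noteq> r"
proof -
  assume r: "1 \<le> r" "r \<le> m"
  then have "\<not> lo r \<le> lo r - 1" using lo_pos[of r] by simp
  then show ?thesis using R_lo[OF r, of "lo r - 1"] by blast
qed

lemma lo_less: "1 \<le> r \<Longrightarrow> r \<le> m \<Longrightarrow> lo r < l"
  using lo_Suc[of r] lo_le[of "Suc r"] b by simp

text \<open>Here \<open>d\<close> is the number of levels that are still to be played.\<close>

fun ones :: "nat \<Rightarrow> (nat \<Rightarrow> bool) \<Rightarrow> nat" where
  "ones 0 f = of_bool (input_at w l f = Some True)"
| "ones (Suc d) f = (\<Sum>j < 2 ^ b. ones d (set_segment (lo (m - d)) b j f))"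

abbreviation parity :: "nat \<Rightarrow> (nat \<Rightarrow> bool) \<Rightarrow> bool" where
  "parity r f \<equiv> odd (ones (Suc m - r) f)"

lemma lo_pred: "1 \<le> r \<Longrightarrow> Suc (lo r - 1) = lo r" using lo_pos by simp

text \<open>A round takes at most 2 b + 4 steps: one to read the bit, 2 b + 2 for the increment with
  its way back, and one to resume. The other two loops have the same cost per round.\<close>

lemma wins_evaluating:
  "j < 2 ^ b \<Longrightarrow> wins w ((2 ^ b - j) * (2 * b + 4) + 1) m
     (u = odd (\<Sum>i \<in> {j..<2 ^ b}. ones 0 (set_segment (lo m) b i f)))
     (conf l (Evaluating u) (set_segment (lo m) b j f) (lo m) R B x Q p)"
proof (induction "2 ^ b - j" arbitrary: j u)
  case (Suc d)
  have m1: "1 \<le> m" using m by simp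
  let ?f = "\<lambda>j. set_segment (lo m) b j f"
  let ?S = "\<lambda>j. \<Sum>i \<in> {j..<2 ^ b}. ones 0 (?f i)"
  let ?T = "(2 ^ b - Suc j) * (2 * b + 4) + 1"
  define u' where "u' = (u \<noteq> (input_at w l (?f j) = Some True))"
  have S: "?S j = of_bool (input_at w l (?f j) = Some True) + ?S (Suc j)"
    using Suc.prems by (subst sum.atLeast_Suc_lessThan) auto
  have "wins w (Suc ?T) m (u = odd (?S j)) (conf l (Back (Evaluate u') (Suc j = 2 ^ b))
      (?f (Suc j mod 2 ^ b)) (lo m - 1) R B x Q p)"
  proof (cases "Suc j = 2 ^ b")
    case True
    have "?S (Suc j) = 0" using True by simp
    then have "(u = odd (?S j)) = (\<not> u')" unfolding S u'_def by auto
    then have "wins w ?T m (u = odd (?S j)) (conf l (Halt m (\<not> u')) (?f (Suc j mod 2 ^ b))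
        (Suc (lo m - 1)) R B x Q (move_work_head Stay p))"
      using wins_halt_pos[of m ?T w] by simp
    then show ?thesis using wins_resume[of "Evaluate u'" R "lo m - 1" l True "Halt m (\<not> u')" Stay w ?T]
        True R_before[OF m1 order_refl] lo_less[OF m1 order_refl] by simp
  next
    case False
    then have j: "Suc j < 2 ^ b" using Suc.prems by simp
    have "(u = odd (?S j)) = (u' = odd (?S (Suc j)))" unfolding S u'_def by auto
    then have "wins w ?T m (u = odd (?S j)) (conf l (Evaluating u') (?f (Suc j mod 2 ^ b))
        (Suc (lo m - 1)) R B x Q (move_work_head Stay p))"
      using Suc.hyps(1)[of "Suc j" u'] Suc.hyps(2) j lo_pred[OF m1] by simp
    then show ?thesis using wins_resume[of "Evaluate u'" R "lo m - 1" l False "Evaluating u'" Stay w ?T]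
        False R_before[OF m1 order_refl] lo_less[OF m1 order_refl] by simp
  qed
  then have "wins w (Suc ?T + (2 * b + 2)) (activity_player (Evaluate u')) (u = odd (?S j))
      (conf l (Inc (Evaluate u')) (?f j) (lo m) R B x Q p)"
    using m1 by (intro wins_Inc Suc.prems) simp_all
  then have "wins w (Suc ?T + (2 * b + 2)) m (u = odd (?S j))
      (conf l (Inc (Evaluate u')) (?f j) (lo m) R B x Q p)"
    unfolding activity_player.simps .
  then have "wins w (Suc (Suc ?T + (2 * b + 2))) m (u = odd (?S j)) (conf l (Evaluating u) (?f j) (lo m) R B x Q p)"
    unfolding u'_def by (intro wins_Evaluating lo_less[OF m1 order_refl])
  moreover have "Suc (Suc ?T + (2 * b + 2)) = (2 ^ b - j) * (2 * b + 4) + 1"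
    using Suc.prems by (simp add: Suc_diff_Suc[symmetric] del: Suc_diff_Suc)
  ultimately show ?case by simp
qed simp

lemma wins_Seek:
  assumes r: "1 \<le> r" "r < m" and win: "wins w t (Suc r) v (conf l (start_of (Suc r) u) f (lo (Suc r)) R B x Q p)"
  shows "n \<le> b \<Longrightarrow> wins w (t + n + 1) (Suc r) v (conf l (Seek r u) f (lo (Suc r) - n) R B x Q p)"
proof (induction n)
  case 0
  have "R (int (lo (Suc r))) \<noteq> r" using R_lo[of r "lo (Suc r)"] r by simp
  then show ?case using wins_Seek_stop[OF r(2) _ _ win] lo_less[of "Suc r"] r by simp
next
  case (Suc n)
  have h: "Suc (lo (Suc r) - Suc n) = lo (Suc r) - n" "lo r \<le> lo (Suc r) - Suc n" "lo (Suc r) - Suc n < lo (Suc r)"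
    using Suc.prems lo_Suc[of r] r b by auto
  have "R (int (lo (Suc r) - Suc n)) = r" using R_lo[OF r(1) less_imp_le[OF r(2)]] h by blast
  then have "wins w (Suc (t + n + 1)) (Suc r) v (conf l (Seek r u) f (lo (Suc r) - Suc n) R B x Q p)"
    using Suc h lo_le[of "Suc r"] by (intro wins_Seek_move r) auto
  then show ?case by simp
qed

text \<open>What a level needs in order to start its counter at 0: its own segment and all later
  ones are still clear.\<close>

definition blank_from :: "nat \<Rightarrow> (nat \<Rightarrow> bool) \<Rightarrow> bool" where
  "blank_from i f \<longleftrightarrow> (\<forall>j \<ge> i. \<not> f j)"

lemma blank_from_set_segment:
  "1 \<le> r \<Longrightarrow> r \<le> m \<Longrightarrow> blank_from (lo r) f \<Longrightarrow> blank_from (lo (Suc r)) (set_segment (lo r) b j f)"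
  using lo_Suc[of r] by (auto simp: blank_from_def set_segment_def)

lemma set_segment_blank: "blank_from (lo r) f \<Longrightarrow> set_segment (lo r) b 0 f = f"
  by (auto simp: blank_from_def set_segment_def)

lemma odd_sum_odd: "odd (\<Sum>i \<in> A. of_bool (odd (c i)) :: nat) \<longleftrightarrow> odd (\<Sum>i \<in> A. c i :: nat)"
proof (cases "finite A")
  case True
  then show ?thesis by (induction A rule: finite_induct) (auto simp del: sum_of_bool_eq)
qed simp

lemma parity_eq_sum:
  "1 \<le> r \<Longrightarrow> r \<le> m \<Longrightarrow>
    parity r f = odd (\<Sum>j < 2 ^ b. of_bool (parity (Suc r) (set_segment (lo r) b j f)) :: nat)"
  by (simp only: odd_sum_odd Suc_diff_le ones.simps diff_diff_cancel diff_Suc_Suc)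

text \<open>The player of level \<open>r + 1\<close> reads the table of guesses backwards while counting upwards, so that the
  table need not be rewound.\<close>

lemma wins_choosing:
  assumes r: "1 \<le> r" "r < m" and f: "blank_from (lo r) f"
    and next_level: "\<And>f p u. blank_from (lo (Suc r)) f \<Longrightarrow>
      wins w t (Suc r) (u = parity (Suc r) f) (conf l (start_of (Suc r) u) f (lo (Suc r)) R B x Q p)"
  shows "j < 2 ^ b \<Longrightarrow> wins w (t + b + 3 + (2 ^ b - j) * (2 * b + 4)) (Suc r)
     (\<exists>i \<in> {j..<2 ^ b}. (Q (p - (int i - int j)) \<noteq> 1) = parity (Suc r) (set_segment (lo r) b i f))
     (conf l (Choosing r) (set_segment (lo r) b j f) (lo r) R B x Q p)"
proof (induction "2 ^ b - j" arbitrary: j p)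
  case (Suc d)
  have rm: "r \<le> m" using r by simp
  let ?f = "\<lambda>j. set_segment (lo r) b j f"
  define V where "V = (\<lambda>j p. \<exists>i \<in> {j..<2 ^ b}. (Q (p - (int i - int j)) \<noteq> 1) = parity (Suc r) (?f i))"
  define T where "T = (\<lambda>j. t + b + 3 + (2 ^ b - j) * (2 * b + 4))"
  have T: "T j = T (Suc j) + (2 * b + 4)"
    unfolding T_def using Suc.prems by (simp add: Suc_diff_Suc[symmetric] del: Suc_diff_Suc)
  \<comment> \<open>Either the current subblock is challenged, or the search goes on with the next
    one and the preceding guess.\<close>
  have V: "V j p \<longleftrightarrow> (Q p \<noteq> 1) = parity (Suc r) (?f j) \<or> (Suc j < 2 ^ b \<and> V (Suc j) (p - 1))"
  proof -
    have ins: "{j..<2 ^ b} = insert j {Suc j..<2 ^ b}" using Suc.prems by auto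
    have "p - (int j - int j) = p" "\<And>i. p - (int i - int j) = p - 1 - (int i - int (Suc j))" by simp_all
    then have "V j p \<longleftrightarrow> (Q p \<noteq> 1) = parity (Suc r) (?f j) \<or> V (Suc j) (p - 1)"
      unfolding V_def ins bex_simps by (simp only:)
    moreover have "V (Suc j) (p - 1) \<Longrightarrow> Suc j < 2 ^ b" unfolding V_def by auto
    ultimately show ?thesis by blast
  qed
  let ?V = "Suc j < 2 ^ b \<and> V (Suc j) (p - 1)"
  have "wins w (Suc (T (Suc j))) (Suc r) ?V
      (conf l (Back (Choose r) (Suc j = 2 ^ b)) (?f (Suc j mod 2 ^ b)) (lo r - 1) R B x Q p)"
  proof (cases "Suc j = 2 ^ b")
    case True
    then have "wins w (T (Suc j)) (Suc r) ?V (conf l (Halt (Suc r) False) (?f (Suc j mod 2 ^ b))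
        (Suc (lo r - 1)) R B x Q (move_work_head Stay p))"
      using wins_halt_pos[of "Suc r" "T (Suc j)" w False] r by (simp add: T_def)
    then show ?thesis using wins_resume[of "Choose r" R "lo r - 1" l True "Halt (Suc r) False" Stay w "T (Suc j)"]
        True R_before[OF r(1) rm] lo_less[OF r(1) rm] r by simp
  next
    case False
    then have j: "Suc j < 2 ^ b" using Suc.prems by simp
    from Suc.hyps(1)[of "Suc j" "p - 1"] Suc.hyps(2) j
    have "wins w (T (Suc j)) (Suc r) (V (Suc j) (p - 1)) (conf l (Choosing r) (?f (Suc j)) (lo r) R B x Q (p - 1))"
      unfolding T_def V_def by simp
    then show ?thesis using wins_resume[of "Choose r" R "lo r - 1" l False "Choosing r" Go_Left w "T (Suc j)"]
        False R_before[OF r(1) rm] lo_less[OF r(1) rm] r j lo_pred[OF r(1)] by simp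
  qed
  then have "wins w (Suc (T (Suc j)) + (2 * b + 2)) (activity_player (Choose r)) ?V
      (conf l (Inc (Choose r)) (?f j) (lo r) R B x Q p)"
    using r by (intro wins_Inc Suc.prems) simp_all
  then have inc: "wins w (Suc (T (Suc j)) + (2 * b + 2)) (Suc r) ?V
      (conf l (Inc (Choose r)) (?f j) (lo r) R B x Q p)"
    unfolding activity_player.simps .
  have "lo (Suc r) - b = lo r" using lo_Suc[OF r(1) rm] by simp
  with wins_Seek[OF r next_level[OF blank_from_set_segment[OF r(1) rm f]] order_refl, of "Q p \<noteq> 1" j p]
  have "wins w (t + b + 1) (Suc r) ((Q p \<noteq> 1) = parity (Suc r) (?f j))
      (conf l (Seek r (Q p \<noteq> 1)) (?f j) (lo r) R B x Q p)" by simp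
  then have "wins w (Suc (T (Suc j)) + (2 * b + 2)) (Suc r) ((Q p \<noteq> 1) = parity (Suc r) (?f j))
      (conf l (Seek r (Q p \<noteq> 1)) (?f j) (lo r) R B x Q p)"
    by (rule wins_mono) (simp add: T_def)
  from wins_Choosing[OF r(2) lo_less[OF r(1) rm] this inc]
  have "wins w (Suc (Suc (T (Suc j)) + (2 * b + 2))) (Suc r) (V j p)
      (conf l (Choosing r) (?f j) (lo r) R B x Q p)"
    unfolding V .
  moreover have "Suc (Suc (T (Suc j)) + (2 * b + 2)) = T j" unfolding T by simp
  ultimately have "wins w (T j) (Suc r) (V j p) (conf l (Choosing r) (?f j) (lo r) R B x Q p)" by simp
  then show ?case unfolding T_def V_def .
qed simp

text \<open>The position is won iff all guesses so far are right and the parity still required is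
  that of the remaining true answers: a wrong guess would be challenged, and right ones are safe.
  The reversed index in \<open>a\<close> comes from the challenger, who meets the last guess at
  counter value 0; the parity of a sum does not depend on the order.\<close>

lemma wins_guessing:
  assumes r: "1 \<le> r" "r < m" and f: "blank_from (lo r) f"
    and next_level: "\<And>f Q p u. blank_from (lo (Suc r)) f \<Longrightarrow>
      wins w t (Suc r) (u = parity (Suc r) f) (conf l (start_of (Suc r) u) f (lo (Suc r)) R B x Q p)"
  defines "a \<equiv> \<lambda>i. parity (Suc r) (set_segment (lo r) b (2 ^ b - 1 - i) f)"
  shows "j < 2 ^ b \<Longrightarrow> wins w (t + b + 3 + 2 ^ b * (2 * b + 4) + (2 ^ b - j) * (2 * b + 4)) r
     ((\<forall>i < j. (Q (p - int j + int i) = 1) = a i) \<and> u = odd (\<Sum>i \<in> {j..<2 ^ b}. of_bool (a i) :: nat))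
     (conf l (Guessing r u) (set_segment (lo r) b j f) (lo r) R B x Q p)"
proof (induction "2 ^ b - j" arbitrary: j Q p u)
  case (Suc d)
  have rm: "r \<le> m" using r by simp
  let ?f = "\<lambda>j. set_segment (lo r) b j f"
  define U where "U = t + b + 3 + 2 ^ b * (2 * b + 4)"
  define T where "T = (\<lambda>j. U + (2 ^ b - j) * (2 * b + 4))"
  define X where "X = (\<lambda>j. odd (\<Sum>i \<in> {j..<2 ^ b}. of_bool (a i) :: nat))"
  define V where "V = (\<lambda>j Q p u. (\<forall>i < j. (Q (p - int j + int i) = (1 :: nat)) = a i) \<and> u = X j)"
  have T: "T j = T (Suc j) + (2 * b + 4)"
    unfolding T_def using Suc.prems by (simp add: Suc_diff_Suc[symmetric] del: Suc_diff_Suc)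
  have X: "X j = (a j \<noteq> X (Suc j))"
    unfolding X_def using Suc.prems by (subst sum.atLeast_Suc_lessThan) auto
  \<comment> \<open>A guess preserves a won position iff it is the true parity, and it never turns a
    lost position into a won one.\<close>
  have V: "V (Suc j) (Q(p := of_bool g)) (p + 1) (u \<noteq> g) \<longleftrightarrow> V j Q p u \<and> g = a j" for g
  proof -
    have "((Q(p := of_bool g)) (p + 1 - int (Suc j) + int i) = (1 :: nat)) = (if i = j then g else Q (p - int j + int i) = 1)"
      if "i < Suc j" for i using that by simp
    then have "(\<forall>i < Suc j. ((Q(p := of_bool g)) (p + 1 - int (Suc j) + int i) = (1 :: nat)) = a i) \<longleftrightarrow>
        g = a j \<and> (\<forall>i < j. (Q (p - int j + int i) = 1) = a i)"
      by (auto simp: less_Suc_eq)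
    then show ?thesis unfolding V_def X by auto
  qed
  have inc: "wins w (Suc (T (Suc j)) + (2 * b + 2)) r (V j Q p u \<and> g = a j)
      (conf l (Inc (Guess r (u \<noteq> g))) (?f j) (lo r) R B x (Q(p := of_bool g)) (p + 1))" for g
  proof -
    let ?Q = "Q(p := of_bool g)" and ?u = "u \<noteq> g"
    have "wins w (Suc (T (Suc j))) r (V j Q p u \<and> g = a j)
        (conf l (Back (Guess r ?u) (Suc j = 2 ^ b)) (?f (Suc j mod 2 ^ b)) (lo r - 1) R B x ?Q (p + 1))"
    proof (cases "Suc j = 2 ^ b")
      case True
      have X0: "X (Suc j) = False" unfolding X_def True by simp
      show ?thesis
      proof (cases ?u)
        case u: True
        then have "\<not> V (Suc j) ?Q (p + 1) ?u" unfolding V_def X0 by blast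
        then have lost: "(V j Q p u \<and> g = a j) = False" using V[of g] by blast
        have "wins w (T (Suc j)) r (V j Q p u \<and> g = a j) (conf l (Halt r False) (?f (Suc j mod 2 ^ b))
            (Suc (lo r - 1)) R B x ?Q (move_work_head Stay (p + 1)))"
          unfolding lost by (rule wins_halt_pos) (use r in \<open>simp_all add: T_def U_def\<close>)
        then show ?thesis using wins_resume[of "Guess r ?u" R "lo r - 1" l True "Halt r False" Stay w "T (Suc j)"]
            True u R_before[OF r(1) rm] lo_less[OF r(1) rm] r by simp
      next
        case u: False
        let ?W = "\<exists>i \<in> {0..<2 ^ b}. (?Q (p - (int i - int 0)) \<noteq> 1) = parity (Suc r) (?f i)"
        \<comment> \<open>The guesses have the required parity here, so the challenger wins iff one
          of them is wrong. Replacing the index i by 2^b - 1 - i undoes the backward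
          reading.\<close>
        have W: "?W = (\<not> (V j Q p u \<and> g = a j))"
        proof -
          have "?W \<longleftrightarrow> (\<exists>i < 2 ^ b. (?Q (p - int i) \<noteq> 1) = parity (Suc r) (?f i))"
            by (simp only: atLeast0LessThan Bex_def lessThan_iff of_nat_0 diff_zero)
          also have "\<dots> \<longleftrightarrow> (\<exists>i < 2 ^ b. (?Q (p - int (2 ^ b - 1 - i)) \<noteq> 1) = a i)" (is "?L \<longleftrightarrow> ?R")
          proof
            assume ?L
            then obtain i where i: "i < 2 ^ b" "(?Q (p - int i) \<noteq> 1) = parity (Suc r) (?f i)" by blast
            then have "2 ^ b - 1 - (2 ^ b - 1 - i) = i" by simp
            then have "a (2 ^ b - 1 - i) = parity (Suc r) (?f i)" unfolding a_def by metis
            moreover have "2 ^ b - 1 - i < 2 ^ b" by (simp add: less_imp_diff_less)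
            ultimately show ?R using i \<open>2 ^ b - 1 - (2 ^ b - 1 - i) = i\<close> by metis
          next
            assume ?R
            then obtain i where i: "i < 2 ^ b" "(?Q (p - int (2 ^ b - 1 - i)) \<noteq> 1) = a i" by blast
            have "2 ^ b - 1 - i < 2 ^ b" by (simp add: less_imp_diff_less)
            then show ?L using i(2) unfolding a_def by blast
          qed
          also have "\<dots> \<longleftrightarrow> (\<exists>i < Suc j. (?Q (p + 1 - int (Suc j) + int i) \<noteq> 1) = a i)"
          proof -
            have "p - int (2 ^ b - 1 - i) = p + 1 - int (Suc j) + int i" if "i < 2 ^ b" for i
              using that True[symmetric] by simp
            then show ?thesis unfolding True by metis
          qed
          finally have "?W \<longleftrightarrow> \<not> V (Suc j) ?Q (p + 1) ?u" using u unfolding V_def X0 by blast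
          then show ?thesis using V[of g] by blast
        qed
        have "wins w U (Suc r) ?W (conf l (Choosing r) (?f 0) (lo r) R B x ?Q p)"
          using wins_choosing[OF r f, where Q = ?Q and t = t and j = 0 and p = p and x = x] next_level unfolding U_def by simp
        then have "wins w U (Suc r) (\<not> (V j Q p u \<and> g = a j)) (conf l (Choosing r) (?f 0) (Suc (lo r - 1)) R B x ?Q (p + 1 - 1))"
          unfolding W lo_pred[OF r(1)] add_diff_cancel_right' .
        from wins_resume_switch[OF r(2) R_before[OF r(1) rm] _ this]
        show ?thesis using True u lo_less[OF r(1) rm] by (simp add: T_def)
      qed
    next
      case False
      then have j: "Suc j < 2 ^ b" using Suc.prems by simp
      from Suc.hyps(1)[of "Suc j" ?Q "p + 1" ?u] Suc.hyps(2) j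
      have "wins w (T (Suc j)) r (V (Suc j) ?Q (p + 1) ?u) (conf l (Guessing r ?u) (?f (Suc j)) (lo r) R B x ?Q (p + 1))"
        unfolding T_def U_def V_def X_def by simp
      then show ?thesis using wins_resume[of "Guess r ?u" R "lo r - 1" l False "Guessing r ?u" Stay w "T (Suc j)"]
          False R_before[OF r(1) rm] lo_less[OF r(1) rm] r j lo_pred[OF r(1)] unfolding V by simp
    qed
    then have "wins w (Suc (T (Suc j)) + (2 * b + 2)) (activity_player (Guess r ?u)) (V j Q p u \<and> g = a j)
        (conf l (Inc (Guess r ?u)) (?f j) (lo r) R B x ?Q (p + 1))"
      using r by (intro wins_Inc Suc.prems) simp_all
    then show ?thesis unfolding activity_player.simps .
  qed
  from wins_Guessing[of r "lo r" l w _ "\<lambda>g. V j Q p u \<and> g = a j", OF r(2) lo_less[OF r(1) rm] inc]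
  have "wins w (Suc (Suc (T (Suc j)) + (2 * b + 2))) r ((V j Q p u \<and> True = a j) \<or> (V j Q p u \<and> False = a j))
      (conf l (Guessing r u) (?f j) (lo r) R B x Q p)" .
  moreover have "(V j Q p u \<and> True = a j) \<or> (V j Q p u \<and> False = a j) \<longleftrightarrow> V j Q p u" by auto
  moreover have "Suc (Suc (T (Suc j)) + (2 * b + 2)) = T j" unfolding T by simp
  ultimately have "wins w (T j) r (V j Q p u) (conf l (Guessing r u) (?f j) (lo r) R B x Q p)" by simp
  then show ?case unfolding T_def U_def V_def X_def .
qed simp

text \<open>A level runs through its counter at most twice, for guessing and for choosing;
  \<open>b + 3\<close> covers the walk to the next segment.\<close>

lemma wins_level:
  "d < m \<Longrightarrow> r = m - d \<Longrightarrow> blank_from (lo r) f \<Longrightarrow>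
    wins w (Suc d * (2 * 2 ^ b * (2 * b + 4) + b + 3)) r (u = parity r f)
      (conf l (start_of r u) f (lo r) R B x Q p)"
proof (induction d arbitrary: r f u Q p)
  case 0
  then have e: "set_segment (lo m) b 0 f = f" using set_segment_blank by simp
  have "parity m f = odd (\<Sum>i \<in> {0..<2 ^ b}. ones 0 (set_segment (lo m) b i f))"
    by (simp add: Suc_diff_le atLeast0LessThan del: ones.simps(1))
  with wins_evaluating[of 0 u f x Q p] 0 e
  have "wins w (2 ^ b * (2 * b + 4) + 1) m (u = parity m f) (conf l (start_of m u) f (lo m) R B x Q p)"
    by (simp add: start_of_def del: ones.simps)
  then show ?case using 0 by (auto elim: wins_mono)
next
  case (Suc d)
  let ?T = "2 * 2 ^ b * (2 * b + 4) + b + 3"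
  have r: "1 \<le> r" "r < m" using Suc.prems by auto
  have e: "set_segment (lo r) b 0 f = f" using set_segment_blank Suc.prems by simp
  have next_level: "wins w (Suc d * ?T) (Suc r) (u = parity (Suc r) f)
      (conf l (start_of (Suc r) u) f (lo (Suc r)) R B x Q p)" if "blank_from (lo (Suc r)) f" for f Q p u
    by (rule Suc.IH) (use Suc.prems that in auto)
  have "odd (\<Sum>i \<in> {0..<2 ^ b}. of_bool (parity (Suc r) (set_segment (lo r) b (2 ^ b - 1 - i) f)) :: nat) = parity r f"
  proof -
    have "(\<Sum>i \<in> {0..<2 ^ b}. of_bool (parity (Suc r) (set_segment (lo r) b (2 ^ b - 1 - i) f)) :: nat) =
        (\<Sum>i < 2 ^ b. of_bool (parity (Suc r) (set_segment (lo r) b i f)))"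
      by (rule sum.reindex_bij_witness[of _ "\<lambda>i. 2 ^ b - 1 - i" "\<lambda>i. 2 ^ b - 1 - i"]) auto
    then show ?thesis using parity_eq_sum[of r f] r by simp
  qed
  with wins_guessing[OF r Suc.prems(3) next_level, of 0 Q p u] e
  have "wins w (Suc d * ?T + b + 3 + 2 ^ b * (2 * b + 4) + 2 ^ b * (2 * b + 4)) r (u = parity r f)
      (conf l (Guessing r u) f (lo r) R B x Q p)"
    by (simp del: ones.simps)
  then show ?case unfolding start_of_def using r by (auto elim: wins_mono)
qed

end

section \<open>The set-up of the counters\<close>

text \<open>The binary length, with \<open>digits 0 = 0\<close>, so that a blank counter tape
  represents 0.\<close>

definition digits :: "nat \<Rightarrow> nat" where
  "digits n = (LEAST d. n < 2 ^ d)"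

lemma less_digits: "n < 2 ^ digits n"
  unfolding digits_def by (rule LeastI) (rule less_exp)

lemma digits_eqI: "n < 2 ^ d \<Longrightarrow> d = 0 \<or> 2 ^ (d - 1) \<le> n \<Longrightarrow> digits n = d"
  unfolding digits_def
proof (rule Least_equality)
  fix e assume a: "d = 0 \<or> 2 ^ (d - 1) \<le> n" "n < 2 ^ e"
  show "d \<le> e"
  proof (rule ccontr)
    assume "\<not> d \<le> e"
    then have "(2 :: nat) ^ e \<le> 2 ^ (d - 1)" by (intro power_increasing) auto
    moreover have "2 ^ (d - 1) \<le> n" using a(1) \<open>\<not> d \<le> e\<close> by simp
    ultimately show False using a(2) by linarith
  qed
qed

lemma digits_le_power: "digits n = 0 \<or> 2 ^ (digits n - 1) \<le> n"
proof (cases "digits n")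
  case (Suc d)
  then have "\<not> n < 2 ^ d" unfolding digits_def by (intro not_less_Least) simp
  then show ?thesis using Suc by simp
qed simp

lemma digits_le: "digits n \<le> n"
proof (cases "digits n = 0")
  case False
  then have "2 ^ (digits n - 1) \<le> n" using digits_le_power[of n] by simp
  moreover have "digits n - 1 < 2 ^ (digits n - 1)" by (rule less_exp)
  ultimately show ?thesis by linarith
qed simp

lemma power_digits_le: "2 ^ digits n \<le> 2 * Suc n"
proof (cases "digits n = 0")
  case False
  then obtain d where "digits n = Suc d" by (cases "digits n") auto
  then show ?thesis using digits_le_power[of n] by simp
qed simp

lemma digits_0: "digits 0 = 0"
  by (rule digits_eqI) simp_all

lemma digits_Suc: "digits (Suc n) = (if Suc n = 2 ^ digits n then Suc (digits n) else digits n)"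
  using less_digits[of n] digits_le_power[of n] by (intro digits_eqI) (auto split: if_splits)

lemma digits_pos: "0 < n \<Longrightarrow> 0 < digits n"
  using less_digits[of n] by (cases "digits n") auto

lemma digits_power: "digits (2 ^ e) = Suc e"
  by (rule digits_eqI) simp_all

text \<open>The least significant bit is in cell 0, and the number grows to the left. The symbols 1
  and 2 stand for the bits, so that blanks delimit the number: its length serves as the unit for the
  segments.\<close>

definition binary_tape :: "nat \<Rightarrow> nat \<Rightarrow> int \<Rightarrow> nat" where
  "binary_tape n d = (\<lambda>x. if - int d < x \<and> x \<le> 0 then if bit n (nat (- x)) then 2 else 1 else 0)"

lemma binary_tape_nonblank: "binary_tape n d x \<noteq> 0 \<longleftrightarrow> - int d < x \<and> x \<le> 0"
  by (simp add: binary_tape_def)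

lemma binary_tape_clear:
  assumes "i < d" "bit n i"
  shows "(binary_tape n d)(- int i := 1) = binary_tape (n - 2 ^ i) d"
proof -
  have "set_bit i (unset_bit i n) = n"
    by (rule bit_eqI) (use assms(2) in \<open>auto simp: bit_set_bit_iff bit_unset_bit_iff\<close>)
  moreover have "set_bit i (unset_bit i n) = unset_bit i n + 2 ^ i"
    by (simp add: set_bit_eq bit_unset_bit_iff)
  ultimately have e: "n - 2 ^ i = unset_bit i n" by simp
  show ?thesis unfolding e using assms(1)
    by (intro ext) (auto simp: binary_tape_def bit_unset_bit_iff)
qed

lemma binary_tape_set:
  assumes "i \<le> d" "\<not> bit n i"
  shows "(binary_tape n d)(- int i := 2) = binary_tape (n + 2 ^ i) (if i = d then Suc d else d)"
proof -
  have e: "n + 2 ^ i = set_bit i n" using assms(2) by (simp add: set_bit_eq)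
  show ?thesis unfolding e using assms(1)
    by (intro ext) (auto simp: binary_tape_def bit_set_bit_iff possible_bit_def)
qed

lemma div_nat_eq_iff: "0 < (b :: nat) \<Longrightarrow> e div b = q \<longleftrightarrow> q * b \<le> e \<and> e < Suc q * b"
  by (metis div_nat_eqI div_times_less_eq_dividend dividend_less_div_times mult.commute mult_Suc)

section \<open>One-step rules of the set-up\<close>

context parity_machine
begin

lemma wins_Init:
  assumes "wins w t 1 v (conf l Count f 0 (R(0 := Suc m)) B i Q p)"
  shows "wins w (Suc t) 1 v (conf l Init f 0 R B i Q p)"
  by (rule wins_det[where a = "(Count, (0 < l \<and> f 0, Stay), (Suc m, Stay), (B i, Stay), (Q p, Stay))"])
    (use assms m conf_update_end[of 0] in \<open>cases "l = 0"; auto simp: transition_simps\<close>)+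

text \<open>For the empty address tape, where the mark of cell 0 lies at the end. Being stuck is a
  loss for player 1, since an existential configuration without successors rejects.\<close>

lemma wins_Count_stuck:
  assumes "R (int l) = Suc m"
  shows "wins w (Suc t) 1 False (conf l Count f l R B i Q p)"
proof -
  let ?A = "actions_of w l Count f l R B i Q p"
  have A: "?A = {}" using assms by simp
  have "wins w (Suc t) 1 (\<exists>a \<in> ?A. True) (conf l Count f l R B i Q p)"
    by (rule wins_step) (use m assms in auto)
  then show ?thesis unfolding A by simp
qed

lemma wins_Count_end:
  assumes "R (int l) \<noteq> Suc m" "0 < l"
    and "wins w t 1 v (conf l (Layout 0) f (l - 1) R B i Q p)"
  shows "wins w (Suc t) 1 v (conf l Count f l R B i Q p)"
  by (rule wins_det[where a = "(Layout 0, (False, Go_Left), (R (int l), Go_Left), (B i, Stay), (Q p, Stay))"])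
    (use assms m in \<open>auto simp: transition_simps conf_update_end\<close>)

lemma wins_Count:
  assumes "h < l" "wins w t 1 v (conf l Count_Carry f h R B i Q p)"
  shows "wins w (Suc t) 1 v (conf l Count f h R B i Q p)"
  by (rule wins_det[where a = "(Count_Carry, (f h, Stay), (R (int h), Stay), (B i, Stay), (Q p, Stay))"])
    (use assms m in \<open>auto simp: transition_simps\<close>)

lemma wins_Count_Carry:
  assumes "h < l" "B i = 2" "wins w t 1 v (conf l Count_Carry f h R (B(i := 1)) (i - 1) Q p)"
  shows "wins w (Suc t) 1 v (conf l Count_Carry f h R B i Q p)"
  by (rule wins_det[where a = "(Count_Carry, (f h, Stay), (R (int h), Stay), (1, Go_Left), (Q p, Stay))"])
    (use assms m in \<open>auto simp: transition_simps\<close>)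

lemma wins_Count_Carry_end:
  assumes "h < l" "B i \<noteq> 2" "wins w t 1 v (conf l Count_Return f h R (B(i := 2)) (i + 1) Q p)"
  shows "wins w (Suc t) 1 v (conf l Count_Carry f h R B i Q p)"
  by (rule wins_det[where a = "(Count_Return, (f h, Stay), (R (int h), Stay), (2, Go_Right), (Q p, Stay))"])
    (use assms m in \<open>auto simp: transition_simps\<close>)

lemma wins_Count_Return:
  assumes "h < l" "B i \<noteq> 0" "wins w t 1 v (conf l Count_Return f h R B (i + 1) Q p)"
  shows "wins w (Suc t) 1 v (conf l Count_Return f h R B i Q p)"
  by (rule wins_det[where a = "(Count_Return, (f h, Stay), (R (int h), Stay), (B i, Go_Right), (Q p, Stay))"])
    (use assms m in \<open>auto simp: transition_simps\<close>)

lemma wins_Count_Return_end: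
  assumes "h < l" "B i = 0" "wins w t 1 v (conf l Count f (Suc h) R B (i - 1) Q p)"
  shows "wins w (Suc t) 1 v (conf l Count_Return f h R B i Q p)"
  by (rule wins_det[where a = "(Count, (f h, Go_Right), (R (int h), Go_Right), (B i, Go_Left), (Q p, Stay))"])
    (use assms m in \<open>auto simp: transition_simps\<close>)

lemma wins_Layout_end:
  assumes "h < l" "wins w t 1 v (conf l (Guessing 1 True) f (Suc h) R B i Q p)"
  shows "wins w (Suc t) 1 v (conf l (Layout chunks) f h R B i Q p)"
  by (rule wins_det[where a = "(Guessing 1 True, (f h, Go_Right), (R (int h), Go_Right), (B i, Stay), (Q p, Stay))"])
    (use assms m in \<open>auto simp: transition_simps\<close>)

lemma wins_Layout_row_end:
  assumes "h < l" "c < chunks" "B i = 0" "wins w t 1 v (conf l (Layout_Return c) f h R B (i + 1) Q p)"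
  shows "wins w (Suc t) 1 v (conf l (Layout c) f h R B i Q p)"
  by (rule wins_det[where a = "(Layout_Return c, (f h, Stay), (R (int h), Stay), (B i, Go_Right), (Q p, Stay))"])
    (use assms m in \<open>auto simp: transition_simps\<close>)

lemma wins_Layout_stuck:
  assumes "c < chunks" "B i \<noteq> 0" "R (int h) = Suc m"
  shows "wins w (Suc t) 1 False (conf l (Layout c) f h R B i Q p)"
proof -
  let ?A = "actions_of w l (Layout c) f h R B i Q p"
  have A: "?A = {}" using assms by simp
  have "wins w (Suc t) 1 (\<exists>a \<in> ?A. True) (conf l (Layout c) f h R B i Q p)"
    by (rule wins_step) (use m assms in auto)
  then show ?thesis unfolding A by simp
qed

lemma wins_Layout:
  assumes "h < l" "0 < h" "c < chunks" "B i \<noteq> 0" "R (int h) \<noteq> Suc m"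
    and "wins w t 1 v (conf l (Layout c) f (h - 1) (R(int h := m - c div Suc k)) B (i - 1) Q p)"
  shows "wins w (Suc t) 1 v (conf l (Layout c) f h R B i Q p)"
  by (rule wins_det[where a = "(Layout c, (f h, Go_Left), (m - c div Suc k, Go_Left), (B i, Go_Left), (Q p, Stay))"])
    (use assms m in \<open>auto simp: transition_simps\<close>)

lemma wins_Layout_Return:
  assumes "h < l" "c < chunks" "B i \<noteq> 0" "wins w t 1 v (conf l (Layout_Return c) f h R B (i + 1) Q p)"
  shows "wins w (Suc t) 1 v (conf l (Layout_Return c) f h R B i Q p)"
  by (rule wins_det[where a = "(Layout_Return c, (f h, Stay), (R (int h), Stay), (B i, Go_Right), (Q p, Stay))"])
    (use assms m in \<open>auto simp: transition_simps\<close>)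

lemma wins_Layout_Return_end:
  assumes "h < l" "c < chunks" "B i = 0" "wins w t 1 v (conf l (Layout (Suc c)) f h R B (i - 1) Q p)"
  shows "wins w (Suc t) 1 v (conf l (Layout_Return c) f h R B i Q p)"
  by (rule wins_det[where a = "(Layout (Suc c), (f h, Stay), (R (int h), Stay), (B i, Go_Left), (Q p, Stay))"])
    (use assms m in \<open>auto simp: transition_simps\<close>)

section \<open>Measuring the address tape and labelling the segments\<close>

lemma wins_Count_Return_run:
  assumes "h < l" "wins w t 1 v (conf l Count f (Suc h) R (binary_tape n d) 0 Q p)"
  shows "j \<le> d \<Longrightarrow> wins w (t + j + 1) 1 v (conf l Count_Return f h R (binary_tape n d) (1 - int j) Q p)"
proof (induction j)
  case 0
  then show ?case using wins_Count_Return_end[of h l "binary_tape n d" 1 w t] assms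
    by (simp add: binary_tape_def)
next
  case (Suc j)
  have "wins w (Suc (t + j + 1)) 1 v (conf l Count_Return f h R (binary_tape n d) (1 - int (Suc j)) Q p)"
  proof (rule wins_Count_Return[OF assms(1)])
    show "binary_tape n d (1 - int (Suc j)) \<noteq> 0" using Suc.prems by (simp only: binary_tape_nonblank) linarith
  qed (use Suc in simp)
  then show ?case by simp
qed

text \<open>The invariant is that of \<open>wins_Inc_run\<close>, except that a carry beyond the
  last digit lengthens the number instead of overflowing.\<close>

lemma wins_Count_Carry_run:
  assumes h: "h < l"
  shows "i \<le> d \<Longrightarrow> n < 2 ^ d \<Longrightarrow> 2 ^ i dvd n \<Longrightarrow>
    wins w t 1 v (conf l Count f (Suc h) R (binary_tape (n + 2 ^ i) (if n + 2 ^ i = 2 ^ d then Suc d else d)) 0 Q p) \<Longrightarrow>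
    wins w (t + (d - i) + d + 3) 1 v (conf l Count_Carry f h R (binary_tape n d) (- int i) Q p)"
proof (induction "d - i" arbitrary: i n)
  case 0
  then have i: "i = d" by simp
  then have n: "n = 0" using 0 by (meson dvd_imp_le gr0I not_le)
  have "wins w (t + d + 1) 1 v (conf l Count_Return f h R (binary_tape (2 ^ d) (Suc d)) (1 - int d) Q p)"
    using 0(5) unfolding n i by (intro wins_Count_Return_run[OF h]) simp_all
  then have "wins w (Suc (t + d + 1)) 1 v (conf l Count_Carry f h R (binary_tape 0 d) (- int d) Q p)"
    using binary_tape_set[of d d 0]
    by (intro wins_Count_Carry_end[OF h]) (simp_all add: binary_tape_def add.commute)
  then show ?case unfolding i n by (auto elim: wins_mono)
next
  case (Suc e)
  then have i: "i < d" by simp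
  obtain q where q: "n = 2 ^ i * q" using Suc.prems(3) by auto
  have bq: "bit n i = odd q" unfolding q by (simp add: bit_iff_odd)
  have tape: "binary_tape n d (- int i) = (if odd q then 2 else 1)"
    using i by (simp add: binary_tape_def bq)
  show ?case
  proof (cases "odd q")
    case True
    then obtain q' where q': "q = Suc (2 * q')" by (metis oddE Suc_eq_plus1)
    have n: "n = 2 ^ Suc i * q' + 2 ^ i" unfolding q q' by (simp add: algebra_simps)
    have e: "n - 2 ^ i + 2 ^ Suc i = n + 2 ^ i" unfolding n by simp
    have "wins w (t + (d - Suc i) + d + 3) 1 v (conf l Count_Carry f h R (binary_tape (n - 2 ^ i) d) (- int (Suc i)) Q p)"
    proof (rule Suc.hyps(1))
      show "2 ^ Suc i dvd n - 2 ^ i" unfolding n by simp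
      show "wins w t 1 v (conf l Count f (Suc h) R (binary_tape (n - 2 ^ i + 2 ^ Suc i)
          (if n - 2 ^ i + 2 ^ Suc i = 2 ^ d then Suc d else d)) 0 Q p)"
        unfolding e by (rule Suc.prems(4))
    qed (use Suc i in auto)
    moreover have "- int (Suc i) = - int i - 1" by simp
    ultimately have "wins w (t + (d - Suc i) + d + 3) 1 v (conf l Count_Carry f h R (binary_tape (n - 2 ^ i) d) (- int i - 1) Q p)"
      by metis
    then have "wins w (Suc (t + (d - Suc i) + d + 3)) 1 v (conf l Count_Carry f h R (binary_tape n d) (- int i) Q p)"
      using binary_tape_clear[OF i] True bq tape
      by (intro wins_Count_Carry[OF h]) simp_all
    moreover have "Suc (t + (d - Suc i) + d + 3) = t + (d - i) + d + 3" using i by simp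
    ultimately show ?thesis by metis
  next
    case False
    \<comment> \<open>Dividing by \<open>2 ^ i\<close> would equate an odd with an even
      number.\<close>
    have "n + 2 ^ i \<noteq> 2 ^ d"
    proof
      assume a: "n + 2 ^ i = 2 ^ d"
      obtain q' where q': "q = 2 * q'" using False by auto
      obtain e where "d = Suc i + e" using i less_iff_Suc_add by auto
      then have "2 ^ i * (2 * q' + 1) = 2 ^ i * (2 * 2 ^ e)" using a unfolding q q' by (simp add: power_add algebra_simps)
      then have "2 * q' + 1 = 2 * (2 :: nat) ^ e" by (metis mult_cancel1 power_not_zero zero_neq_numeral)
      then show False by presburger
    qed
    then have "wins w (t + i + 1) 1 v (conf l Count_Return f h R (binary_tape (n + 2 ^ i) d) (1 - int i) Q p)"
      using Suc.prems(4) i by (intro wins_Count_Return_run[OF h]) simp_all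
    then have "wins w (Suc (t + i + 1)) 1 v (conf l Count_Carry f h R (binary_tape n d) (- int i) Q p)"
      using binary_tape_set[of i d n] False bq tape i
      by (intro wins_Count_Carry_end[OF h]) (simp_all add: add.commute)
    then show ?thesis using i by (auto elim!: wins_mono)
  qed
qed

lemma wins_Count_run:
  assumes "wins w t 1 v (conf l Count f l R (binary_tape l (digits l)) 0 Q p)"
  shows "h \<le> l \<Longrightarrow> wins w (t + (l - h) * (2 * l + 4)) 1 v (conf l Count f h R (binary_tape h (digits h)) 0 Q p)"
proof (induction "l - h" arbitrary: h)
  case 0
  then show ?case using assms by simp
next
  case (Suc d)
  then have h: "h < l" by simp
  let ?t = "t + (l - Suc h) * (2 * l + 4)"
  have "wins w ?t 1 v (conf l Count f (Suc h) R (binary_tape (Suc h) (digits (Suc h))) 0 Q p)"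
    using Suc h by simp
  then have "wins w (?t + (digits h - 0) + digits h + 3) 1 v (conf l Count_Carry f h R (binary_tape h (digits h)) (- int 0) Q p)"
    by (intro wins_Count_Carry_run[OF h]) (simp_all add: less_digits digits_Suc split: if_splits)
  then have "wins w (Suc (?t + digits h + digits h + 3)) 1 v (conf l Count f h R (binary_tape h (digits h)) 0 Q p)"
    by (intro wins_Count[OF h]) simp
  \<comment> \<open>The crude bound \<open>digits h \<le> h\<close> is affordable: measuring stays
    quadratic in \<open>l\<close>, and k + 2 is at least 2.\<close>
  moreover have "Suc (?t + digits h + digits h + 3) \<le> t + (l - h) * (2 * l + 4)"
  proof -
    have "l - h = Suc (l - Suc h)" using h by simp
    then show ?thesis using digits_le[of h] h by simp
  qed
  ultimately show ?case by (rule wins_mono)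
qed

text \<open>The ruler after the last \<open>n\<close> cells have been labelled.
  \<open>nat (int l - 1 - i)\<close> is the distance from the right end, and its quotient by
  \<open>digits l\<close> is the number of the chunk. The mark \<open>Suc m\<close> in cell 0 stops
  the labelling when the tape is too short.\<close>

definition ruler :: "nat \<Rightarrow> nat \<Rightarrow> int \<Rightarrow> nat" where
  "ruler l n = (\<lambda>i. if i = 0 then Suc m
     else if int l - int n \<le> i \<and> i < int l then m - (nat (int l - 1 - i) div digits l) div Suc k else 0)"

lemma ruler_0: "ruler l 0 = (\<lambda>_. 0)(0 := Suc m)"
  by (auto simp: ruler_def)

lemma ruler_no_mark: "0 < h \<Longrightarrow> ruler l n (int h) \<noteq> Suc m"
  by (auto simp: ruler_def)

lemma ruler_Suc:
  assumes "Suc n < l"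
  shows "(ruler l n)(int (l - 1 - n) := m - (n div digits l) div Suc k) = ruler l (Suc n)"
  using assms by (intro ext) (auto simp: ruler_def)

lemma wins_Layout_Return_run:
  assumes "h < l" "c < chunks" "wins w t 1 v (conf l (Layout (Suc c)) f h R (binary_tape n d) 0 Q p)"
  shows "j \<le> d \<Longrightarrow> wins w (t + j + 1) 1 v (conf l (Layout_Return c) f h R (binary_tape n d) (1 - int j) Q p)"
proof (induction j)
  case 0
  then show ?case using wins_Layout_Return_end[of h l c "binary_tape n d" 1 w t] assms
    by (simp add: binary_tape_def)
next
  case (Suc j)
  have "wins w (Suc (t + j + 1)) 1 v (conf l (Layout_Return c) f h R (binary_tape n d) (1 - int (Suc j)) Q p)"
  proof (rule wins_Layout_Return[OF assms(1,2)])
    show "binary_tape n d (1 - int (Suc j)) \<noteq> 0" using Suc.prems by (simp only: binary_tape_nonblank) linarith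
  qed (use Suc in simp)
  then show ?case by simp
qed

text \<open>If the address tape is too short for the segments of all levels, the ruler head meets the mark
  \<open>m + 1\<close> at its left end, and the computation is stuck.\<close>

lemma wins_Layout_row:
  assumes l: "0 < l" and c: "c < chunks"
    and final: "Suc c * digits l < l \<Longrightarrow> wins w t 1 v (conf l (Layout (Suc c)) f (l - 1 - Suc c * digits l)
      (ruler l (Suc c * digits l)) (binary_tape l (digits l)) 0 Q p)"
    and v: "v \<Longrightarrow> Suc c * digits l < l"
  shows "u \<le> digits l \<Longrightarrow> c * digits l + u < l \<Longrightarrow>
    wins w (t + (digits l - u) + digits l + 2) 1 v (conf l (Layout c) f (l - 1 - (c * digits l + u))
      (ruler l (c * digits l + u)) (binary_tape l (digits l)) (- int u) Q p)"
proof (induction "digits l - u" arbitrary: u)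
  case 0
  let ?d = "digits l"
  have u: "u = ?d" using 0 by simp
  have n: "c * ?d + u = Suc c * ?d" unfolding u by simp
  have h: "l - 1 - Suc c * ?d < l" using l by simp
  have "wins w (t + ?d + 1) 1 v (conf l (Layout_Return c) f (l - 1 - Suc c * ?d)
      (ruler l (Suc c * ?d)) (binary_tape l ?d) (1 - int ?d) Q p)"
    using final 0(3) unfolding n by (intro wins_Layout_Return_run[OF h c]) simp_all
  then have "wins w (Suc (t + ?d + 1)) 1 v (conf l (Layout c) f (l - 1 - Suc c * ?d)
      (ruler l (Suc c * ?d)) (binary_tape l ?d) (- int ?d) Q p)"
    by (intro wins_Layout_row_end[OF h c]) (simp_all add: binary_tape_def add.commute)
  then show ?case unfolding n unfolding u by simp
next
  case (Suc d)
  let ?d = "digits l" and ?n = "c * digits l + u"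
  have u: "u < ?d" using Suc by simp
  have B: "binary_tape l ?d (- int u) \<noteq> 0" using u by (simp only: binary_tape_nonblank) linarith
  show ?case
  proof (cases "Suc ?n < l")
    case False
    then have "l - 1 - ?n = 0" by simp
    moreover have "\<not> v" using v False u by auto
    moreover have "wins w (Suc (t + (?d - u) + ?d + 1)) 1 False (conf l (Layout c) f 0
      (ruler l ?n) (binary_tape l ?d) (- int u) Q p)"
      by (rule wins_Layout_stuck[OF c]) (rule B, simp add: ruler_def)
    ultimately show ?thesis by simp
  next
    case True
    have "?n div ?d = c" using u by simp
    then have R: "(ruler l ?n)(int (l - 1 - ?n) := m - c div Suc k) = ruler l (Suc ?n)"
      using ruler_Suc[OF True] by simp
    have "wins w (t + (?d - Suc u) + ?d + 2) 1 v (conf l (Layout c) f (l - 1 - (c * ?d + Suc u))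
      (ruler l (c * ?d + Suc u)) (binary_tape l ?d) (- int (Suc u)) Q p)"
      using Suc True u by (intro Suc.hyps(1)) simp_all
    moreover have "- int (Suc u) = - int u - 1" "l - 1 - (c * ?d + Suc u) = l - 1 - ?n - 1" "c * ?d + Suc u = Suc ?n"
      by simp_all
    ultimately have "wins w (t + (?d - Suc u) + ?d + 2) 1 v (conf l (Layout c) f (l - 1 - ?n - 1)
      ((ruler l ?n)(int (l - 1 - ?n) := m - c div Suc k)) (binary_tape l ?d) (- int u - 1) Q p)"
      unfolding R by metis
    then have "wins w (Suc (t + (?d - Suc u) + ?d + 2)) 1 v (conf l (Layout c) f (l - 1 - ?n)
      (ruler l ?n) (binary_tape l ?d) (- int u) Q p)"
      using True B by (intro wins_Layout[OF _ _ c] ruler_no_mark) simp_all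
    moreover have "Suc (t + (?d - Suc u) + ?d + 2) = t + (?d - u) + ?d + 2" using u by simp
    ultimately show ?thesis by metis
  qed
qed

lemma wins_Layout_run:
  assumes l: "0 < l"
    and final: "chunks * digits l < l \<Longrightarrow> wins w t 1 v (conf l (Layout chunks) f (l - 1 - chunks * digits l)
      (ruler l (chunks * digits l)) (binary_tape l (digits l)) 0 Q p)"
    and v: "v \<Longrightarrow> chunks * digits l < l"
  shows "c \<le> chunks \<Longrightarrow> c * digits l < l \<Longrightarrow>
    wins w (t + (chunks - c) * (2 * digits l + 2)) 1 v (conf l (Layout c) f (l - 1 - c * digits l)
      (ruler l (c * digits l)) (binary_tape l (digits l)) 0 Q p)"
proof (induction "chunks - c" arbitrary: c)
  case 0
  then have "c = chunks" by simp
  then show ?case using final 0 by simp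
next
  case (Suc e)
  let ?d = "digits l"
  have c: "c < chunks" using Suc by simp
  let ?t = "t + (chunks - Suc c) * (2 * ?d + 2)"
  have v': "Suc c * ?d < l" if v
  proof -
    have "Suc c * ?d \<le> chunks * ?d" using c by (intro mult_right_mono) auto
    then show ?thesis using v[OF that] by linarith
  qed
  have "wins w (?t + (?d - 0) + ?d + 2) 1 v (conf l (Layout c) f (l - 1 - (c * ?d + 0))
      (ruler l (c * ?d + 0)) (binary_tape l ?d) (- int 0) Q p)"
  proof (rule wins_Layout_row[OF l c _ v'])
    assume "Suc c * ?d < l"
    then show "wins w ?t 1 v (conf l (Layout (Suc c)) f (l - 1 - Suc c * ?d)
        (ruler l (Suc c * ?d)) (binary_tape l ?d) 0 Q p)"
      using Suc.hyps(2) c by (intro Suc.hyps(1)) linarith+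
  qed (use Suc.prems(2) in simp_all)
  moreover have "?t + (?d - 0) + ?d + 2 = t + (chunks - c) * (2 * ?d + 2)"
  proof -
    obtain N where N: "chunks - Suc c = N" "chunks - c = Suc N" using c by (metis Suc_diff_Suc)
    show ?thesis unfolding N by simp
  qed
  ultimately show ?case by (simp only: add_0_right of_nat_0 minus_zero)
qed

lemma ruler_layout:
  assumes "chunks * digits l < l"
  shows "layout m l (Suc k * digits l) (ruler l (chunks * digits l))"
proof -
  let ?d = "digits l" and ?b = "Suc k * digits l"
  have mb: "chunks * ?d = m * ?b" by (simp only: mult.assoc)
  define N where "N = m * ?b"
  have N: "N < l" using assms unfolding mb N_def .
  have d: "0 < ?d" using N digits_pos by simp
  then have b: "0 < ?b" by simp
  show ?thesis
  proof
    show "0 < ?b" by (rule b)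
    show "m * ?b < l" using assms unfolding mb .
    fix r i assume r: "1 \<le> r" "r \<le> m"
    show "ruler l (chunks * ?d) (int i) = r \<longleftrightarrow> l - (Suc m - r) * ?b \<le> i \<and> i < l - (m - r) * ?b"
    proof (cases "i = 0 \<or> \<not> l - N \<le> i \<or> l \<le> i")
      case True
      have "ruler l (chunks * ?d) (int i) \<noteq> r"
        using True r N unfolding mb N_def[symmetric] ruler_def by auto
      moreover have "(Suc m - r) * ?b \<le> m * ?b" using r by (intro mult_right_mono) auto
      then have "\<not> (l - (Suc m - r) * ?b \<le> i \<and> i < l - (m - r) * ?b)"
        using True N unfolding N_def[symmetric] by linarith
      ultimately show ?thesis by blast
    next
      case False
      define e where "e = l - 1 - i"
      have i: "0 < i" "i < l" "e < N" "i = l - 1 - e" "e < l" using False N unfolding e_def by linarith+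
      have e: "nat (int l - 1 - int i) = e" unfolding e_def using i(2) by linarith
      \<comment> \<open>Dividing the distance \<open>e\<close> by the chunk length and then by k + 1
        is dividing it by the segment length.\<close>
      have "ruler l (chunks * ?d) (int i) = m - e div ?b"
      proof -
        have "ruler l N (int i) = m - (nat (int l - 1 - int i) div ?d) div Suc k"
          using False i(1,2) N unfolding ruler_def by auto
        then show ?thesis unfolding mb N_def[symmetric] e div_mult2_eq[symmetric] by (simp only: mult.commute)
      qed
      moreover have "e div ?b < m" using i(3) unfolding N_def by (rule less_mult_imp_div_less)
      moreover have "m - q = r \<longleftrightarrow> q = m - r" if "q < m" for q using that r by linarith
      ultimately have ruler: "ruler l (chunks * ?d) (int i) = r \<longleftrightarrow> e div ?b = m - r" by metis
      have "e div ?b = m - r \<longleftrightarrow> (m - r) * ?b \<le> e \<and> e < Suc (m - r) * ?b"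
        unfolding div_nat_eq_iff[OF b] ..
      moreover have "Suc (m - r) = Suc m - r" using r by simp
      moreover have "(m - r) * ?b \<le> e \<longleftrightarrow> i < l - (m - r) * ?b" "e < (Suc m - r) * ?b \<longleftrightarrow> l - (Suc m - r) * ?b \<le> i"
        using i(2) unfolding e_def by linarith+
      ultimately show ?thesis unfolding ruler by metis
    qed
  qed
qed

end

section \<open>The hierarchy\<close>

text \<open>The input positions whose parity is computed. The cells from \<open>a\<close> on hold
  the least significant bits, so these are the numbers below 2^(l-a); the description by subsets
  fits the recursion over segments.\<close>

definition positions :: "nat \<Rightarrow> nat \<Rightarrow> nat set" where
  "positions a l = (\<lambda>X. address_value (map (\<lambda>i. i \<in> X) [0..<l])) ` Pow {a..<l}"

lemma bit_address_value:
  "bit (address_value bs) i \<longleftrightarrow> i < length bs \<and> bs ! (length bs - Suc i)"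
  by (auto simp: address_value_def bit_horner_sum_bit_iff rev_nth)

lemma inj_on_address:
  "inj_on (\<lambda>X. address_value (map (\<lambda>i. i \<in> X) [0..<l])) (Pow {a..<l})"
proof (rule inj_onI)
  fix X Y assume X: "X \<in> Pow {a..<l}" and Y: "Y \<in> Pow {a..<l}"
    and e: "address_value (map (\<lambda>i. i \<in> X) [0..<l]) = address_value (map (\<lambda>i. i \<in> Y) [0..<l])"
  have "i \<in> X \<longleftrightarrow> i \<in> Y" if i: "i < l" for i
  proof -
    have "bit (address_value (map (\<lambda>i. i \<in> Z) [0..<l])) (l - Suc i) \<longleftrightarrow> i \<in> Z" for Z
      unfolding bit_address_value using i by auto
    then show ?thesis using e by metis
  qed
  then show "X = Y" using X Y by fastforce
qed

lemma card_positions: "card (positions a l) = 2 ^ (l - a)"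
  unfolding positions_def by (simp add: card_image[OF inj_on_address] card_Pow)

lemma address_value_less: "address_value bs < 2 ^ length bs"
  using horner_sum_of_bool_2_less[of "rev bs"] by (simp add: address_value_def)

lemma positions_subset: "positions a l \<subseteq> {..<2 ^ l}"
  unfolding positions_def using address_value_less[of "map _ [0..<l]"] by (auto simp: image_subset_iff)

context layout
begin

text \<open>The address contents that the last \<open>d\<close> levels can produce from
  \<open>f\<close>. Fixing the values from \<open>l\<close> on keeps the set finite.\<close>

definition extensions :: "nat \<Rightarrow> (nat \<Rightarrow> bool) \<Rightarrow> (nat \<Rightarrow> bool) set" where
  "extensions d f = {g. \<forall>i. i < lo (Suc m - d) \<or> l \<le> i \<longrightarrow> g i = f i}"

lemma finite_extensions: "finite (extensions d f)"
proof -
  have "extensions d f \<subseteq> (\<lambda>X i. if i < l then i \<in> X else f i) ` Pow {..<l}"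
  proof
    fix g assume "g \<in> extensions d f"
    then have "g = (\<lambda>X i. if i < l then i \<in> X else f i) {i. i < l \<and> g i}"
      by (auto simp: extensions_def)
    then show "g \<in> (\<lambda>X i. if i < l then i \<in> X else f i) ` Pow {..<l}" by blast
  qed
  then show ?thesis by (rule finite_subset) simp
qed

lemma extensions_Suc:
  assumes "d < m"
  shows "extensions (Suc d) f = (\<Union>j \<in> {..<2 ^ b}. extensions d (set_segment (lo (m - d)) b j f))"
    and "j < 2 ^ b \<Longrightarrow> j' < 2 ^ b \<Longrightarrow> j \<noteq> j' \<Longrightarrow>
      extensions d (set_segment (lo (m - d)) b j f) \<inter> extensions d (set_segment (lo (m - d)) b j' f) = {}"
proof -
  let ?lo = "lo (m - d)"
  have S: "Suc m - d = Suc (m - d)" using assms by simp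
  have lo: "lo (Suc (m - d)) = ?lo + b" using assms by (intro lo_Suc) auto
  have le: "?lo + b \<le> l" using lo_le[of "Suc (m - d)"] lo by simp
  show "extensions (Suc d) f = (\<Union>j \<in> {..<2 ^ b}. extensions d (set_segment ?lo b j f))"
  proof (intro equalityI subsetI)
    fix g assume g: "g \<in> extensions (Suc d) f"
    let ?bs = "map (\<lambda>i. g (?lo + i)) [0..<b]"
    let ?j = "horner_sum of_bool 2 ?bs :: nat"
    have "?j < 2 ^ b" using horner_sum_of_bool_2_less[of ?bs] by simp
    moreover have "g \<in> extensions d (set_segment ?lo b ?j f)"
      using g by (auto simp: extensions_def S lo set_segment_def bit_horner_sum_bit_iff)
    ultimately show "g \<in> (\<Union>j \<in> {..<2 ^ b}. extensions d (set_segment ?lo b j f))" by blast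
  next
    fix g assume "g \<in> (\<Union>j \<in> {..<2 ^ b}. extensions d (set_segment ?lo b j f))"
    then show "g \<in> extensions (Suc d) f"
      using le by (auto simp: extensions_def S lo set_segment_def)
  qed
  assume j: "j < 2 ^ b" "j' < 2 ^ b" "j \<noteq> j'"
  have "take_bit b j = j" "take_bit b j' = j'" using j by (simp_all add: take_bit_nat_eq_self)
  then obtain i where i: "i < b" "bit j i \<noteq> bit j' i"
    using j(3) by (metis bit_eqI bit_take_bit_iff)
  show "extensions d (set_segment ?lo b j f) \<inter> extensions d (set_segment ?lo b j' f) = {}"
  proof (rule ccontr)
    assume "\<not> ?thesis"
    then obtain g where "g \<in> extensions d (set_segment ?lo b j f)" "g \<in> extensions d (set_segment ?lo b j' f)"
      by blast
    then have "set_segment ?lo b j f (?lo + i) = set_segment ?lo b j' f (?lo + i)"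
      using i(1) unfolding extensions_def S lo by fastforce
    then show False using i by (simp add: set_segment_def)
  qed
qed

lemma ones_eq:
  "d \<le> m \<Longrightarrow> ones d f = (\<Sum>g \<in> extensions d f. of_bool (input_at w l g = Some True))"
proof (induction d arbitrary: f)
  case 0
  have "i < l \<or> l \<le> i" for i by linarith
  then have "extensions 0 f = {f}" by (auto simp: extensions_def lo_def)
  then show ?case by simp
next
  case (Suc d)
  then have d: "d < m" by simp
  have "(\<Sum>g \<in> extensions (Suc d) f. of_bool (input_at w l g = Some True) :: nat) =
      (\<Sum>j < 2 ^ b. \<Sum>g \<in> extensions d (set_segment (lo (m - d)) b j f). of_bool (input_at w l g = Some True))"
    unfolding extensions_Suc(1)[OF d]
    by (rule sum.UNION_disjoint) (use finite_extensions extensions_Suc(2)[OF d] in auto)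
  then show ?case using Suc d by (simp only: ones.simps less_imp_le)
qed

text \<open>Because of the length of \<open>w\<close>, every address on \<open>l\<close> cells names
  a bit of the input, never the endmark. The nested sum over the levels is then one sum over all
  subsets of the segments.\<close>

lemma parity_eq:
  assumes "length w = 2 ^ l"
  shows "ones m (\<lambda>_. False) = card {u \<in> positions (l - m * b) l. w ! u}"
proof -
  let ?G = "extensions m (\<lambda>_. False)" and ?X = "Pow {l - m * b..<l}"
  let ?v = "\<lambda>X. address_value (map (\<lambda>i. i \<in> X) [0..<l])"
  have bij: "bij_betw (\<lambda>X i. i \<in> X) ?X ?G"
  proof (rule bij_betw_byWitness[where f' = Collect])
    have "Collect g \<subseteq> {l - m * b..<l}" if g: "g \<in> ?G" for g
    proof
      fix i assume "i \<in> Collect g"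
      then have "\<not> (i < l - m * b \<or> l \<le> i)" using g unfolding extensions_def lo_def by auto
      then show "i \<in> {l - m * b..<l}" by auto
    qed
    then show "Collect ` ?G \<subseteq> ?X" by blast
    show "(\<lambda>X i. i \<in> X) ` ?X \<subseteq> ?G" by (auto simp: extensions_def lo_def)
  qed simp_all
  have lt: "?v X < 2 ^ l" for X using address_value_less[of "map (\<lambda>i. i \<in> X) [0..<l]"] by simp
  have "ones m (\<lambda>_. False) = (\<Sum>g \<in> ?G. of_bool (input_at w l g = Some True))"
    by (rule ones_eq) simp
  also have "\<dots> = (\<Sum>X \<in> ?X. of_bool (input_at w l (\<lambda>i. i \<in> X) = Some True))"
    by (rule sum.reindex_bij_betw[OF bij, symmetric])
  also have "\<dots> = (\<Sum>X \<in> ?X. of_bool (w ! ?v X))"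
    by (rule sum.cong) (use lt assms in \<open>auto simp: input_at_def read_input_def\<close>)
  also have "\<dots> = (\<Sum>u \<in> positions (l - m * b) l. of_bool (w ! u))"
    unfolding positions_def by (subst sum.reindex[OF inj_on_address]) (simp add: o_def)
  also have "\<dots> = card {u \<in> positions (l - m * b) l. w ! u}"
    by (simp add: positions_def Int_def)
  finally show ?thesis .
qed

end

section \<open>The running time\<close>

context parity_machine
begin

text \<open>The game, the labelling of the chunks and the measuring, in this order; the single steps
  are the end of \<open>Layout\<close>, the end of \<open>Count\<close>, and
  \<open>Init\<close>.\<close>

definition running_time :: "nat \<Rightarrow> nat" where
  "running_time l = (let d = digits l; b = Suc k * d in
     m * (2 * 2 ^ b * (2 * b + 4) + b + 3) + 1 + chunks * (2 * d + 2) + 1 + l * (2 * l + 4) + 1)"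

lemma evaluates_init:
  fixes w :: "bool list"
  defines "l \<equiv> address_length (length w)"
  shows "\<exists>v. evaluates machine w (running_time l) m v (init_config machine w) \<and>
    (chunks * digits l < l \<longrightarrow> length w = 2 ^ l \<longrightarrow>
      v = odd (card {u \<in> positions (l - chunks * digits l) l. w ! u}))"
proof -
  let ?d = "digits l" and ?b = "Suc k * digits l" and ?f = "\<lambda>_. False"
  let ?R = "ruler l (chunks * digits l)" and ?B = "binary_tape l (digits l)"
  define t where "t = m * (2 * 2 ^ ?b * (2 * ?b + 4) + ?b + 3)"
  \<comment> \<open>If the segments do not fit, the machine gets stuck at player 1 and rejects. If
    they fit, this is the value of the game for every length of \<open>w\<close>; at length 2^l it
    is the intended parity.\<close>
  define v where "v \<longleftrightarrow> chunks * ?d < l \<and> odd (layout.ones m w l ?b m ?f)"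
  have chunks_eq: "chunks * ?d = m * ?b" by (simp only: mult.assoc)
  have final: "wins w (Suc t) 1 v (conf l (Layout chunks) ?f (l - 1 - chunks * ?d) ?R ?B 0 (\<lambda>_. 0) 0)"
    if small: "chunks * ?d < l"
  proof -
    interpret layout m k w l ?b ?R ?B by (rule ruler_layout[OF small])
    have "Suc (m - 1) = m" "1 = m - (m - 1)" using m by simp_all
    with wins_level[of "m - 1" 1 ?f True 0 "\<lambda>_. 0" 0] m
    have "wins w t 1 (True = parity 1 ?f) (conf l (start_of 1 True) ?f (lo 1) ?R ?B 0 (\<lambda>_. 0) 0)"
      unfolding t_def blank_from_def by simp
    moreover have "(True = parity 1 ?f) = v" using small unfolding v_def by simp
    moreover have "start_of 1 True = Guessing 1 True" using m by (simp add: start_of_def)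
    moreover have "lo 1 = l - chunks * ?d" unfolding lo_def chunks_eq diff_Suc_1 by (simp only: One_nat_def diff_Suc_Suc diff_zero)
    then have "lo 1 = Suc (l - 1 - chunks * ?d)" using small by linarith
    ultimately have "wins w t 1 v (conf l (Guessing 1 True) ?f (Suc (l - 1 - chunks * ?d)) ?R ?B 0 (\<lambda>_. 0) 0)"
      by metis
    then show ?thesis by (rule wins_Layout_end[rotated]) (use small in linarith)
  qed
  have init: "init_config machine w = conf l Init ?f 0 (\<lambda>_. 0) (\<lambda>_. 0) 0 (\<lambda>_. 0) 0"
    unfolding init_config_def conf_def l_def[symmetric]
    by (simp add: machine_def map_replicate_const numeral_3_eq_3)
  have count: "wins w (Suc (Suc t + chunks * (2 * ?d + 2))) 1 v
      (conf l Count ?f l (ruler l 0) ?B 0 (\<lambda>_. 0) 0)"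
  proof (cases "l = 0")
    case True
    then have "v = False" unfolding v_def by simp
    then show ?thesis using True by (simp only:) (rule wins_Count_stuck, simp add: ruler_def)
  next
    case False
    then have l: "0 < l" by simp
    have "wins w (Suc t + (chunks - 0) * (2 * ?d + 2)) 1 v (conf l (Layout 0) ?f (l - 1 - 0 * ?d)
      (ruler l (0 * ?d)) ?B 0 (\<lambda>_. 0) 0)"
      by (rule wins_Layout_run[OF l final]) (use l in \<open>simp_all add: v_def\<close>)
    then have "wins w (Suc t + chunks * (2 * ?d + 2)) 1 v (conf l (Layout 0) ?f (l - 1) (ruler l 0) ?B 0 (\<lambda>_. 0) 0)"
      by (simp only: mult_0 diff_zero)
    then show ?thesis by (rule wins_Count_end[rotated 2]) (use ruler_no_mark l in blast)+
  qed
  have "wins w (Suc (Suc t + chunks * (2 * ?d + 2)) + (l - 0) * (2 * l + 4)) 1 v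
      (conf l Count ?f 0 (ruler l 0) (binary_tape 0 (digits 0)) 0 (\<lambda>_. 0) 0)"
    by (rule wins_Count_run[OF count]) simp
  moreover have "binary_tape 0 (digits 0) = (\<lambda>_. 0)" by (auto simp: binary_tape_def digits_0)
  ultimately have "wins w (Suc (Suc t + chunks * (2 * ?d + 2)) + l * (2 * l + 4)) 1 v
      (conf l Count ?f 0 ((\<lambda>_. 0)(0 := Suc m)) (\<lambda>_. 0) 0 (\<lambda>_. 0) 0)"
    unfolding ruler_0 by simp
  then have "wins w (Suc (Suc (Suc t + chunks * (2 * ?d + 2)) + l * (2 * l + 4))) 1 v (init_config machine w)"
    unfolding init by (rule wins_Init)
  moreover have "Suc (Suc (Suc t + chunks * (2 * ?d + 2)) + l * (2 * l + 4)) = running_time l"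
    unfolding running_time_def Let_def t_def by simp
  ultimately have "wins w (running_time l) 1 v (init_config machine w)" by simp
  then have "evaluates machine w (running_time l) m v (init_config machine w)"
    unfolding wins_def by simp
  moreover have "v = odd (card {u \<in> positions (l - chunks * ?d) l. w ! u})"
    if small: "chunks * ?d < l" and len: "length w = 2 ^ l"
  proof -
    interpret layout m k w l ?b ?R ?B by (rule ruler_layout[OF small])
    show ?thesis using small unfolding v_def chunks_eq parity_eq[OF len] by blast
  qed
  ultimately show ?thesis by blast
qed

text \<open>As \<open>2 ^ digits l\<close> is at most 2 (l + 1), a loop has O((l + 1)^(k+1)) rounds.
  A round costs 2 b + 4 steps, for which the crude bound O(l + 1) suffices.\<close>

lemma running_time_le: "\<exists>C. \<forall>l. running_time l \<le> C * Suc l ^ (k + 2)"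
proof -
  define D where "D = m * (2 * 2 ^ Suc k * (2 * Suc k + 4) + Suc k + 3) + chunks * 4 + 9"
  have "running_time l \<le> D * Suc l ^ (k + 2)" for l
  proof -
    let ?y = "Suc l" and ?d = "digits l"
    let ?b = "Suc k * ?d" and ?Y = "Suc l ^ (k + 2)"
    have d: "?d \<le> ?y" using digits_le[of l] by simp
    have y1: "1 \<le> ?y ^ e" for e by simp
    have yY: "?y * ?y \<le> ?Y" using power_increasing[of 2 "k + 2" "Suc l"] by (simp add: power2_eq_square)
    have y: "?y \<le> ?Y" using yY by (metis le_square le_trans)
    have b: "?b \<le> Suc k * ?y" using d by (rule mult_le_mono2)
    have "2 ^ ?b = ((2 :: nat) ^ ?d) ^ Suc k" by (simp only: power_mult mult.commute[of "Suc k"])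
    also have "\<dots> \<le> (2 * ?y) ^ Suc k" by (rule power_mono[OF power_digits_le]) simp
    also have "\<dots> = 2 ^ Suc k * ?y ^ Suc k" by (rule power_mult_distrib)
    finally have pb: "2 ^ ?b \<le> 2 ^ Suc k * ?y ^ Suc k" .
    have "2 * ?b + 4 \<le> (2 * Suc k + 4) * ?y" using b by (simp add: algebra_simps)
    with pb have "2 ^ ?b * (2 * ?b + 4) \<le> (2 ^ Suc k * ?y ^ Suc k) * ((2 * Suc k + 4) * ?y)"
      by (rule mult_le_mono)
    also have "\<dots> = 2 ^ Suc k * (2 * Suc k + 4) * (?y ^ Suc k * ?y)" by (simp only: mult_ac)
    also have "?y ^ Suc k * ?y = ?Y" by simp
    finally have 1: "2 * 2 ^ ?b * (2 * ?b + 4) \<le> 2 * 2 ^ Suc k * (2 * Suc k + 4) * ?Y" by simp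
    have 2: "?b \<le> Suc k * ?Y" using b y by (meson le_trans mult_le_mono2)
    have 3: "3 \<le> 3 * ?Y" "1 \<le> ?Y" using y1[of "k + 2"] by simp_all
    have "2 * 2 ^ ?b * (2 * ?b + 4) + ?b + 3 \<le> (2 * 2 ^ Suc k * (2 * Suc k + 4) + Suc k + 3) * ?Y"
      using add_mono[OF add_mono[OF 1 2] 3(1)] by (simp only: distrib_right)
    then have a: "m * (2 * 2 ^ ?b * (2 * ?b + 4) + ?b + 3) \<le> m * (2 * 2 ^ Suc k * (2 * Suc k + 4) + Suc k + 3) * ?Y"
      unfolding mult.assoc[of m] by (rule mult_le_mono2)
    have "2 * ?d + 2 \<le> 4 * ?Y" using d y 3(2) by linarith
    then have c: "chunks * (2 * ?d + 2) \<le> chunks * 4 * ?Y"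
      unfolding mult.assoc[of chunks] by (rule mult_le_mono2)
    have "l * (2 * l + 4) \<le> ?y * (6 * ?y)" by (rule mult_le_mono) simp_all
    also have "\<dots> = 6 * (?y * ?y)" by (simp only: mult_ac)
    also have "\<dots> \<le> 6 * ?Y" using yY by (rule mult_le_mono2)
    finally have e: "l * (2 * l + 4) \<le> 6 * ?Y" .
    have "running_time l \<le> m * (2 * 2 ^ Suc k * (2 * Suc k + 4) + Suc k + 3) * ?Y + ?Y + chunks * 4 * ?Y + ?Y + 6 * ?Y + ?Y"
      unfolding running_time_def Let_def using a c e 3(2) by (intro add_mono)
    also have "\<dots> = D * ?Y" unfolding D_def by (simp add: distrib_right)
    finally show ?thesis .
  qed
  then show ?thesis by blast
qed

end

section \<open>Asymptotics and the separation\<close>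

lemma ATIME_I:
  assumes "wf_ratm M" "start M \<in> existential M" "(\<lambda>n. real (T n)) \<in> O(f)"
    and "\<And>w. \<exists>v. evaluates M w (T (length w)) m v (init_config M w)"
  shows "accepted_language M \<in> ATIME f m"
proof -
  have "length cs - 1 \<le> T (length w) \<and> blocks M cs \<le> m" if c: "computation M w cs" for w cs
  proof -
    obtain v where "evaluates M w (T (length w)) m v (init_config M w)" using assms(4) by blast
    then show ?thesis using evaluates_bounded c unfolding bounded_def computation_def by blast
  qed
  then show ?thesis unfolding ATIME_def using assms(1-3) by blast
qed

lemma ATIME_mono:
  assumes "f \<in> O(g)"
  shows "ATIME f m \<subseteq> ATIME g m"
  unfolding ATIME_def using landau_o.big_trans[OF _ assms] by blast

lemma log_power_bigo:
  assumes "j \<le> k"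
  shows "(\<lambda>n. log 2 (real n) ^ j) \<in> O(\<lambda>n. log 2 (real n) ^ k)"
proof (rule bigoI[where c = 1])
  show "\<forall>\<^sub>F n in sequentially. norm (log 2 (real n) ^ j) \<le> 1 * norm (log 2 (real n) ^ k)"
    using eventually_ge_at_top[of 2]
  proof eventually_elim
    case (elim n)
    then have "1 \<le> log 2 (real n)" by (simp add: le_log_iff)
    then show ?case using power_increasing[OF assms] by simp
  qed
qed

lemma address_length_power: "address_length (2 ^ l) = l"
  by (simp add: address_length_def log_nat_power)

text \<open>The 3: rounding up and the successor add at most 2 to a logarithm that is at least
  1.\<close>

lemma address_length_bigo: "(\<lambda>n. real (C * Suc (address_length n) ^ j)) \<in> O(\<lambda>n. log 2 (real n) ^ j)"
proof (rule bigoI[where c = "real C * 3 ^ j"])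
  show "\<forall>\<^sub>F n in sequentially. norm (real (C * Suc (address_length n) ^ j)) \<le> real C * 3 ^ j * norm (log 2 (real n) ^ j)"
    using eventually_ge_at_top[of 2]
  proof eventually_elim
    case (elim n)
    then have l: "1 \<le> log 2 (real n)" by (simp add: le_log_iff)
    then have "real (Suc (address_length n)) \<le> 3 * log 2 (real n)"
      unfolding address_length_def by linarith
    then have "real (Suc (address_length n)) ^ j \<le> (3 * log 2 (real n)) ^ j"
      by (intro power_mono) auto
    then have "real C * real (Suc (address_length n)) ^ j \<le> real C * (3 ^ j * log 2 (real n) ^ j)"
      by (intro mult_left_mono) (simp_all add: power_mult_distrib)
    then show ?case using l by (simp add: mult_ac)
  qed
qed

text \<open>Used with \<open>K = chunks\<close> and l = 2^e: as
  \<open>digits (2 ^ e) = Suc e\<close>, all segments together are shorter than the address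
  tape.\<close>

lemma double_power_greater:
  fixes K N :: nat
  shows "\<exists>e. K * Suc e < (2 :: nat) ^ e \<and> N \<le> 2 ^ e"
proof -
  \<comment> \<open>For e = 2 t, the left side is at most t (t + 1), which is below (2^t)^2.\<close>
  define t where "t = 2 * K + N"
  have "K * Suc (2 * t) \<le> Suc t * t" unfolding t_def by (simp add: algebra_simps)
  also have "\<dots> < Suc t * Suc t" by simp
  also have "\<dots> \<le> 2 ^ t * 2 ^ t" using less_exp[of t] by (intro mult_mono) (simp_all add: Suc_le_eq)
  also have "\<dots> = 2 ^ (2 * t)" by (simp add: mult_2 power_add)
  finally have "K * Suc (2 * t) < 2 ^ (2 * t)" .
  moreover have "N \<le> 2 ^ (2 * t)" 
  proof -
    have "N \<le> 2 * t" unfolding t_def by simp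
    also have "\<dots> \<le> 2 ^ (2 * t)" by (rule less_imp_le[OF less_exp])
    finally show ?thesis .
  qed
  ultimately show ?thesis by blast
qed

theorem theorem5:
  fixes m k :: nat
  assumes "m > 2" and "k > 1"
  shows "ATIME (\<lambda>n. (log 2 (real n)) ^ k) m \<subset> ATIME (\<lambda>n. (log 2 (real n)) ^ (k + 2)) m"
proof -
  interpret parity_machine m k by unfold_locales (use assms in simp)
  let ?L = "accepted_language machine"
  obtain C where C: "running_time l \<le> C * Suc l ^ (k + 2)" for l using running_time_le by blast
  have "?L \<in> ATIME (\<lambda>n. (log 2 (real n)) ^ (k + 2)) m"
  proof (rule ATIME_I[OF wf_machine _ address_length_bigo[of C]])
    show "start machine \<in> existential machine" by (auto simp: machine_def)
    fix w
    show "\<exists>v. evaluates machine w (C * Suc (address_length (length w)) ^ (k + 2)) m v (init_config machine w)"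
      using evaluates_init[of w] evaluates_mono[OF _ C] by blast
  qed
  moreover have "?L \<notin> ATIME (\<lambda>n. (log 2 (real n)) ^ k) m"
  proof
    assume "?L \<in> ATIME (\<lambda>n. (log 2 (real n)) ^ k) m"
    then obtain M T where M: "wf_ratm M" "accepted_language M = ?L"
      and T: "(\<lambda>n. real (T n)) \<in> O(\<lambda>n. (log 2 (real n)) ^ k)"
      and bd: "\<And>w cs. computation M w cs \<Longrightarrow> length cs - 1 \<le> T (length w) \<and> blocks M cs \<le> m"
      unfolding ATIME_def by blast
    obtain A where A: "\<And>n V. V \<subseteq> {..<n} \<Longrightarrow> (A * Suc (T n)) ^ m \<le> card V \<Longrightarrow>
        \<not> (\<forall>w. length w = n \<longrightarrow> (w \<in> accepted_language M \<longleftrightarrow> odd (card {v \<in> V. w ! v})))"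
      using parity_lower_bound[where T = T and m = m, OF M(1) bd] by blast
    obtain c where "c > 0" "\<forall>\<^sub>F n in sequentially. norm (real (T n)) \<le> c * norm (log 2 (real n) ^ k)"
      using landau_o.bigE[OF T] by blast
    then obtain n0 where c: "\<And>n. n \<ge> n0 \<Longrightarrow> real (T n) \<le> c * norm (log 2 (real n) ^ k)"
      unfolding eventually_sequentially by auto
    obtain c' where c': "c \<le> real c'" using real_arch_simple by blast
    obtain e where e: "chunks * Suc e < 2 ^ e" "n0 + A * Suc c' \<le> 2 ^ e"
      using double_power_greater by blast
    define l where "l = (2 :: nat) ^ e"
    let ?b = "Suc k * digits l"
    have l: "chunks * digits l < l" "n0 + A * Suc c' \<le> l" "0 < l" using e by (simp_all add: l_def digits_power)
    let ?V = "positions (l - chunks * digits l) l"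
    have "n0 \<le> 2 ^ l" using l(2) less_exp[of l] by linarith
    then have "real (T (2 ^ l)) \<le> c * norm (log 2 (real (2 ^ l)) ^ k)" by (rule c)
    also have "\<dots> = c * real l ^ k" by (simp add: log_nat_power)
    also have "\<dots> \<le> real c' * real l ^ k" using c' by (rule mult_right_mono) simp
    finally have "real (T (2 ^ l)) \<le> real (c' * l ^ k)" by simp
    then have "T (2 ^ l) \<le> c' * l ^ k" by (simp only: of_nat_le_iff)
    moreover have "1 \<le> l ^ k" using l(3) by simp
    ultimately have "Suc (T (2 ^ l)) \<le> Suc c' * l ^ k" by simp
    then have "A * Suc (T (2 ^ l)) \<le> A * Suc c' * l ^ k" by (simp only: mult.assoc mult_le_mono2)
    \<comment> \<open>One power of \<open>l\<close> absorbs the constants of the lower bound and of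
      the assumed time bound.\<close>
    also have "\<dots> \<le> l * l ^ k" using l(2) by (intro mult_right_mono) simp_all
    also have "\<dots> = l ^ Suc k" by simp
    also have "\<dots> \<le> (2 ^ digits l) ^ Suc k" by (rule power_mono[OF less_imp_le[OF less_digits]]) simp
    also have "\<dots> = 2 ^ ?b" by (simp only: power_mult mult.commute[of "Suc k"])
    finally have "(A * Suc (T (2 ^ l))) ^ m \<le> (2 ^ ?b) ^ m" by (rule power_mono) simp
    also have "\<dots> = 2 ^ (chunks * digits l)" by (simp only: power_mult mult.commute[of m] mult.assoc)
    also have "\<dots> = card ?V" using l(1) by (simp add: card_positions)
    finally have "\<not> (\<forall>w. length w = 2 ^ l \<longrightarrow> (w \<in> accepted_language M \<longleftrightarrow> odd (card {v \<in> ?V. w ! v})))"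
      by (rule A[OF positions_subset])
    then obtain w where w: "length w = 2 ^ l" "\<not> (w \<in> ?L \<longleftrightarrow> odd (card {v \<in> ?V. w ! v}))"
      unfolding M(2) by blast
    obtain v where "evaluates machine w (running_time l) m v (init_config machine w)"
      "v = odd (card {u \<in> ?V. w ! u})"
      using evaluates_init[of w] w(1) l(1) unfolding w(1) address_length_power by blast
    then have "w \<in> ?L \<longleftrightarrow> odd (card {u \<in> ?V. w ! u})"
      using evaluates_accepting[OF wf_machine] unfolding accepted_language_def by simp
    then show False using w(2) by blast
  qed
  moreover have "ATIME (\<lambda>n. (log 2 (real n)) ^ k) m \<subseteq> ATIME (\<lambda>n. (log 2 (real n)) ^ (k + 2)) m"
    by (rule ATIME_mono[OF log_power_bigo]) simp
  ultimately show ?thesis by blast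
qed

end
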